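(* Let $\mathfrak g$ be a simple finite-dimensional complex Lie algebra and $\kappa$ an invariant inner product on $\mathfrak g$ with $\kappa\neq\kappa_c$. Then $H^i(\mathfrak g[[t]],\mathfrak g,\mathbb V_\kappa)=0$ for all $i>0$, and $H^0(\mathfrak g[[t]],\mathfrak g,\mathbb V_\kappa)=\mathbb C$.
   Context: All vector spaces are over $\mathbb C$. An invariant inner product on $\mathfrak g$ means an invariant symmetric bilinear form (unique up to scalar). For such $\kappa$, $\widehat{\mathfrak g}_\kappa$ is the central extension $0\to\mathbb C K\to\widehat{\mathfrak g}_\kappa\to\mathfrak g((t))\to 0$, with $K$ central and $[A\otimes f,B\otimes g]=[A,B]\otimes fg-\kappa(A,B)\,\mathrm{Res}(f\,dg)\,K$. The vacuum module is $\mathbb V_\kappa=\mathrm{Ind}_{\mathfrak g[[t]]\oplus\mathbb C K}^{\widehat{\mathfrak g}_\kappa}\mathbb C$, where $\mathfrak g[[t]]$ acts on $\mathbb C$ by $0$ and $K$ by $1$. The critical inner product is $\kappa_c(x,y)=-\frac12\mathrm{Tr}(\mathrm{ad}\,x\,\mathrm{ad}\,y)$. $H^\bullet(\mathfrak g[[t]],\mathfrak g,\mathbb V_\kappa)$ is the cohomology of the relative Chevalley complex $C^\bullet(\mathfrak g[[t]],\mathfrak g,\mathbb V_\kappa)=(\mathbb V_\kappa\otimes\bigwedge^\bullet(\mathfrak g[[t]]/\mathfrak g)^* )^{\mathfrak g}$, where $\mathfrak g\subset\mathfrak g[[t]]$ is the subalgebra of constants and $^*$ denotes the continuous (topological) dual.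 *)

theory Defs
  imports
    "HOL-Analysis.Product_Vector"
    "HOL-Library.Poly_Mapping"
    "HOL-Combinatorics.Permutations"
    "HOL-Computational_Algebra.Formal_Laurent_Series"
    "HOL-Algebra.Module"
    "HOL-Algebra.AbelCoset"
begin

unbundle fps_syntax
notation fls_nth (infixl \<open>$$\<close> 75)

section \<open>Complex Lie algebras\<close>

locale complex_lie_algebra = vector_space s
  for s :: "complex \<Rightarrow> 'g::ab_group_add \<Rightarrow> 'g" +
  fixes br :: "'g \<Rightarrow> 'g \<Rightarrow> 'g"
  assumes br_linear_left: "Vector_Spaces.linear s s (\<lambda>x. br x y)"
    and br_linear_right: "Vector_Spaces.linear s s (br x)"
    and br_alternating: "br x x = 0"
    and jacobi: "br x (br y z) + br y (br z x) + br z (br x y) = 0"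
begin

definition lie_ideal :: "'g set \<Rightarrow> bool" where
  "lie_ideal I \<longleftrightarrow> subspace I \<and> (\<forall>x. \<forall>y\<in>I. br x y \<in> I)"

definition invariant_form :: "('g \<Rightarrow> 'g \<Rightarrow> complex) \<Rightarrow> bool" where
  "invariant_form \<kappa> \<longleftrightarrow>
     (\<forall>x. Vector_Spaces.linear s (*) (\<kappa> x)) \<and>
     (\<forall>x y. \<kappa> x y = \<kappa> y x) \<and>
     (\<forall>x y z. \<kappa> (br x y) z = \<kappa> x (br y z))"

text \<open>\<^term>\<open>extend_basis {}\<close> is an (arbitrarily chosen) basis of the whole space; the trace of an
  endomorphism of a finite-dimensional space does not depend on this choice.\<close>

definition trace :: "('g \<Rightarrow> 'g) \<Rightarrow> complex" where
  "trace f = (\<Sum>b\<in>extend_basis {}. representation (extend_basis {}) (f b) b)"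

definition critical_form :: "'g \<Rightarrow> 'g \<Rightarrow> complex" where
  "critical_form x y = - (1 / 2) * trace (br x \<circ> br y)"

end

locale simple_lie_algebra = complex_lie_algebra +
  assumes finite_dimensional: "\<exists>B. finite B \<and> span B = UNIV"
    and nonabelian: "\<exists>x y. br x y \<noteq> 0"
    and only_trivial_ideals: "lie_ideal I \<Longrightarrow> I = {0} \<or> I = UNIV"


section \<open>The affine Lie algebra\<close>

text \<open>Since \<open>\<gg>\<close> is finite-dimensional, \<open>\<gg>[[t]]\<close> and \<open>\<gg>((t))\<close> are the formal power and Laurent series
  with coefficients in \<open>\<gg>\<close>, the pure tensor \<open>A \<otimes> f\<close> being the series with coefficients \<open>f\<^sub>n A\<close>.\<close>

definition fps_scale :: "(complex \<Rightarrow> 'g::zero \<Rightarrow> 'g) \<Rightarrow> complex \<Rightarrow> 'g fps \<Rightarrow> 'g fps" where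
  "fps_scale s c f = Abs_fps (\<lambda>n. s c (f $ n))"

definition fps_bracket :: "('g::comm_monoid_add \<Rightarrow> 'g \<Rightarrow> 'g) \<Rightarrow> 'g fps \<Rightarrow> 'g fps \<Rightarrow> 'g fps" where
  "fps_bracket br f g = Abs_fps (\<lambda>n. \<Sum>i=0..n. br (f $ i) (g $ (n - i)))"

definition fls_scale :: "(complex \<Rightarrow> 'g::zero \<Rightarrow> 'g) \<Rightarrow> complex \<Rightarrow> 'g fls \<Rightarrow> 'g fls" where
  "fls_scale s c f = Abs_fls (\<lambda>n. s c (f $$ n))"

text \<open>The extension of a bilinear map \<open>\<beta>\<close> by \<open>\<beta>(A \<otimes> f, B \<otimes> g) = \<beta>(A, B) \<otimes> f g\<close>.\<close>

definition fls_bilinear ::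
    "('a::zero \<Rightarrow> 'b::zero \<Rightarrow> 'c::comm_monoid_add) \<Rightarrow> 'a fls \<Rightarrow> 'b fls \<Rightarrow> 'c fls" where
  "fls_bilinear \<beta> f g =
     Abs_fls (\<lambda>n. \<Sum>i=fls_subdegree f..n - fls_subdegree g. \<beta> (f $$ i) (g $$ (n - i)))"

text \<open>Termwise derivative, \<open>A \<otimes> g \<mapsto> A \<otimes> dg/dt\<close>; the library's \<^const>\<open>fls_deriv\<close> requires
  coefficients in a ring.\<close>

definition fls_deriv_coeffs :: "(complex \<Rightarrow> 'g::zero \<Rightarrow> 'g) \<Rightarrow> 'g fls \<Rightarrow> 'g fls" where
  "fls_deriv_coeffs s g = Abs_fls (\<lambda>n. s (of_int (n + 1)) (g $$ (n + 1)))"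

text \<open>As a vector space the central extension is \<open>\<gg>((t)) \<oplus> \<complex>K\<close>; the pair \<open>(f, a)\<close> stands for
  \<open>f + a K\<close>.\<close>

type_synonym 'g affine = "'g fls \<times> complex"

definition affine_scale ::
    "(complex \<Rightarrow> 'g::zero \<Rightarrow> 'g) \<Rightarrow> complex \<Rightarrow> 'g affine \<Rightarrow> 'g affine" where
  "affine_scale s c x = (fls_scale s c (fst x), c * snd x)"

definition affine_bracket ::
    "(complex \<Rightarrow> 'g::comm_monoid_add \<Rightarrow> 'g) \<Rightarrow> ('g \<Rightarrow> 'g \<Rightarrow> 'g) \<Rightarrow> ('g \<Rightarrow> 'g \<Rightarrow> complex) \<Rightarrow>
     'g affine \<Rightarrow> 'g affine \<Rightarrow> 'g affine" where
  "affine_bracket s br \<kappa> x y =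
     (fls_bilinear br (fst x) (fst y),
      - (fls_bilinear \<kappa> (fst x) (fls_deriv_coeffs s (fst y)) $$ (-1)))"

definition affine_plus :: "'g::zero affine set" where
  "affine_plus = {(fps_to_fls f, a) | f a. True}"


section \<open>Quotient spaces\<close>

definition quotient_space ::
    "(complex, 'm) module \<Rightarrow> 'm set \<Rightarrow> (complex, 'm set) module" where
  "quotient_space M N =
     \<lparr>carrier = a_rcosets\<^bsub>M\<^esub> N,
      mult = undefined, one = undefined,
      zero = N,
      add = set_add M,
      smult = (\<lambda>c X. \<Union>x\<in>X. N +>\<^bsub>M\<^esub> (c \<odot>\<^bsub>M\<^esub> x))\<rparr>"

definition scalar_space :: "(complex, complex) module" where
  "scalar_space =
     \<lparr>carrier = UNIV, mult = undefined, one = undefined, zero = 0, add = (+), smult = (*)\<rparr>"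

definition isomorphic_spaces ::
    "(complex, 'm) module \<Rightarrow> (complex, 'n) module \<Rightarrow> bool" where
  "isomorphic_spaces M N \<longleftrightarrow>
     (\<exists>f. bij_betw f (carrier M) (carrier N) \<and>
          (\<forall>x\<in>carrier M. \<forall>y\<in>carrier M. f (x \<oplus>\<^bsub>M\<^esub> y) = f x \<oplus>\<^bsub>N\<^esub> f y) \<and>
          (\<forall>c. \<forall>x\<in>carrier M. f (c \<odot>\<^bsub>M\<^esub> x) = c \<odot>\<^bsub>N\<^esub> f x))"


section \<open>Induced modules and the vacuum module\<close>

definition free_scale :: "complex \<Rightarrow> ('k \<Rightarrow>\<^sub>0 complex) \<Rightarrow> ('k \<Rightarrow>\<^sub>0 complex)" where
  "free_scale c p = Poly_Mapping.map ((*) c) p"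

lemma lookup_free_scale: "Poly_Mapping.lookup (free_scale c p) k = c * Poly_Mapping.lookup p k"
  by (simp add: free_scale_def Poly_Mapping.map.rep_eq when_def)

global_interpretation free: vector_space "free_scale :: complex \<Rightarrow> ('k \<Rightarrow>\<^sub>0 complex) \<Rightarrow> _"
  defines free_span = free.span
  by unfold_locales (rule poly_mapping_eqI; simp add: lookup_free_scale lookup_add algebra_simps)+

definition free_space :: "(complex, 'k \<Rightarrow>\<^sub>0 complex) module" where
  "free_space =
     \<lparr>carrier = UNIV, mult = undefined, one = undefined, zero = 0, add = (+), smult = free_scale\<rparr>"

abbreviation generator :: "'l list \<Rightarrow> 'm \<Rightarrow> ('l list \<times> 'm) \<Rightarrow>\<^sub>0 complex" where
  "generator u m \<equiv> Poly_Mapping.single (u, m) 1"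

text \<open>Let \<open>L\<close> be the Lie algebra with scalar multiplication \<open>s\<close> and bracket \<open>br\<close>, and \<open>M\<close> a module
  over a subalgebra \<open>H\<close> with scalar multiplication \<open>sM\<close> and action \<open>\<rho>\<close>. The induced module
  \<open>U(L) \<otimes>\<^bsub>U(H)\<^esub> M\<close> is presented by generators \<open>x\<^sub>1 \<cdots> x\<^sub>k \<otimes> m\<close>, encoded as pairs
  \<open>([x\<^sub>1, \<dots>, x\<^sub>k], m)\<close>. The relations say, in order: words are multilinear (giving the tensor
  algebra of \<open>L\<close>), \<open>x y - y x = [x, y]\<close> (giving \<open>U(L)\<close>), linearity in \<open>m\<close>, and
  \<open>u h \<otimes> m = u \<otimes> h m\<close> for \<open>h \<in> H\<close>.\<close>

inductive_set induced_relations ::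
    "(complex \<Rightarrow> 'l::ab_group_add \<Rightarrow> 'l) \<Rightarrow> ('l \<Rightarrow> 'l \<Rightarrow> 'l) \<Rightarrow> 'l set \<Rightarrow>
     (complex \<Rightarrow> 'm::ab_group_add \<Rightarrow> 'm) \<Rightarrow> ('l \<Rightarrow> 'm \<Rightarrow> 'm) \<Rightarrow> (('l list \<times> 'm) \<Rightarrow>\<^sub>0 complex) set"
  for s br H sM \<rho> where
  word_linear:
    "generator (u @ (s c x + y) # w) m
       - (free_scale c (generator (u @ x # w) m) + generator (u @ y # w) m)
       \<in> induced_relations s br H sM \<rho>"
| commutator:
    "generator (u @ x # y # w) m - generator (u @ y # x # w) m - generator (u @ br x y # w) m
       \<in> induced_relations s br H sM \<rho>"
| vector_linear:
    "generator u (sM c m + m') - (free_scale c (generator u m) + generator u m')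
       \<in> induced_relations s br H sM \<rho>"
| balanced:
    "h \<in> H \<Longrightarrow> generator (u @ [h]) m - generator u (\<rho> h m) \<in> induced_relations s br H sM \<rho>"

definition induced_module ::
    "(complex \<Rightarrow> 'l::ab_group_add \<Rightarrow> 'l) \<Rightarrow> ('l \<Rightarrow> 'l \<Rightarrow> 'l) \<Rightarrow> 'l set \<Rightarrow>
     (complex \<Rightarrow> 'm::ab_group_add \<Rightarrow> 'm) \<Rightarrow> ('l \<Rightarrow> 'm \<Rightarrow> 'm) \<Rightarrow>
     (complex, (('l list \<times> 'm) \<Rightarrow>\<^sub>0 complex) set) module" where
  "induced_module s br H sM \<rho> =
     quotient_space free_space (free_span (induced_relations s br H sM \<rho>))"

definition prepend_letter ::
    "'l \<Rightarrow> (('l list \<times> 'm) \<Rightarrow>\<^sub>0 complex) \<Rightarrow> (('l list \<times> 'm) \<Rightarrow>\<^sub>0 complex)" where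
  "prepend_letter x p =
     (\<Sum>(u, m)\<in>Poly_Mapping.keys p. Poly_Mapping.single (x # u, m) (Poly_Mapping.lookup p (u, m)))"

definition induced_action ::
    "(complex \<Rightarrow> 'l::ab_group_add \<Rightarrow> 'l) \<Rightarrow> ('l \<Rightarrow> 'l \<Rightarrow> 'l) \<Rightarrow> 'l set \<Rightarrow>
     (complex \<Rightarrow> 'm::ab_group_add \<Rightarrow> 'm) \<Rightarrow> ('l \<Rightarrow> 'm \<Rightarrow> 'm) \<Rightarrow>
     'l \<Rightarrow> (('l list \<times> 'm) \<Rightarrow>\<^sub>0 complex) set \<Rightarrow> (('l list \<times> 'm) \<Rightarrow>\<^sub>0 complex) set" where
  "induced_action s br H sM \<rho> x X =
     (\<Union>p\<in>X. free_span (induced_relations s br H sM \<rho>) +>\<^bsub>free_space\<^esub> prepend_letter x p)"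

type_synonym 'g vacuum = "(('g affine list \<times> complex) \<Rightarrow>\<^sub>0 complex) set"

text \<open>\<open>f + a K\<close> with \<open>f \<in> \<gg>[[t]]\<close> acts on \<open>\<complex>\<close> as the scalar \<open>a\<close>.\<close>

definition vacuum_module ::
    "(complex \<Rightarrow> 'g::ab_group_add \<Rightarrow> 'g) \<Rightarrow> ('g \<Rightarrow> 'g \<Rightarrow> 'g) \<Rightarrow> ('g \<Rightarrow> 'g \<Rightarrow> complex) \<Rightarrow>
     (complex, 'g vacuum) module" where
  "vacuum_module s br \<kappa> =
     induced_module (affine_scale s) (affine_bracket s br \<kappa>) affine_plus (*) (\<lambda>x z. snd x * z)"

definition vacuum_action ::
    "(complex \<Rightarrow> 'g::ab_group_add \<Rightarrow> 'g) \<Rightarrow> ('g \<Rightarrow> 'g \<Rightarrow> 'g) \<Rightarrow> ('g \<Rightarrow> 'g \<Rightarrow> complex) \<Rightarrow>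
     'g affine \<Rightarrow> 'g vacuum \<Rightarrow> 'g vacuum" where
  "vacuum_action s br \<kappa> =
     induced_action (affine_scale s) (affine_bracket s br \<kappa>) affine_plus (*) (\<lambda>x z. snd x * z)"


section \<open>The relative Chevalley complex\<close>

text \<open>\<open>(\<gg>[[t]]/\<gg>)\<^sup>*\<close>, as the functionals on \<open>\<gg>[[t]]\<close> that vanish on the constants and are continuous
  for the \<open>t\<close>-adic topology, which is the topology of \<^typ>\<open>'g fps\<close> in the library. A linear functional
  is continuous iff it kills some \<open>t\<^sup>N \<gg>[[t]]\<close>, whether \<open>\<complex>\<close> is discrete or has its usual topology.\<close>

definition continuous_dual ::
    "(complex \<Rightarrow> 'g::ab_group_add \<Rightarrow> 'g) \<Rightarrow> ('g fps \<Rightarrow> complex) set" where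
  "continuous_dual s =
     {\<xi>. Vector_Spaces.linear (fps_scale s) (*) \<xi> \<and> continuous_on UNIV \<xi> \<and>
         (\<forall>a. \<xi> (fps_const a) = 0)}"

text \<open>\<open>V \<otimes> \<And>\<^sup>n(\<gg>[[t]]/\<gg>)\<^sup>*\<close> is realised inside the \<open>V\<close>-valued functions of \<open>n\<close> arguments in
  \<open>\<gg>[[t]]\<close>, as the span of the \<open>v \<otimes> \<xi>\<^sub>1 \<and> \<dots> \<and> \<xi>\<^sub>n\<close>, the latter being
  \<open>(x\<^sub>1, \<dots>, x\<^sub>n) \<mapsto> det (\<xi>\<^sub>i(x\<^sub>j)) v\<close>. Arguments are given as lists, and cochains of degree \<open>n\<close> are
  set to zero on lists of other lengths.\<close>

definition wedge :: "('x \<Rightarrow> complex) list \<Rightarrow> 'x list \<Rightarrow> complex" where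
  "wedge \<xi>s xs =
     (\<Sum>p | p permutes {..<length \<xi>s}. of_int (sign p) * (\<Prod>i<length \<xi>s. (\<xi>s ! i) (xs ! p i)))"

definition pure_cochain ::
    "(complex, 'm) module \<Rightarrow> 'm \<Rightarrow> ('x \<Rightarrow> complex) list \<Rightarrow> 'x list \<Rightarrow> 'm" where
  "pure_cochain M v \<xi>s xs =
     (if length xs = length \<xi>s then wedge \<xi>s xs \<odot>\<^bsub>M\<^esub> v else \<zero>\<^bsub>M\<^esub>)"

inductive_set tensor_wedge ::
    "(complex, 'm) module \<Rightarrow> ('x \<Rightarrow> complex) set \<Rightarrow> nat \<Rightarrow> ('x list \<Rightarrow> 'm) set"
  for M D n where
  zero: "(\<lambda>_. \<zero>\<^bsub>M\<^esub>) \<in> tensor_wedge M D n"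
| add_pure:
    "\<lbrakk>\<phi> \<in> tensor_wedge M D n; v \<in> carrier M; length \<xi>s = n; set \<xi>s \<subseteq> D\<rbrakk>
     \<Longrightarrow> (\<lambda>xs. \<phi> xs \<oplus>\<^bsub>M\<^esub> pure_cochain M v \<xi>s xs) \<in> tensor_wedge M D n"

text \<open>For a module \<open>M\<close> over \<open>\<gg>[[t]]\<close> with action \<open>act\<close>, the second condition below is invariance
  under \<open>\<gg>\<close>.\<close>

definition relative_cochains ::
    "(complex \<Rightarrow> 'g::ab_group_add \<Rightarrow> 'g) \<Rightarrow> ('g \<Rightarrow> 'g \<Rightarrow> 'g) \<Rightarrow>
     (complex, 'm) module \<Rightarrow> ('g fps \<Rightarrow> 'm \<Rightarrow> 'm) \<Rightarrow> nat \<Rightarrow> ('g fps list \<Rightarrow> 'm) set" where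
  "relative_cochains s br M act n =
     {\<phi> \<in> tensor_wedge M (continuous_dual s) n.
        \<forall>a xs. length xs = n \<longrightarrow>
          act (fps_const a) (\<phi> xs) \<ominus>\<^bsub>M\<^esub>
            (\<Oplus>\<^bsub>M\<^esub>i\<in>{..<n}. \<phi> (xs[i := fps_bracket br (fps_const a) (xs ! i)])) = \<zero>\<^bsub>M\<^esub>}"

definition chevalley_differential ::
    "('g::ab_group_add \<Rightarrow> 'g \<Rightarrow> 'g) \<Rightarrow> (complex, 'm) module \<Rightarrow> ('g fps \<Rightarrow> 'm \<Rightarrow> 'm) \<Rightarrow> nat \<Rightarrow>
     ('g fps list \<Rightarrow> 'm) \<Rightarrow> ('g fps list \<Rightarrow> 'm)" where
  "chevalley_differential br M act n \<phi> xs =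
     (if length xs = n + 1 then
        (\<Oplus>\<^bsub>M\<^esub>i\<in>{..n}. (-1) ^ i \<odot>\<^bsub>M\<^esub> act (xs ! i) (\<phi> (nths xs (- {i})))) \<oplus>\<^bsub>M\<^esub>
        (\<Oplus>\<^bsub>M\<^esub>j\<in>{..n}. \<Oplus>\<^bsub>M\<^esub>i\<in>{..<j}.
           (-1) ^ (i + j) \<odot>\<^bsub>M\<^esub> \<phi> (fps_bracket br (xs ! i) (xs ! j) # nths xs (- {i, j})))
      else \<zero>\<^bsub>M\<^esub>)"

definition cochain_space ::
    "(complex, 'm) module \<Rightarrow> ('x list \<Rightarrow> 'm) set \<Rightarrow> (complex, 'x list \<Rightarrow> 'm) module" where
  "cochain_space M C =
     \<lparr>carrier = C, mult = undefined, one = undefined,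
      zero = (\<lambda>_. \<zero>\<^bsub>M\<^esub>),
      add = (\<lambda>\<phi> \<psi> xs. \<phi> xs \<oplus>\<^bsub>M\<^esub> \<psi> xs),
      smult = (\<lambda>c \<phi> xs. c \<odot>\<^bsub>M\<^esub> \<phi> xs)\<rparr>"

definition relative_cocycles ::
    "(complex \<Rightarrow> 'g::ab_group_add \<Rightarrow> 'g) \<Rightarrow> ('g \<Rightarrow> 'g \<Rightarrow> 'g) \<Rightarrow>
     (complex, 'm) module \<Rightarrow> ('g fps \<Rightarrow> 'm \<Rightarrow> 'm) \<Rightarrow> nat \<Rightarrow> ('g fps list \<Rightarrow> 'm) set" where
  "relative_cocycles s br M act n =
     {\<phi> \<in> relative_cochains s br M act n. chevalley_differential br M act n \<phi> = (\<lambda>_. \<zero>\<^bsub>M\<^esub>)}"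

definition relative_coboundaries ::
    "(complex \<Rightarrow> 'g::ab_group_add \<Rightarrow> 'g) \<Rightarrow> ('g \<Rightarrow> 'g \<Rightarrow> 'g) \<Rightarrow>
     (complex, 'm) module \<Rightarrow> ('g fps \<Rightarrow> 'm \<Rightarrow> 'm) \<Rightarrow> nat \<Rightarrow> ('g fps list \<Rightarrow> 'm) set" where
  "relative_coboundaries s br M act n =
     (if n = 0 then {\<lambda>_. \<zero>\<^bsub>M\<^esub>}
      else chevalley_differential br M act (n - 1) ` relative_cochains s br M act (n - 1))"

definition relative_cohomology ::
    "(complex \<Rightarrow> 'g::ab_group_add \<Rightarrow> 'g) \<Rightarrow> ('g \<Rightarrow> 'g \<Rightarrow> 'g) \<Rightarrow>
     (complex, 'm) module \<Rightarrow> ('g fps \<Rightarrow> 'm \<Rightarrow> 'm) \<Rightarrow> nat \<Rightarrow>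
     (complex, ('g fps list \<Rightarrow> 'm) set) module" where
  "relative_cohomology s br M act n =
     quotient_space (cochain_space M (relative_cocycles s br M act n))
       (relative_coboundaries s br M act n)"

text \<open>\<open>H\<^sup>n(\<gg>[[t]], \<gg>, V\<^sub>\<kappa>)\<close>; \<open>\<gg>[[t]]\<close> is a subalgebra of the affine Lie algebra because the cocycle
  vanishes on it.\<close>

definition vacuum_cohomology ::
    "(complex \<Rightarrow> 'g::ab_group_add \<Rightarrow> 'g) \<Rightarrow> ('g \<Rightarrow> 'g \<Rightarrow> 'g) \<Rightarrow> ('g \<Rightarrow> 'g \<Rightarrow> complex) \<Rightarrow> nat \<Rightarrow>
     (complex, ('g fps list \<Rightarrow> 'g vacuum) set) module" where
  "vacuum_cohomology s br \<kappa> n =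
     relative_cohomology s br (vacuum_module s br \<kappa>)
       (\<lambda>f. vacuum_action s br \<kappa> (fps_to_fls f, 0)) n"

end

theory Submission imports Defs begin

text \<open>Put \<open>\<Omega> = \<kappa> - \<kappa>\<^sub>c\<close>. This form is nonzero and invariant, hence nondegenerate, so there are
  bases \<open>J\<^sub>a\<close> and \<open>J\<^sup>a\<close> of \<open>\<gg>\<close> that are dual with respect to \<open>\<Omega>\<close>. On the relative cochains consider
  \<open>h = \<Sum>\<^sub>a \<Sum>\<^sub>q\<^sub>>\<^sub>0 (J\<^sup>a t\<^sup>-\<^sup>q + 1/2 ad\<^sup>*(J\<^sup>a t\<^sup>-\<^sup>q)) \<iota>(J\<^sub>a t\<^sup>q)\<close>, where \<open>J\<^sup>a t\<^sup>-\<^sup>q\<close> acts on the coefficients and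
  \<open>ad\<^sup>*\<close> is the coadjoint action on \<open>(t\<gg>[[t]])\<^sup>*\<close>. As in the Nakano identity, \<open>d h + h d\<close> is the Sugawara
  operator on the coefficients plus the degree of the arguments, minus half the Casimir operator of the
  diagonal action of \<open>\<gg>\<close>. The latter vanishes on invariant cochains, so the total energy operator is
  null-homotopic. Its eigenvalues are nonnegative integers, and \<open>0\<close> is not attained in positive cochain
  degree; hence the cohomology vanishes there. In degree \<open>0\<close> a vector killed by \<open>\<gg>[[t]]\<close> has energy \<open>0\<close> and
  is a multiple of the vacuum, which is nonzero because its vacuum expectation value is \<open>1\<close>.\<close>

text \<open>The scale of the dual bases is the point of \<Omega>: in d h + h d the central term
  contributes \<kappa>, the repeated brackets contribute the Killing form, and for bases dual with
  respect to \<kappa> plus half the Killing form the two add up to exactly the degree. Three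
  obstacles shape the rest. The sum over q is infinite; but a finite sum of pure tensors sees only
  argument degrees below some N, and its values are killed by all modes from N on, so h is truncated
  at N. The elements J t^-q do not preserve g[[t]] and act on arguments only through the quotient of
  g((t)) by g[t^-1]; hence the identity is verified on monomials of positive degree, and
  g-invariance together with vanishing on constants carries it to all arguments. Finally, the energy
  has to be inverted inside the invariant cocycles; a product of linear factors that annihilates the
  given cochain achieves this. Cartan's formula defines d recursively in the first argument, which
  turns the Nakano identity into an induction on the list of arguments.\<close>

lemma additive_fun_sum:
  fixes f :: "'a::ab_group_add \<Rightarrow> 'b::ab_group_add"
  assumes "\<And>x y. f (x + y) = f x + f y"
  shows "f (sum g S) = (\<Sum>i\<in>S. f (g i))"
  using additive.sum[OF additive.intro, of f, OF assms] .

lemma additive_fun_zero: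
  fixes f :: "'a::ab_group_add \<Rightarrow> 'b::ab_group_add"
  assumes "\<And>x y. f (x + y) = f x + f y"
  shows "f 0 = 0"
  using assms[of 0 0] by simp

lemma additive_fun_minus:
  fixes f :: "'a::ab_group_add \<Rightarrow> 'b::ab_group_add"
  assumes "\<And>x y. f (x + y) = f x + f y"
  shows "f (- x) = - f x"
  using additive.minus[OF additive.intro, of f, OF assms] .

lemma additive_fun_diff:
  fixes f :: "'a::ab_group_add \<Rightarrow> 'b::ab_group_add"
  assumes "\<And>x y. f (x + y) = f x + f y"
  shows "f (x - y) = f x - f y"
  using additive.diff[OF additive.intro, of f, OF assms] .

section \<open>Laurent series with coefficients in a vector space\<close>

text \<open>Subdegrees behave badly under sums and brackets. A common lower bound lets all
  convolution sums of an identity run over the same interval, so that they can be compared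
  termwise.\<close>

lemma fls_common_bound:
  fixes f :: "'a::zero fls" and g :: "'b::zero fls" and h :: "'c::zero fls"
  obtains N :: int where "N \<ge> 0" "\<And>i. i < - N \<Longrightarrow> f $$ i = 0" "\<And>i. i < - N \<Longrightarrow> g $$ i = 0"
    "\<And>i. i < - N \<Longrightarrow> h $$ i = 0"
proof -
  obtain a where "\<forall>n<a. f $$ n = 0" by (rule fls_nth_vanishes_belowE)
  moreover obtain b where "\<forall>n<b. g $$ n = 0" by (rule fls_nth_vanishes_belowE)
  moreover obtain c where "\<forall>n<c. h $$ n = 0" by (rule fls_nth_vanishes_belowE)
  ultimately show thesis
    by (intro that[of "max 0 (max (- a) (max (- b) (- c)))"]) auto
qed

text \<open>The summation limits in \<open>fls_bilinear\<close> come from the subdegrees; any lower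
  bounds serve as well, since every term gained or lost has a zero factor.\<close>

lemma fls_bilinear_nth:
  fixes \<beta> :: "'a::zero \<Rightarrow> 'b::zero \<Rightarrow> 'c::comm_monoid_add"
  assumes z: "\<And>y. \<beta> 0 y = 0" "\<And>x. \<beta> x 0 = 0"
    and f: "\<And>i. i < a \<Longrightarrow> f $$ i = 0" and g: "\<And>i. i < b \<Longrightarrow> g $$ i = 0"
  shows "fls_bilinear \<beta> f g $$ n = (\<Sum>i=a..n-b. \<beta> (f $$ i) (g $$ (n - i)))"
proof -
  have "fls_bilinear \<beta> f g $$ n
      = (\<Sum>i=fls_subdegree f..n - fls_subdegree g. \<beta> (f $$ i) (g $$ (n - i)))"
    unfolding fls_bilinear_def
    by (rule nth_Abs_fls_lower_bound[of "fls_subdegree f + fls_subdegree g"]) auto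
  also have "\<dots> = (\<Sum>i=a..n-b. \<beta> (f $$ i) (g $$ (n - i)))"
  proof (rule sum.mono_neutral_cong)
    fix i assume "i \<in> {a..n - b} - {fls_subdegree f..n - fls_subdegree g}"
    then have "i < fls_subdegree f \<or> n - i < fls_subdegree g" by auto
    then show "\<beta> (f $$ i) (g $$ (n - i)) = 0" using z by auto
  next
    fix i assume "i \<in> {fls_subdegree f..n - fls_subdegree g} - {a..n - b}"
    then have "i < a \<or> n - i < b" by auto
    then show "\<beta> (f $$ i) (g $$ (n - i)) = 0" using z f g by auto
  qed auto
  finally show ?thesis .
qed

lemma fls_scale_nth:
  assumes "s c 0 = 0"
  shows "fls_scale s c f $$ n = s c (f $$ n)"
proof -
  obtain N where "\<forall>n<N. f $$ n = 0" by (rule fls_nth_vanishes_belowE)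
  then show ?thesis unfolding fls_scale_def
    by (intro nth_Abs_fls_lower_bound[of N]) (auto simp: assms)
qed

lemma fls_deriv_coeffs_nth:
  assumes "\<And>c. s c 0 = 0"
  shows "fls_deriv_coeffs s f $$ n = s (of_int (n + 1)) (f $$ (n + 1))"
proof -
  obtain N where "\<forall>n<N. f $$ n = 0" by (rule fls_nth_vanishes_belowE)
  then show ?thesis unfolding fls_deriv_coeffs_def
    by (intro nth_Abs_fls_lower_bound[of "N - 1"]) (auto simp: assms)
qed

text \<open>The substitution k = i + j turns a convolution nested on the left into a double sum over
  a square, the shape that a convolution nested on the right also takes. The corner of the square
  added to the triangle carries only zeros.\<close>

lemma sum_triangle_reindex:
  fixes h :: "int \<Rightarrow> int \<Rightarrow> 'a::comm_monoid_add"
  assumes h: "\<And>i j. i + j > n + N \<Longrightarrow> h i j = 0" and N: "N \<ge> 0"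
  shows "(\<Sum>k=-2*N..n+N. \<Sum>i=-N..k+N. h i (k - i)) = (\<Sum>i=-N..n+2*N. \<Sum>j=-N..n+2*N. h i j)"
proof -
  have "(\<Sum>i=-N..n+2*N. \<Sum>j=-N..n+2*N. h i j) = (\<Sum>(i, j)\<in>{-N..n+2*N} \<times> {-N..n+2*N}. h i j)"
    by (simp add: sum.cartesian_product)
  also have "\<dots> = (\<Sum>(i, j)\<in>{(i, j). - N \<le> i \<and> - N \<le> j \<and> i + j \<le> n + N}. h i j)"
  proof (rule sum.mono_neutral_right)
    show "\<forall>x\<in>{-N..n+2*N} \<times> {-N..n+2*N} - {(i, j). - N \<le> i \<and> - N \<le> j \<and> i + j \<le> n + N}.
        (case x of (i, j) \<Rightarrow> h i j) = 0"
      using h by force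
  qed (use N in auto)
  also have "\<dots> = (\<Sum>(k, i)\<in>Sigma {-2*N..n+N} (\<lambda>k. {-N..k+N}). h i (k - i))"
    by (rule sum.reindex_bij_witness[of _ "\<lambda>(k, i). (i, k - i)" "\<lambda>(i, j). (i + j, i)"]) auto
  finally show ?thesis by (simp add: sum.Sigma)
qed

definition fls_mono :: "'g::zero \<Rightarrow> int \<Rightarrow> 'g fls" where
  "fls_mono b p = Abs_fls (\<lambda>n. if n = p then b else 0)"

lemma fls_mono_nth [simp]: "fls_mono b p $$ n = (if n = p then b else 0)"
  by (simp add: fls_mono_def)

section \<open>The affine bracket\<close>

context complex_lie_algebra
begin

lemma linear_map_add: "Vector_Spaces.linear a b f \<Longrightarrow> f (x + y) = f x + f y"
  and linear_map_scale: "Vector_Spaces.linear a b f \<Longrightarrow> f (a c x) = b c (f x)"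
  by (metis Vector_Spaces.linear_def module_hom.add, metis Vector_Spaces.linear_def module_hom.scale)

lemma br_add_left [simp]: "br (x + y) z = br x z + br y z"
  and br_scale_left [simp]: "br (s c x) z = s c (br x z)"
  using br_linear_left[of z] by (auto dest: linear_map_add linear_map_scale)

lemma br_add_right [simp]: "br x (y + z) = br x y + br x z"
  and br_scale_right [simp]: "br x (s c z) = s c (br x z)"
  using br_linear_right[of x] by (auto dest: linear_map_add linear_map_scale)

lemma br_zero [simp]: "br 0 x = 0" "br x 0 = 0"
  and br_minus [simp]: "br (- x) y = - br x y" "br x (- y) = - br x y"
  and br_diff [simp]: "br (x - z) y = br x y - br z y" "br x (y - z) = br x y - br x z"
  by (simp_all add: additive_fun_zero[of "\<lambda>x. br x y" for y] additive_fun_zero[of "\<lambda>y. br x y" for x]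
      additive_fun_minus[of "\<lambda>x. br x y" for y] additive_fun_minus[of "\<lambda>y. br x y" for x]
      additive_fun_diff[of "\<lambda>x. br x y" for y] additive_fun_diff[of "\<lambda>y. br x y" for x])

lemma br_sum_left: "br (sum f S) y = (\<Sum>i\<in>S. br (f i) y)"
  and br_sum_right: "br y (sum f S) = (\<Sum>i\<in>S. br y (f i))"
  by (rule additive_fun_sum, simp)+

lemma br_swap: "br x y = - br y x"
proof -
  have "br x y + br y x = br (x + y) (x + y)"
    by (simp add: br_alternating[of x] br_alternating[of y] del: br_zero)
  then show ?thesis by (simp only: br_alternating eq_neg_iff_add_eq_0)
qed

lemma br_leibniz: "br x (br y z) = br (br x y) z + br y (br x z)"
proof -
  have "br y (br z x) = - br y (br x z)" "br z (br x y) = - br (br x y) z"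
    using br_swap by (metis br_minus(2))+
  then show ?thesis using jacobi[of x y z] by (simp add: algebra_simps)
qed

lemma fps_bracket_nth: "fps_bracket br f g $ n = (\<Sum>i=0..n. br (f $ i) (g $ (n - i)))"
  by (simp add: fps_bracket_def)

lemma affine_scale_components [simp]:
  "fst (affine_scale s c x) $$ n = s c (fst x $$ n)" "snd (affine_scale s c x) = c * snd x"
  by (simp_all add: affine_scale_def fls_scale_nth)

lemma affine_bracket_fst:
  assumes "\<And>i. i < a \<Longrightarrow> fst x $$ i = 0" "\<And>i. i < b \<Longrightarrow> fst y $$ i = 0"
  shows "fst (affine_bracket s br \<kappa> x y) $$ n = (\<Sum>i=a..n-b. br (fst x $$ i) (fst y $$ (n - i)))"
  unfolding affine_bracket_def fst_conv by (rule fls_bilinear_nth) (use assms in auto)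

lemma affine_eqI:
  fixes x y :: "'g affine"
  assumes "\<And>n. fst x $$ n = fst y $$ n" "snd x = snd y" shows "x = y"
  using assms by (auto intro!: prod_eqI fls_eqI)

end

locale lie_algebra_form = complex_lie_algebra s br
  for s :: "complex \<Rightarrow> 'g::ab_group_add \<Rightarrow> 'g" and br +
  fixes \<kappa> :: "'g \<Rightarrow> 'g \<Rightarrow> complex"
  assumes invariant: "invariant_form \<kappa>"
begin

abbreviation abr :: "'g affine \<Rightarrow> 'g affine \<Rightarrow> 'g affine" where
  "abr \<equiv> affine_bracket s br \<kappa>"

lemma form_sym: "\<kappa> x y = \<kappa> y x"
  and form_invariant: "\<kappa> (br x y) z = \<kappa> x (br y z)"
  and form_add_right [simp]: "\<kappa> x (y + z) = \<kappa> x y + \<kappa> x z"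
  and form_scale_right [simp]: "\<kappa> x (s c z) = c * \<kappa> x z"
proof -
  have "Vector_Spaces.linear s (*) (\<kappa> x)" for x using invariant by (simp add: invariant_form_def)
  then show "\<kappa> x (y + z) = \<kappa> x y + \<kappa> x z" "\<kappa> x (s c z) = c * \<kappa> x z"
    by (auto dest: linear_map_add linear_map_scale)
qed (use invariant in \<open>auto simp: invariant_form_def\<close>)

lemma form_add_left [simp]: "\<kappa> (y + z) x = \<kappa> y x + \<kappa> z x"
  and form_scale_left [simp]: "\<kappa> (s c z) x = c * \<kappa> z x"
  by (metis form_sym form_add_right, metis form_sym form_scale_right)

lemma form_zero [simp]: "\<kappa> 0 x = 0" "\<kappa> x 0 = 0"
  and form_minus [simp]: "\<kappa> (- x) y = - \<kappa> x y" "\<kappa> x (- y) = - \<kappa> x y"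
  by (simp_all add: additive_fun_zero[of "\<lambda>x. \<kappa> x y" for y] additive_fun_zero[of "\<lambda>y. \<kappa> x y" for x]
      additive_fun_minus[of "\<lambda>x. \<kappa> x y" for y] additive_fun_minus[of "\<lambda>y. \<kappa> x y" for x])

lemma form_sum_left: "\<kappa> (sum f S) y = (\<Sum>i\<in>S. \<kappa> (f i) y)"
  and form_sum_right: "\<kappa> y (sum f S) = (\<Sum>i\<in>S. \<kappa> y (f i))"
  by (rule additive_fun_sum, simp)+

text \<open>The residue pairs the coefficient of index i with that of index -i. Differentiating t^-i
  brings out -i, which cancels the sign in the definition of the bracket.\<close>

lemma affine_bracket_snd:
  assumes "\<And>i. i < a \<Longrightarrow> fst x $$ i = 0" "\<And>i. i < b \<Longrightarrow> fst y $$ i = 0"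
  shows "snd (abr x y) = (\<Sum>i=a..-b. of_int i * \<kappa> (fst x $$ i) (fst y $$ (- i)))"
proof -
  have "fls_bilinear \<kappa> (fst x) (fls_deriv_coeffs s (fst y)) $$ (-1)
     = (\<Sum>i=a..-1-(b-1). \<kappa> (fst x $$ i) (fls_deriv_coeffs s (fst y) $$ (-1 - i)))"
    by (rule fls_bilinear_nth) (use assms in \<open>auto simp: fls_deriv_coeffs_nth\<close>)
  also have "\<dots> = - (\<Sum>i=a..-b. of_int i * \<kappa> (fst x $$ i) (fst y $$ (- i)))"
    by (simp add: fls_deriv_coeffs_nth sum_negf)
  finally show ?thesis by (simp add: affine_bracket_def)
qed

lemma affine_bracket_add_right: "abr x (y + z) = abr x y + abr x z"
  and affine_bracket_add_left: "abr (y + z) x = abr y x + abr z x"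
proof -
  obtain N where N: "\<And>i. i < - N \<Longrightarrow> fst x $$ i = 0" "\<And>i. i < - N \<Longrightarrow> fst y $$ i = 0"
    "\<And>i. i < - N \<Longrightarrow> fst z $$ i = 0" by (rule fls_common_bound[of "fst x" "fst y" "fst z"]) blast
  show "abr x (y + z) = abr x y + abr x z" "abr (y + z) x = abr y x + abr z x"
    by (rule affine_eqI; simp add: affine_bracket_fst[of "-N" _ "-N"] affine_bracket_snd[of "-N" _ "-N"]
        N sum.distrib algebra_simps)+
qed

lemma affine_bracket_scale_right: "abr x (affine_scale s c y) = affine_scale s c (abr x y)"
  and affine_bracket_scale_left: "abr (affine_scale s c x) y = affine_scale s c (abr x y)"
proof -
  obtain N where N: "\<And>i. i < - N \<Longrightarrow> fst x $$ i = 0" "\<And>i. i < - N \<Longrightarrow> fst y $$ i = 0"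
    "\<And>i. i < - N \<Longrightarrow> fst y $$ i = 0" by (rule fls_common_bound[of "fst x" "fst y" "fst y"]) blast
  show "abr x (affine_scale s c y) = affine_scale s c (abr x y)"
     "abr (affine_scale s c x) y = affine_scale s c (abr x y)"
    by (rule affine_eqI; simp add: affine_bracket_fst[of "-N" _ "-N"] affine_bracket_snd[of "-N" _ "-N"]
        N sum_distrib_left scale_sum_right mult.left_commute)+
qed

lemma affine_bracket_swap: "abr x y = - abr y x"
proof -
  obtain N where N: "\<And>i. i < - N \<Longrightarrow> fst x $$ i = 0" "\<And>i. i < - N \<Longrightarrow> fst y $$ i = 0"
    "\<And>i. i < - N \<Longrightarrow> fst y $$ i = 0" by (rule fls_common_bound[of "fst x" "fst y" "fst y"]) blast
  have 1: "(\<Sum>i=-N..n+N. br (fst x $$ i) (fst y $$ (n - i)))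
      = (\<Sum>i=-N..n+N. - br (fst y $$ i) (fst x $$ (n - i)))" for n
    by (rule sum.reindex_bij_witness[of _ "\<lambda>i. n - i" "\<lambda>i. n - i"]) (auto intro: br_swap[symmetric])
  have 2: "(\<Sum>i=-N..N. of_int i * \<kappa> (fst x $$ i) (fst y $$ (- i)))
      = (\<Sum>i=-N..N. - (of_int i * \<kappa> (fst y $$ i) (fst x $$ (- i))))"
    by (rule sum.reindex_bij_witness[of _ uminus uminus]) (auto intro: form_sym)
  show ?thesis
    by (rule affine_eqI; simp add: affine_bracket_fst[of "-N" _ "-N"] affine_bracket_snd[of "-N" _ "-N"]
        N 1 2 sum_negf)
qed

text \<open>All iterated brackets are written as double sums over one square of indices. The series
  component is then the Jacobi identity termwise. In the central component invariance of \<kappa>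
  brings every term to \<kappa>([z_i, x_j], y_(-i-j)), with coefficients i on the left and (i + j) -
  j on the right.\<close>

lemma affine_bracket_leibniz: "abr z (abr x y) = abr (abr z x) y + abr x (abr z y)"
proof -
  obtain N where N0: "N \<ge> 0" and N: "\<And>i. i < - N \<Longrightarrow> fst x $$ i = 0" "\<And>i. i < - N \<Longrightarrow> fst y $$ i = 0"
    "\<And>i. i < - N \<Longrightarrow> fst z $$ i = 0" by (rule fls_common_bound[of "fst x" "fst y" "fst z"]) blast
  note nth = affine_bracket_fst[of "-N" _ "-N"]
  \<comment> \<open>A bracket of two series starting at -N starts at -2N, hence the wider ranges in
    the outer sums.\<close>
  have low: "fst (abr u v) $$ i = 0" if "i < - 2 * N" "\<And>i. i < - N \<Longrightarrow> fst u $$ i = 0"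
    "\<And>i. i < - N \<Longrightarrow> fst v $$ i = 0" for i u v
    using that by (simp add: nth)
  have R: "fst (abr u (abr v w)) $$ n
      = (\<Sum>i=-N..n+2*N. \<Sum>j=-N..n+2*N. br (fst u $$ i) (br (fst v $$ j) (fst w $$ (n - i - j))))"
    if uvw: "\<And>i. i < - N \<Longrightarrow> fst u $$ i = 0" "\<And>i. i < - N \<Longrightarrow> fst v $$ i = 0" "\<And>i. i < - N \<Longrightarrow> fst w $$ i = 0"
    for u v w n
  proof -
    have "fst (abr u (abr v w)) $$ n = (\<Sum>i=-N..n-(-2*N). br (fst u $$ i) (fst (abr v w) $$ (n - i)))"
      by (rule affine_bracket_fst) (use uvw low in auto)
    also have "\<dots> = (\<Sum>i=-N..n+2*N. \<Sum>j=-N..n-i+N. br (fst u $$ i) (br (fst v $$ j) (fst w $$ (n - i - j))))"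
      by (simp add: nth uvw br_sum_right)
    also have "\<dots> = (\<Sum>i=-N..n+2*N. \<Sum>j=-N..n+2*N. br (fst u $$ i) (br (fst v $$ j) (fst w $$ (n - i - j))))"
      by (intro sum.cong sum.mono_neutral_left) (use uvw in auto)
    finally show ?thesis .
  qed
  have L: "fst (abr (abr z x) y) $$ n
      = (\<Sum>i=-N..n+2*N. \<Sum>j=-N..n+2*N. br (br (fst z $$ i) (fst x $$ j)) (fst y $$ (n - i - j)))" for n
  proof -
    have "fst (abr (abr z x) y) $$ n = (\<Sum>k=-2*N..n-(-N). br (fst (abr z x) $$ k) (fst y $$ (n - k)))"
      by (rule affine_bracket_fst) (use N low in auto)
    also have "\<dots> = (\<Sum>k=-2*N..n+N. \<Sum>i=-N..k+N. br (br (fst z $$ i) (fst x $$ (k - i))) (fst y $$ (n - i - (k - i))))"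
      by (simp add: nth N br_sum_left)
    also have "\<dots> = (\<Sum>i=-N..n+2*N. \<Sum>j=-N..n+2*N. br (br (fst z $$ i) (fst x $$ j)) (fst y $$ (n - i - j)))"
      by (rule sum_triangle_reindex) (use N N0 in auto)
    finally show ?thesis .
  qed
  have Rs: "snd (abr u (abr v w))
      = (\<Sum>i=-N..2*N. \<Sum>j=-N..2*N. of_int i * \<kappa> (fst u $$ i) (br (fst v $$ j) (fst w $$ (- i - j))))"
    if uvw: "\<And>i. i < - N \<Longrightarrow> fst u $$ i = 0" "\<And>i. i < - N \<Longrightarrow> fst v $$ i = 0" "\<And>i. i < - N \<Longrightarrow> fst w $$ i = 0"
    for u v w
  proof -
    have "snd (abr u (abr v w)) = (\<Sum>i=-N..-(-2*N). of_int i * \<kappa> (fst u $$ i) (fst (abr v w) $$ (- i)))"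
      by (rule affine_bracket_snd) (use uvw low in auto)
    also have "\<dots> = (\<Sum>i=-N..2*N. \<Sum>j=-N..-i+N. of_int i * \<kappa> (fst u $$ i) (br (fst v $$ j) (fst w $$ (- i - j))))"
      by (simp add: nth uvw form_sum_right sum_distrib_left)
    also have "\<dots> = (\<Sum>i=-N..2*N. \<Sum>j=-N..2*N. of_int i * \<kappa> (fst u $$ i) (br (fst v $$ j) (fst w $$ (- i - j))))"
      by (intro sum.cong sum.mono_neutral_left) (use uvw in auto)
    finally show ?thesis .
  qed
  have Ls: "snd (abr (abr z x) y)
      = (\<Sum>i=-N..2*N. \<Sum>j=-N..2*N. of_int (i + j) * \<kappa> (br (fst z $$ i) (fst x $$ j)) (fst y $$ (- i - j)))"
  proof -
    have "snd (abr (abr z x) y) = (\<Sum>k=-2*N..-(-N). of_int k * \<kappa> (fst (abr z x) $$ k) (fst y $$ (- k)))"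
      by (rule affine_bracket_snd) (use N low in auto)
    also have "\<dots> = (\<Sum>k=-2*N..0+N. \<Sum>i=-N..k+N. of_int (i + (k - i)) * \<kappa> (br (fst z $$ i) (fst x $$ (k - i))) (fst y $$ (- i - (k - i))))"
      by (simp add: nth N form_sum_left sum_distrib_left)
    also have "\<dots> = (\<Sum>i=-N..0+2*N. \<Sum>j=-N..0+2*N. of_int (i + j) * \<kappa> (br (fst z $$ i) (fst x $$ j)) (fst y $$ (- i - j)))"
      by (rule sum_triangle_reindex) (use N N0 in auto)
    finally show ?thesis by simp
  qed
  have f: "\<kappa> a (br b c) = \<kappa> (br a b) c" "\<kappa> b (br a c) = - \<kappa> (br a b) c" for a b c
    using form_invariant br_swap form_minus by (metis, metis)
  show ?thesis
  proof (rule affine_eqI)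
    fix n
    have "fst (abr x (abr z y)) $$ n
      = (\<Sum>i=-N..n+2*N. \<Sum>j=-N..n+2*N. br (fst x $$ j) (br (fst z $$ i) (fst y $$ (n - i - j))))"
      by (subst sum.swap) (simp add: R N algebra_simps)
    then show "fst (abr z (abr x y)) $$ n = fst (abr (abr z x) y + abr x (abr z y)) $$ n"
      by (simp add: R L N sum.distrib[symmetric] br_leibniz[of "fst z $$ _"])
  next
    have "snd (abr x (abr z y))
      = (\<Sum>i=-N..2*N. \<Sum>j=-N..2*N. of_int j * \<kappa> (fst x $$ j) (br (fst z $$ i) (fst y $$ (- i - j))))"
      by (subst sum.swap) (simp add: Rs N minus_diff_commute)
    then have xs: "snd (abr x (abr z y))
      = (\<Sum>i=-N..2*N. \<Sum>j=-N..2*N. - (of_int j * \<kappa> (br (fst z $$ i) (fst x $$ j)) (fst y $$ (- i - j))))"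
      by (simp only: f(2) mult_minus_right)
    have zs: "snd (abr z (abr x y))
      = (\<Sum>i=-N..2*N. \<Sum>j=-N..2*N. of_int i * \<kappa> (fst z $$ i) (br (fst x $$ j) (fst y $$ (- i - j))))"
      by (rule Rs) (use N in auto)
    show "snd (abr z (abr x y)) = snd (abr (abr z x) y + abr x (abr z y))"
      unfolding snd_add xs Ls zs sum.distrib[symmetric]
      by (intro sum.cong refl) (simp add: f(1) algebra_simps)
  qed
qed

lemma affine_bracket_mono:
  "abr (fls_mono b p, u) (fls_mono c q, v)
    = (fls_mono (br b c) (p + q), if p + q = 0 then of_int p * \<kappa> b c else 0)"
proof (rule affine_eqI)
  fix n
  have "fst (abr (fls_mono b p, u) (fls_mono c q, v)) $$ n
     = (\<Sum>i=p..n-q. br (fls_mono b p $$ i) (fls_mono c q $$ (n - i)))"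
    by (subst affine_bracket_fst[of p _ q]) auto
  also have "\<dots> = (\<Sum>i=p..n-q. if i = p then (if n = p + q then br b c else 0) else 0)"
    by (rule sum.cong) auto
  also have "\<dots> = (if n = p + q then br b c else 0)"
    by (subst sum.delta) auto
  finally show "fst (abr (fls_mono b p, u) (fls_mono c q, v)) $$ n
    = fst (fls_mono (br b c) (p + q), if p + q = 0 then of_int p * \<kappa> b c else 0) $$ n" by simp
next
  have "snd (abr (fls_mono b p, u) (fls_mono c q, v))
     = (\<Sum>i=p..-q. of_int i * \<kappa> (fls_mono b p $$ i) (fls_mono c q $$ (- i)))"
    by (subst affine_bracket_snd[of p _ q]) auto
  also have "\<dots> = (\<Sum>i=p..-q. if i = p then (if p + q = 0 then of_int p * \<kappa> b c else 0) else 0)"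
    by (rule sum.cong) auto
  also have "\<dots> = (if p + q = 0 then of_int p * \<kappa> b c else 0)"
    by (subst sum.delta) auto
  finally show "snd (abr (fls_mono b p, u) (fls_mono c q, v))
    = snd (fls_mono (br b c) (p + q), if p + q = 0 then of_int p * \<kappa> b c else 0)" by simp
qed

lemma affine_bracket_fps:
  "abr (fps_to_fls f, u) (fps_to_fls g, v) = (fps_to_fls (fps_bracket br f g), 0)"
proof (rule affine_eqI)
  fix n
  have "fst (abr (fps_to_fls f, u) (fps_to_fls g, v)) $$ n
     = (\<Sum>i=0..n. br (fps_to_fls f $$ i) (fps_to_fls g $$ (n - i)))"
    by (subst affine_bracket_fst[of 0 _ 0]) auto
  also have "\<dots> = fps_to_fls (fps_bracket br f g) $$ n"
  proof (cases "n < 0")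
    case False
    then show ?thesis
      by (simp add: fps_bracket_nth) (rule sum.reindex_bij_witness[of _ int nat]; auto simp: nat_diff_distrib')
  qed auto
  finally show "fst (abr (fps_to_fls f, u) (fps_to_fls g, v)) $$ n = fst (fps_to_fls (fps_bracket br f g), 0) $$ n"
    by simp
qed (subst affine_bracket_snd[of 0 _ 0]; simp)

lemma affine_bracket_central: "abr (0, a) x = 0" "abr x (0, a) = 0"
proof -
  obtain N where N: "\<And>i. i < N \<Longrightarrow> fst x $$ i = 0" by (rule fls_nth_vanishes_belowE) blast
  show "abr x (0, a) = 0"
    by (rule affine_eqI; simp add: N affine_bracket_fst[of "N" _ 0] affine_bracket_snd[of "N" _ 0])
  then show "abr (0, a) x = 0" by (subst affine_bracket_swap) simp
qed

end

section \<open>Operators on functions of a list of arguments\<close>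

text \<open>Cochains are functions on lists of every length, and a slot is addressed by splitting
  the list. Such conditions pass to \<open>\<lambda>ys. \<phi> (x # ys)\<close>, the contraction
  with x, which is what the inductions on argument lists need.\<close>

definition slot_additive :: "('x::plus list \<Rightarrow> 'v::plus) \<Rightarrow> bool" where
  "slot_additive \<phi> \<longleftrightarrow> (\<forall>us x y vs. \<phi> (us @ (x + y) # vs) = \<phi> (us @ x # vs) + \<phi> (us @ y # vs))"

definition slot_homogeneous ::
    "(complex \<Rightarrow> 'x \<Rightarrow> 'x) \<Rightarrow> (complex \<Rightarrow> 'v \<Rightarrow> 'v) \<Rightarrow> ('x list \<Rightarrow> 'v) \<Rightarrow> bool" where
  "slot_homogeneous sx sv \<phi> \<longleftrightarrow> (\<forall>us c x vs. \<phi> (us @ sx c x # vs) = sv c (\<phi> (us @ x # vs)))"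

text \<open>Adjacent swaps generate all permutations, and over the complex numbers the sign rule
  already forces vanishing on equal neighbours.\<close>

definition slot_alternating :: "('x list \<Rightarrow> 'v::uminus) \<Rightarrow> bool" where
  "slot_alternating \<phi> \<longleftrightarrow> (\<forall>us x y vs. \<phi> (us @ x # y # vs) = - \<phi> (us @ y # x # vs))"

definition slot_vanishing :: "('x \<Rightarrow> bool) \<Rightarrow> ('x list \<Rightarrow> 'v::zero) \<Rightarrow> bool" where
  "slot_vanishing P \<phi> \<longleftrightarrow> (\<forall>us x vs. P x \<longrightarrow> \<phi> (us @ x # vs) = 0)"

lemma slot_additive_insert: "slot_additive \<phi> \<Longrightarrow> slot_additive (\<lambda>ys. \<phi> (x # ys))"
  unfolding slot_additive_def by (metis append_Cons)

lemma slot_homogeneous_insert: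
  "slot_homogeneous sx sv \<phi> \<Longrightarrow> slot_homogeneous sx sv (\<lambda>ys. \<phi> (x # ys))"
  unfolding slot_homogeneous_def by (metis append_Cons)

lemma slot_alternating_insert: "slot_alternating \<phi> \<Longrightarrow> slot_alternating (\<lambda>ys. \<phi> (x # ys))"
  unfolding slot_alternating_def by (metis append_Cons)

lemma slot_vanishing_insert: "slot_vanishing P \<phi> \<Longrightarrow> slot_vanishing P (\<lambda>ys. \<phi> (x # ys))"
  unfolding slot_vanishing_def by (metis append_Cons)

lemma slot_additiveD: "slot_additive \<phi> \<Longrightarrow> \<phi> (us @ (x + y) # vs) = \<phi> (us @ x # vs) + \<phi> (us @ y # vs)"
  unfolding slot_additive_def by blast

lemma slot_homogeneousD: "slot_homogeneous sx sv \<phi> \<Longrightarrow> \<phi> (us @ sx c x # vs) = sv c (\<phi> (us @ x # vs))"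
  unfolding slot_homogeneous_def by blast

lemma slot_additive_first: "slot_additive \<phi> \<Longrightarrow> \<phi> ((x + y) # zs) = \<phi> (x # zs) + \<phi> (y # zs)"
  unfolding slot_additive_def by (metis append_Nil)

lemma slot_homogeneous_first: "slot_homogeneous sx sv \<phi> \<Longrightarrow> \<phi> (sx c x # zs) = sv c (\<phi> (x # zs))"
  unfolding slot_homogeneous_def by (metis append_Nil)

lemma slot_vanishing_first: "slot_vanishing P \<phi> \<Longrightarrow> P x \<Longrightarrow> \<phi> (x # zs) = 0"
  unfolding slot_vanishing_def by (metis append_Nil)

lemma slot_alternatingD: "slot_alternating \<phi> \<Longrightarrow> \<phi> (us @ x # y # vs) = - \<phi> (us @ y # x # vs)"
  unfolding slot_alternating_def by blast

lemma slot_alternating_first: "slot_alternating \<phi> \<Longrightarrow> \<phi> (x # y # zs) = - \<phi> (y # x # zs)"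
  unfolding slot_alternating_def by (metis append_Nil)

lemma slot_additive_second:
  "slot_additive \<phi> \<Longrightarrow> \<phi> (u # (x + y) # zs) = \<phi> (u # x # zs) + \<phi> (u # y # zs)"
  using slot_additive_first[OF slot_additive_insert] .

lemma slot_homogeneous_second:
  "slot_homogeneous sx sv \<phi> \<Longrightarrow> \<phi> (u # sx c x # zs) = sv c (\<phi> (u # x # zs))"
  using slot_homogeneous_first[OF slot_homogeneous_insert] .

lemma slot_vanishing_second: "slot_vanishing P \<phi> \<Longrightarrow> P x \<Longrightarrow> \<phi> (u # x # zs) = 0"
  using slot_vanishing_first[OF slot_vanishing_insert] .

lemma slot_additive_zero:
  fixes \<phi> :: "'x::ab_group_add list \<Rightarrow> 'v::ab_group_add"
  assumes "slot_additive \<phi>"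
  shows "\<phi> (us @ 0 # vs) = 0"
  by (rule additive_fun_zero[of "\<lambda>x. \<phi> (us @ x # vs)"]) (use assms in \<open>auto simp: slot_additive_def\<close>)

lemma slot_additive_zero_first:
  fixes \<phi> :: "'x::ab_group_add list \<Rightarrow> 'v::ab_group_add"
  assumes "slot_additive \<phi>"
  shows "\<phi> (0 # vs) = 0" "\<phi> (u # 0 # vs) = 0"
  using slot_additive_zero[OF assms, of "[]"] slot_additive_zero[OF assms, of "[u]"] by auto

lemma slot_additive_minus_first:
  fixes \<phi> :: "'x::ab_group_add list \<Rightarrow> 'v::ab_group_add"
  assumes "slot_additive \<phi>"
  shows "\<phi> (- x # vs) = - \<phi> (x # vs)" "\<phi> ((x - y) # vs) = \<phi> (x # vs) - \<phi> (y # vs)"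
    "\<phi> (u # (- x) # vs) = - \<phi> (u # x # vs)" "\<phi> (u # (x - y) # vs) = \<phi> (u # x # vs) - \<phi> (u # y # vs)"
  using additive_fun_minus[of "\<lambda>x. \<phi> (x # vs)"] additive_fun_diff[of "\<lambda>x. \<phi> (x # vs)"]
    additive_fun_minus[of "\<lambda>x. \<phi> (u # x # vs)"] additive_fun_diff[of "\<lambda>x. \<phi> (u # x # vs)"]
    slot_additive_first[OF assms] slot_additive_second[OF assms] by blast+

text \<open>The action on multilinear functions dual to the endomorphism \<open>T\<close> of the arguments.\<close>

fun slot_der :: "('x \<Rightarrow> 'x) \<Rightarrow> ('x list \<Rightarrow> 'v::ab_group_add) \<Rightarrow> 'x list \<Rightarrow> 'v" where
  "slot_der T \<phi> [] = 0"
| "slot_der T \<phi> (x # xs) = slot_der T (\<lambda>ys. \<phi> (x # ys)) xs - \<phi> (T x # xs)"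

lemma slot_der_add: "slot_der T (\<lambda>ys. \<phi> ys + \<psi> ys) xs = slot_der T \<phi> xs + slot_der T \<psi> xs"
  by (induction T \<phi> xs arbitrary: \<psi> rule: slot_der.induct) auto

lemma slot_der_hom:
  fixes f :: "'v::ab_group_add \<Rightarrow> 'w::ab_group_add"
  assumes "\<And>x y. f (x + y) = f x + f y"
  shows "slot_der T (\<lambda>ys. f (\<phi> ys)) xs = f (slot_der T \<phi> xs)"
  by (induction T \<phi> xs rule: slot_der.induct)
    (auto simp: additive_fun_zero[of f, OF assms] additive_fun_diff[of f, OF assms])

lemma slot_der_minus: "slot_der T (\<lambda>ys. - \<phi> ys) xs = - slot_der T \<phi> xs"
  by (rule slot_der_hom) simp

lemma slot_der_zero: "slot_der T (\<lambda>ys. 0) xs = 0"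
  by (induction xs) auto

lemma slot_der_sum: "slot_der T (\<lambda>ys. \<Sum>i\<in>I. \<phi> i ys) xs = (\<Sum>i\<in>I. slot_der T (\<phi> i) xs)"
  by (induction I rule: infinite_finite_induct) (auto simp: slot_der_zero slot_der_add)

lemma slot_der_cong:
  assumes "\<And>x. x \<in> set xs \<Longrightarrow> T x = T' x"
  shows "slot_der T \<phi> xs = slot_der T' \<phi> xs"
  using assms by (induction T \<phi> xs rule: slot_der.induct) auto

lemma slot_der_diff: "slot_der T (\<lambda>ys. \<phi> ys - \<psi> ys) xs = slot_der T \<phi> xs - slot_der T \<psi> xs"
  using slot_der_add[of T \<phi> "\<lambda>ys. - \<psi> ys"] by (simp add: slot_der_minus)

text \<open>Contributions in which S and T hit different slots are symmetric and cancel; those in a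
  common slot give the commutator. The minus sign in \<open>slot_der\<close> makes the dual action a
  representation instead of reversing the order.\<close>

lemma slot_der_commutator:
  fixes \<phi> :: "'x::ab_group_add list \<Rightarrow> 'v::ab_group_add"
  assumes "slot_additive \<phi>"
  shows "slot_der S (slot_der T \<phi>) xs - slot_der T (slot_der S \<phi>) xs
    = slot_der (\<lambda>x. S (T x) - T (S x)) \<phi> xs"
  using assms
proof (induction xs arbitrary: \<phi>)
  case (Cons x xs)
  have "slot_der U (slot_der W \<phi>) (x # xs) = slot_der U (slot_der W (\<lambda>ys. \<phi> (x # ys))) xs
      - slot_der U (\<lambda>ys. \<phi> (W x # ys)) xs - (slot_der W (\<lambda>ys. \<phi> (U x # ys)) xs - \<phi> (W (U x) # xs))" for U W
    by (simp add: slot_der_diff)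
  then show ?case
    using Cons.IH[OF slot_additive_insert[OF Cons.prems], of x]
    by (simp add: slot_additive_minus_first[OF Cons.prems] algebra_simps)
qed simp

lemma slot_additive_slot_der:
  fixes \<phi> :: "'x::ab_group_add list \<Rightarrow> 'v::ab_group_add"
  assumes "slot_additive \<phi>" and T: "\<And>x y. T (x + y) = T x + T y"
  shows "slot_additive (slot_der T \<phi>)"
proof -
  have "slot_der T \<phi> (us @ (x + y) # vs) = slot_der T \<phi> (us @ x # vs) + slot_der T \<phi> (us @ y # vs)" for us x y vs
    using assms(1)
  proof (induction us arbitrary: \<phi>)
    case Nil
    then show ?case by (simp add: T slot_additive_first slot_additive_second slot_der_add)
  next
    case (Cons u us)
    then show ?case
      using Cons.IH[OF slot_additive_insert[OF Cons.prems], of u] slot_additive_insert[OF Cons.prems, of "T u"]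
      by (simp add: slot_additive_def)
  qed
  then show ?thesis by (simp add: slot_additive_def)
qed

lemma slot_homogeneous_slot_der:
  fixes \<phi> :: "'x list \<Rightarrow> 'v::ab_group_add"
  assumes "slot_homogeneous sx sv \<phi>" and T: "\<And>c x. T (sx c x) = sx c (T x)"
    and sv: "\<And>c x y. sv c (x + y) = sv c x + sv c y"
  shows "slot_homogeneous sx sv (slot_der T \<phi>)"
proof -
  have "slot_der T \<phi> (us @ sx c x # vs) = sv c (slot_der T \<phi> (us @ x # vs))" for us c x vs
    using assms(1)
  proof (induction us arbitrary: \<phi>)
    case Nil
    then show ?case
      by (simp add: T slot_homogeneous_first[of sx sv \<phi>] slot_der_hom[of "sv c", OF sv] additive_fun_diff[of "sv c", OF sv])
  next
    case (Cons u us)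
    then show ?case
      using Cons.IH[OF slot_homogeneous_insert[OF Cons.prems], of u] slot_homogeneous_insert[OF Cons.prems, of "T u"]
      by (simp add: slot_homogeneous_def additive_fun_diff[of "sv c", OF sv])
  qed
  then show ?thesis by (simp add: slot_homogeneous_def)
qed

lemma slot_alternating_slot_der:
  assumes "slot_alternating \<phi>"
  shows "slot_alternating (slot_der T \<phi>)"
proof -
  have "slot_der T \<phi> (us @ x # y # vs) = - slot_der T \<phi> (us @ y # x # vs)" for us x y vs
    using assms(1)
  proof (induction us arbitrary: \<phi>)
    case Nil
    have "(\<lambda>ys. \<phi> (x # y # ys)) = (\<lambda>ys. - \<phi> (y # x # ys))"
      using slot_alternating_first[OF Nil] by blast
    then show ?case
      by (simp add: slot_der_minus slot_alternating_first[OF Nil, of x "T y" vs]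
          slot_alternating_first[OF Nil, of "T x" y vs])
  next
    case (Cons u us)
    then show ?case
      using Cons.IH[OF slot_alternating_insert[OF Cons.prems], of u]
        slot_alternatingD[OF Cons.prems, of "T u # us" x y vs]
      by simp
  qed
  then show ?thesis unfolding slot_alternating_def by blast
qed

text \<open>There are two predicates because an operator such as multiplication by t^-q lowers
  degrees: for T x to vanish far enough, x has to vanish further.\<close>

lemma slot_vanishing_slot_der:
  assumes "slot_vanishing P \<phi>" and T: "\<And>x. Q x \<Longrightarrow> P x \<and> P (T x)"
  shows "slot_vanishing Q (slot_der T \<phi>)"
proof -
  have "slot_der T \<phi> (us @ x # vs) = 0" if "Q x" for us x vs
    using assms(1)
  proof (induction us arbitrary: \<phi>)
    case Nil
    then show ?case using that T by (simp add: slot_vanishing_first[of P \<phi>] slot_der_zero)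
  next
    case (Cons u us)
    then show ?case
      using Cons.IH[OF slot_vanishing_insert[OF Cons.prems], of u] slot_vanishing_insert[OF Cons.prems, of "T u"] that T
      by (simp add: slot_vanishing_def)
  qed
  then show ?thesis by (simp add: slot_vanishing_def)
qed

text \<open>The Chevalley differential, defined by Cartan's formula \<open>\<iota>\<^sub>x d + d \<iota>\<^sub>x = L\<^sub>x\<close>.\<close>

definition lie_der ::
    "('x \<Rightarrow> 'v \<Rightarrow> 'v::ab_group_add) \<Rightarrow> ('x \<Rightarrow> 'x \<Rightarrow> 'x) \<Rightarrow> 'x \<Rightarrow> ('x list \<Rightarrow> 'v) \<Rightarrow> 'x list \<Rightarrow> 'v" where
  "lie_der act ad x \<phi> xs = act x (\<phi> xs) + slot_der (ad x) \<phi> xs"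

fun cartan_diff ::
    "('x \<Rightarrow> 'v \<Rightarrow> 'v::ab_group_add) \<Rightarrow> ('x \<Rightarrow> 'x \<Rightarrow> 'x) \<Rightarrow> ('x list \<Rightarrow> 'v) \<Rightarrow> 'x list \<Rightarrow> 'v" where
  "cartan_diff act ad \<phi> [] = 0"
| "cartan_diff act ad \<phi> (x # xs) = lie_der act ad x \<phi> xs - cartan_diff act ad (\<lambda>ys. \<phi> (x # ys)) xs"

lemma lie_der_insert:
  "lie_der act ad y \<phi> (x # xs) = lie_der act ad y (\<lambda>ys. \<phi> (x # ys)) xs - \<phi> (ad y x # xs)"
  by (simp add: lie_der_def)

lemma cartan_diff_hom:
  fixes f :: "'v::ab_group_add \<Rightarrow> 'v"
  assumes f: "\<And>x y. f (x + y) = f x + f y" "\<And>x v. act x (f v) = f (act x v)"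
  shows "cartan_diff act ad (\<lambda>ys. f (\<phi> ys)) xs = f (cartan_diff act ad \<phi> xs)"
  by (induction xs arbitrary: \<phi>)
    (auto simp: lie_der_def slot_der_hom f additive_fun_zero[of f, OF f(1)] additive_fun_diff[of f, OF f(1)])

text \<open>Twice a summand of the homotopy operator, so that no halves occur.\<close>

definition homotopy_term ::
    "('v \<Rightarrow> 'v::ab_group_add) \<Rightarrow> ('x \<Rightarrow> 'x) \<Rightarrow> 'x \<Rightarrow> ('x list \<Rightarrow> 'v) \<Rightarrow> 'x list \<Rightarrow> 'v" where
  "homotopy_term R T u \<phi> zs = R (\<phi> (u # zs)) + R (\<phi> (u # zs)) + slot_der T (\<lambda>ys. \<phi> (u # ys)) zs"

context
  fixes act :: "'x::ab_group_add \<Rightarrow> 'v::ab_group_add \<Rightarrow> 'v" and ad :: "'x \<Rightarrow> 'x \<Rightarrow> 'x"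
  assumes act_add: "\<And>x v w. act x (v + w) = act x v + act x w"
begin

lemma lie_der_add: "lie_der act ad x (\<lambda>ys. \<phi> ys + \<psi> ys) xs = lie_der act ad x \<phi> xs + lie_der act ad x \<psi> xs"
  by (simp add: lie_der_def slot_der_add act_add)

lemma cartan_diff_add:
  "cartan_diff act ad (\<lambda>ys. \<phi> ys + \<psi> ys) xs = cartan_diff act ad \<phi> xs + cartan_diff act ad \<psi> xs"
  by (induction xs arbitrary: \<phi> \<psi>) (auto simp: lie_der_add)

lemma cartan_diff_minus: "cartan_diff act ad (\<lambda>ys. - \<phi> ys) xs = - cartan_diff act ad \<phi> xs"
  by (rule cartan_diff_hom) (simp_all add: additive_fun_minus[of "act _", OF act_add])

lemma cartan_diff_zero: "cartan_diff act ad (\<lambda>ys. 0) xs = 0"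
  using cartan_diff_add[of "\<lambda>ys. 0" "\<lambda>ys. 0"] by simp

lemma cartan_diff_diff:
  "cartan_diff act ad (\<lambda>ys. \<phi> ys - \<psi> ys) xs = cartan_diff act ad \<phi> xs - cartan_diff act ad \<psi> xs"
  using cartan_diff_add[of \<phi> "\<lambda>ys. - \<psi> ys"] by (simp add: cartan_diff_minus)

lemma cartan_diff_sum:
  "cartan_diff act ad (\<lambda>ys. \<Sum>i\<in>I. \<phi> i ys) xs = (\<Sum>i\<in>I. cartan_diff act ad (\<phi> i) xs)"
  by (induction I rule: infinite_finite_induct) (auto simp: cartan_diff_zero cartan_diff_add)

text \<open>For the first two arguments, Cartan's formula applied twice leaves Lie derivative terms
  that enter antisymmetrically, the term \<phi>([x, y], ...), and the differential of \<phi>(x, y,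
  ...), each of which changes sign under the swap. Later slots follow from the contraction with the
  first argument.\<close>

lemma slot_alternating_cartan_diff:
  assumes "slot_alternating \<phi>" "slot_additive \<phi>" and ad: "\<And>x y. ad x y = - ad y x"
  shows "slot_alternating (cartan_diff act ad \<phi>)"
proof -
  have "cartan_diff act ad \<phi> (us @ x # y # vs) = - cartan_diff act ad \<phi> (us @ y # x # vs)" for us x y vs
    using assms(1,2)
  proof (induction us arbitrary: \<phi>)
    case Nil
    have "(\<lambda>ys. \<phi> (x # y # ys)) = (\<lambda>ys. - \<phi> (y # x # ys))"
      using slot_alternating_first[OF Nil(1)] by blast
    moreover have "\<phi> (ad x y # vs) = - \<phi> (ad y x # vs)"
      by (subst ad) (simp add: slot_additive_minus_first[OF Nil(2)])
    ultimately show ?case by (simp add: lie_der_insert cartan_diff_minus)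
  next
    case (Cons u us)
    show ?case
      using Cons.IH[OF slot_alternating_insert[OF Cons.prems(1)] slot_additive_insert[OF Cons.prems(2)], of u]
        slot_alternatingD[OF slot_alternating_slot_der[OF Cons.prems(1), of "ad u"], of us x y vs]
        slot_alternatingD[OF Cons.prems(1), of us x y vs]
      by (simp add: lie_der_def additive_fun_minus[of "act _", OF act_add])
  qed
  then show ?thesis unfolding slot_alternating_def by blast
qed

text \<open>An operator on values commutes with one on arguments, so only three corrections survive:
  the commutator of \<open>act y\<close> with R, that of \<open>ad y\<close> with T, and the
  replacement of the contracted element u by [y, u].\<close>

lemma lie_der_homotopy_term:
  assumes R: "\<And>x y. R (x + y) = R x + R y" and \<phi>: "slot_additive \<phi>"
  shows "lie_der act ad y (homotopy_term R T u \<phi>) zs - homotopy_term R T u (lie_der act ad y \<phi>) zs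
    = (act y (R (\<phi> (u # zs))) - R (act y (\<phi> (u # zs)))) + (act y (R (\<phi> (u # zs))) - R (act y (\<phi> (u # zs))))
      + R (\<phi> (ad y u # zs)) + R (\<phi> (ad y u # zs))
      + slot_der (\<lambda>x. ad y (T x) - T (ad y x)) (\<lambda>ys. \<phi> (u # ys)) zs
      + slot_der T (\<lambda>ys. \<phi> (ad y u # ys)) zs"
proof -
  have 1: "lie_der act ad y (homotopy_term R T u \<phi>) zs
    = act y (R (\<phi> (u # zs))) + act y (R (\<phi> (u # zs))) + act y (slot_der T (\<lambda>ys. \<phi> (u # ys)) zs)
      + R (slot_der (ad y) (\<lambda>ys. \<phi> (u # ys)) zs) + R (slot_der (ad y) (\<lambda>ys. \<phi> (u # ys)) zs)
      + slot_der (ad y) (slot_der T (\<lambda>ys. \<phi> (u # ys))) zs"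
    unfolding homotopy_term_def lie_der_def by (simp add: act_add slot_der_add slot_der_hom[of R, OF R])
  have 2: "homotopy_term R T u (lie_der act ad y \<phi>) zs
    = R (act y (\<phi> (u # zs))) + R (act y (\<phi> (u # zs)))
      + R (slot_der (ad y) (\<lambda>ys. \<phi> (u # ys)) zs) + R (slot_der (ad y) (\<lambda>ys. \<phi> (u # ys)) zs)
      - R (\<phi> (ad y u # zs)) - R (\<phi> (ad y u # zs))
      + act y (slot_der T (\<lambda>ys. \<phi> (u # ys)) zs)
      + slot_der T (slot_der (ad y) (\<lambda>ys. \<phi> (u # ys))) zs - slot_der T (\<lambda>ys. \<phi> (ad y u # ys)) zs"
    unfolding homotopy_term_def lie_der_insert
    unfolding lie_der_def
    by (simp add: R additive_fun_diff[of R, OF R] slot_der_add slot_der_diff slot_der_hom[of "act y", OF act_add]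
        algebra_simps)
  show ?thesis
    unfolding 1 2 slot_der_commutator[OF slot_additive_insert[OF \<phi>], symmetric] by (simp add: algebra_simps)
qed

lemma homotopy_term_insert:
  assumes R: "\<And>x y. R (x + y) = R x + R y" and \<phi>: "slot_alternating \<phi>"
  shows "homotopy_term R T u \<phi> (y # zs) = - homotopy_term R T u (\<lambda>ys. \<phi> (y # ys)) zs - \<phi> (u # T y # zs)"
proof -
  have "(\<lambda>ys. \<phi> (u # y # ys)) = (\<lambda>ys. - \<phi> (y # u # ys))"
    using slot_alternating_first[OF \<phi>] by blast
  then show ?thesis
    unfolding homotopy_term_def
    by (simp add: slot_der_minus slot_alternating_first[OF \<phi>, of u y] additive_fun_minus[of R, OF R])
qed

text \<open>This is the inductive step of the homotopy formula for a single summand. The terms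
  \<open>cartan_diff act ad \<phi> (u # T y # zs)\<close> from d h and h d cancel. Beyond the
  anticommutator for the contraction with y there remain a part acting on coefficients, a part
  acting on the arguments zs, and the contraction with [u, T y]; each is evaluated only after
  summation over dual bases and modes.\<close>

lemma homotopy_term_anticommutator:
  assumes R: "\<And>x y. R (x + y) = R x + R y" and \<phi>: "slot_additive \<phi>" "slot_alternating \<phi>"
    and ad: "\<And>x y. ad x y = - ad y x"
  shows "cartan_diff act ad (homotopy_term R T u \<phi>) (y # zs) + homotopy_term R T u (cartan_diff act ad \<phi>) (y # zs)
    = cartan_diff act ad (homotopy_term R T u (\<lambda>ys. \<phi> (y # ys))) zs
      + homotopy_term R T u (cartan_diff act ad (\<lambda>ys. \<phi> (y # ys))) zs
      + ((act y (R (\<phi> (u # zs))) - R (act y (\<phi> (u # zs)))) + (act y (R (\<phi> (u # zs))) - R (act y (\<phi> (u # zs))))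
        + R (\<phi> (ad y u # zs)) + R (\<phi> (ad y u # zs)) + act (T y) (\<phi> (u # zs)) - act u (\<phi> (T y # zs)))
      + (slot_der (\<lambda>x. ad y (T x) - T (ad y x)) (\<lambda>ys. \<phi> (u # ys)) zs
        + slot_der T (\<lambda>ys. \<phi> (ad y u # ys)) zs + slot_der (ad (T y)) (\<lambda>ys. \<phi> (u # ys)) zs
        - slot_der (ad u) (\<lambda>ys. \<phi> (T y # ys)) zs)
      + \<phi> (ad u (T y) # zs)"
proof -
  let ?d = "cartan_diff act ad" and ?h = "homotopy_term R T u" and ?L = "lie_der act ad"
  let ?i = "\<lambda>ys. \<phi> (y # ys)"
  have alt: "slot_alternating (?d \<phi>)" by (rule slot_alternating_cartan_diff) fact+
  have "?d (?h \<phi>) (y # zs) = ?L y (?h \<phi>) zs - ?d (\<lambda>ys. - ?h ?i ys - \<phi> (u # T y # ys)) zs"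
    by (simp add: homotopy_term_insert[OF R \<phi>(2)])
  also have "\<dots> = ?L y (?h \<phi>) zs + ?d (?h ?i) zs + ?d (\<lambda>ys. \<phi> (u # T y # ys)) zs"
    by (simp add: cartan_diff_minus cartan_diff_diff)
  also have "?d (\<lambda>ys. \<phi> (u # T y # ys)) zs
      = ?L (T y) (\<lambda>ys. \<phi> (u # ys)) zs - ?L u \<phi> (T y # zs) + ?d \<phi> (u # T y # zs)" by simp
  finally have 1: "?d (?h \<phi>) (y # zs) = ?L y (?h \<phi>) zs + ?d (?h ?i) zs
      + (?L (T y) (\<lambda>ys. \<phi> (u # ys)) zs - ?L u \<phi> (T y # zs) + ?d \<phi> (u # T y # zs))" .
  have "?h (?d \<phi>) (y # zs) = - ?h (\<lambda>ys. ?d \<phi> (y # ys)) zs - ?d \<phi> (u # T y # zs)"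
    by (rule homotopy_term_insert[OF R alt])
  also have "?h (\<lambda>ys. ?d \<phi> (y # ys)) zs = ?h (?L y \<phi>) zs - ?h (?d ?i) zs"
    unfolding homotopy_term_def cartan_diff.simps
    by (simp add: slot_der_diff additive_fun_diff[of R, OF R])
  finally have 2: "?h (?d \<phi>) (y # zs) = - (?h (?L y \<phi>) zs - ?h (?d ?i) zs) - ?d \<phi> (u # T y # zs)" .
  have 3: "?L (T y) (\<lambda>ys. \<phi> (u # ys)) zs - ?L u \<phi> (T y # zs)
     = act (T y) (\<phi> (u # zs)) + slot_der (ad (T y)) (\<lambda>ys. \<phi> (u # ys)) zs - act u (\<phi> (T y # zs))
      - slot_der (ad u) (\<lambda>ys. \<phi> (T y # ys)) zs + \<phi> (ad u (T y) # zs)"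
    by (simp add: lie_der_def)
  have 4: "?L y (?h \<phi>) zs = ?h (?L y \<phi>) zs + (?L y (?h \<phi>) zs - ?h (?L y \<phi>) zs)" by simp
  show ?thesis
    unfolding 1 2 3
    by (subst 4, subst lie_der_homotopy_term[OF R \<phi>(1)]) (simp add: algebra_simps)
qed

end

section \<open>Reindexing of sums over modes\<close>

lemma sum_shift_up:
  fixes g :: "int \<Rightarrow> 'v::comm_monoid_add"
  assumes "p \<ge> 0" "\<And>j. j \<ge> N \<Longrightarrow> g j = 0"
  shows "(\<Sum>q\<in>{1..<N}. g (p + q)) = (\<Sum>q\<in>{1..<N}. if p < q then g q else 0)"
proof -
  have "(\<Sum>q\<in>{1..<N}. g (p + q)) = (\<Sum>q\<in>{p+1..<p+N}. g q)"
    by (rule sum.reindex_bij_witness[of _ "\<lambda>q. q - p" "\<lambda>q. p + q"]) auto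
  also have "\<dots> = (\<Sum>q\<in>{1..<N}. if p < q then g q else 0)"
    by (rule sum.mono_neutral_cong) (use assms in auto)
  finally show ?thesis .
qed

lemma sum_reflect:
  fixes g :: "int \<Rightarrow> 'v::comm_monoid_add"
  assumes "\<And>j. j \<le> 0 \<Longrightarrow> g j = 0" "\<And>j. j \<ge> N \<Longrightarrow> g j = 0" "\<And>j. p - j \<ge> N \<Longrightarrow> g j = 0"
  shows "(\<Sum>q\<in>{1..<N}. g (p - q)) = (\<Sum>q\<in>{1..<N}. if q < p then g q else 0)"
proof -
  have "(\<Sum>q\<in>{1..<N}. g (p - q)) = (\<Sum>q\<in>{p-N+1..<p}. g q)"
    by (rule sum.reindex_bij_witness[of _ "\<lambda>q. p - q" "\<lambda>q. p - q"]) auto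
  also have "\<dots> = (\<Sum>q\<in>{1..<N}. if q < p then g q else 0)"
    by (rule sum.mono_neutral_cong) (use assms in auto)
  finally show ?thesis .
qed

text \<open>After a shift in g(p + q) and a reflection in g(p - q), each q other than p is counted
  twice with either sign; only the diagonal q = p survives.\<close>

lemma sum_modes_first_order:
  fixes g :: "int \<Rightarrow> 'v::ab_group_add"
  assumes p: "p > 0" and g: "\<And>j. j \<le> 0 \<Longrightarrow> g j = 0" "\<And>j. j \<ge> N \<Longrightarrow> g j = 0" "\<And>j. p - j \<ge> N \<Longrightarrow> g j = 0"
  shows "(\<Sum>q\<in>{1..<N}. g q + g q - g (p + q) - g (p + q) - (if q < p then g q else 0) - g (p - q)) = g p + g p"
proof -
  have "(\<Sum>q\<in>{1..<N}. g q + g q - g (p + q) - g (p + q) - (if q < p then g q else 0) - g (p - q))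
    = (\<Sum>q\<in>{1..<N}. g q + g q - (if p < q then g q else 0) - (if p < q then g q else 0)
        - (if q < p then g q else 0) - (if q < p then g q else 0))"
    using p g by (simp add: sum.distrib sum_subtractf sum_shift_up sum_reflect)
  also have "\<dots> = (\<Sum>q\<in>{1..<N}. if q = p then g p + g p else 0)"
    by (rule sum.cong) auto
  also have "\<dots> = g p + g p"
    using p g(2)[of p] by (subst sum.delta) auto
  finally show ?thesis .
qed

text \<open>The reflection q \<mapsto> p + r - q turns the part of \<alpha> cut off at r into a sum
  of \<gamma> up to p. Since \<alpha> - \<beta> = \<gamma>, the coefficients of \<gamma> q cancel
  for q < p and for q > p, and the diagonal term remains twice.\<close>

lemma sum_modes_second_order:
  fixes \<alpha> \<beta> \<gamma> :: "int \<Rightarrow> 'v::ab_group_add"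
  assumes pr: "p > 0" "r > 0" and ab: "\<And>j. \<alpha> j = \<beta> j + \<gamma> j" and alt: "\<And>j. \<alpha> j = - \<gamma> (p + r - j)"
    and \<gamma>: "\<And>j. j \<le> 0 \<or> j \<ge> N \<or> p + r - j \<ge> N \<or> p + r - j \<le> 0 \<Longrightarrow> \<gamma> j = 0"
  shows "(\<Sum>q\<in>{1..<N}. (if q < r then \<alpha> q else 0) - \<beta> q - \<gamma> (p + q) - (if q < p then \<gamma> q else 0) - \<gamma> (p - q))
    = \<gamma> p + \<gamma> p"
proof -
  have 1: "(\<Sum>q\<in>{1..<N}. \<gamma> (p + q)) = (\<Sum>q\<in>{1..<N}. if p < q then \<gamma> q else 0)"
    by (rule sum_shift_up) (use pr \<gamma> in auto)
  have 2: "(\<Sum>q\<in>{1..<N}. \<gamma> (p - q)) = (\<Sum>q\<in>{1..<N}. if q < p then \<gamma> q else 0)"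
    by (rule sum_reflect) (use pr \<gamma> in auto)
  have "(\<Sum>q\<in>{1..<N}. if q < r then \<alpha> q else 0)
      = (\<Sum>q\<in>{1..<N}. \<alpha> q + (if p + r - q \<le> p then \<gamma> (p + r - q) else 0))"
    by (rule sum.cong) (auto simp: alt)
  also have "\<dots> = (\<Sum>q\<in>{1..<N}. \<alpha> q) + (\<Sum>q\<in>{1..<N}. if q < p + r then if q \<le> p then \<gamma> q else 0 else 0)"
    unfolding sum.distrib
    by (subst sum_reflect[where g = "\<lambda>j. if j \<le> p then \<gamma> j else 0"]) (use pr \<gamma> in auto)
  finally have 3: "(\<Sum>q\<in>{1..<N}. if q < r then \<alpha> q else 0)
    = (\<Sum>q\<in>{1..<N}. \<alpha> q) + (\<Sum>q\<in>{1..<N}. if q < p + r then if q \<le> p then \<gamma> q else 0 else 0)" .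
  have "(\<Sum>q\<in>{1..<N}. (if q < r then \<alpha> q else 0) - \<beta> q - \<gamma> (p + q) - (if q < p then \<gamma> q else 0) - \<gamma> (p - q))
    = (\<Sum>q\<in>{1..<N}. \<alpha> q + (if q < p + r then if q \<le> p then \<gamma> q else 0 else 0) - \<beta> q - (if p < q then \<gamma> q else 0)
        - (if q < p then \<gamma> q else 0) - (if q < p then \<gamma> q else 0))"
    by (simp add: sum.distrib sum_subtractf 1 2 3)
  also have "\<dots> = (\<Sum>q\<in>{1..<N}. if q = p then \<gamma> p + \<gamma> p else 0)"
    by (rule sum.cong) (use pr in \<open>auto simp: ab\<close>)
  also have "\<dots> = \<gamma> p + \<gamma> p"
    using pr \<gamma>[of p] by (subst sum.delta) auto
  finally show ?thesis .
qed

lemma slot_der_add_map: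
  assumes "slot_additive \<phi>"
  shows "slot_der (\<lambda>x. T x + T' x) \<phi> xs = slot_der T \<phi> xs + slot_der T' \<phi> xs"
  using assms
proof (induction xs arbitrary: \<phi>)
  case (Cons x xs)
  then show ?case
    using Cons.IH[OF slot_additive_insert[OF Cons.prems], of x] slot_additive_first[OF Cons.prems]
    by simp
qed simp

lemma slot_der_scale_map:
  assumes "slot_homogeneous sx sv \<phi>" and sv: "\<And>c x y. sv c (x + y) = sv c x + sv c y"
  shows "slot_der (\<lambda>x. sx c (T x)) \<phi> xs = sv c (slot_der T \<phi> xs)"
  using assms(1)
proof (induction xs arbitrary: \<phi>)
  case Nil
  then show ?case by (simp add: additive_fun_zero[of "sv c", OF sv])
next
  case (Cons x xs)
  then show ?case
    using Cons.IH[OF slot_homogeneous_insert[OF Cons.prems], of x] slot_homogeneous_first[OF Cons.prems]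
    by (simp add: additive_fun_diff[of "sv c", OF sv])
qed

section \<open>Modules over the affine algebra\<close>

text \<open>The value 0 for p \<le> 0 is the image of b t^p in tg[[t]], seen as the quotient of
  g((t)) by g[t^-1]. Formulas with a shifted exponent such as p - q therefore truncate
  themselves.\<close>

definition pos_mono :: "'g::zero \<Rightarrow> int \<Rightarrow> 'g fps" where
  "pos_mono b p = Abs_fps (\<lambda>n. if 0 < p \<and> int n = p then b else 0)"

lemma pos_mono_nth: "pos_mono b p $ n = (if 0 < p \<and> int n = p then b else 0)"
  by (simp add: pos_mono_def)

lemma pos_mono_nonpos: "p \<le> 0 \<Longrightarrow> pos_mono b p = 0"
  by (rule fps_ext) (simp add: pos_mono_nth)

lemma pos_mono_zero [simp]: "pos_mono 0 p = 0"
  by (rule fps_ext) (simp add: pos_mono_nth)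

lemma pos_mono_add: "pos_mono (b + c :: 'g::monoid_add) p = pos_mono b p + pos_mono c p"
  by (rule fps_ext) (simp add: pos_mono_nth)

lemma pos_mono_minus: "pos_mono (- c :: 'g::group_add) p = - pos_mono c p"
  by (rule fps_ext) (simp add: pos_mono_nth)

lemma fps_to_fls_pos_mono: "fps_to_fls (pos_mono b p) = (if 0 < p then fls_mono b p else 0)"
  by (rule fls_eqI) (auto simp: pos_mono_nth)

context complex_lie_algebra
begin

definition bilinear_map :: "(complex \<Rightarrow> 'w \<Rightarrow> 'w::ab_group_add) \<Rightarrow> ('g \<Rightarrow> 'g \<Rightarrow> 'w) \<Rightarrow> bool" where
  "bilinear_map sw f \<longleftrightarrow> (\<forall>x x' y. f (x + x') y = f x y + f x' y) \<and> (\<forall>x y y'. f x (y + y') = f x y + f x y')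
    \<and> (\<forall>c x y. f (s c x) y = sw c (f x y)) \<and> (\<forall>c x y. f x (s c y) = sw c (f x y))"

lemma pos_mono_scale: "pos_mono (s c b) p = fps_scale s c (pos_mono b p)"
  by (rule fps_ext) (simp add: pos_mono_nth fps_scale_def)

text \<open>The action of \<open>c t\<^sup>q\<close> on \<open>t\<gg>[[t]]\<close>, regarded for \<open>q < 0\<close> as the quotient of \<open>\<gg>((t))\<close> by
  \<open>\<gg>[t\<^sup>-\<^sup>1]\<close>.\<close>

definition mode_ad :: "'g \<Rightarrow> int \<Rightarrow> 'g fps \<Rightarrow> 'g fps" where
  "mode_ad c q x = Abs_fps (\<lambda>n. if 0 < n \<and> 0 < int n - q then br c (x $ nat (int n - q)) else 0)"

lemma mode_ad_nth: "mode_ad c q x $ n = (if 0 < n \<and> 0 < int n - q then br c (x $ nat (int n - q)) else 0)"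
  by (simp add: mode_ad_def)

lemma mode_ad_pos_mono: "0 < p \<Longrightarrow> mode_ad c q (pos_mono b p) = pos_mono (br c b) (p + q)"
  by (rule fps_ext) (auto simp: mode_ad_nth pos_mono_nth)

lemma mode_ad_add_left: "mode_ad (b + c) q x = mode_ad b q x + mode_ad c q x"
  and mode_ad_scale_left: "mode_ad (s k b) q x = fps_scale s k (mode_ad b q x)"
  and mode_ad_add: "mode_ad c q (x + y) = mode_ad c q x + mode_ad c q y"
  and mode_ad_scale: "mode_ad c q (fps_scale s k x) = fps_scale s k (mode_ad c q x)"
  by (rule fps_ext; simp add: mode_ad_nth fps_scale_def)+

lemma fps_bracket_pos_mono:
  "0 < p \<Longrightarrow> fps_bracket br (pos_mono b p) (pos_mono c q) = (if 0 < q then pos_mono (br b c) (p + q) else 0)"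
proof (rule fps_ext)
  fix n assume p: "0 < p"
  have "fps_bracket br (pos_mono b p) (pos_mono c q) $ n
    = (\<Sum>i=0..n. if i = nat p then (if 0 < q \<and> int n = p + q then br b c else 0) else 0)"
    unfolding fps_bracket_nth by (rule sum.cong) (use p in \<open>auto simp: pos_mono_nth\<close>)
  also have "\<dots> = (if 0 < q then pos_mono (br b c) (p + q) else 0) $ n"
    by (subst sum.delta) (use p in \<open>auto simp: pos_mono_nth\<close>)
  finally show "fps_bracket br (pos_mono b p) (pos_mono c q) $ n
    = (if 0 < q then pos_mono (br b c) (p + q) else 0) $ n" .
qed

lemma fps_bracket_add_left: "fps_bracket br (x + y) z = fps_bracket br x z + fps_bracket br y z"
  and fps_bracket_add_right: "fps_bracket br z (x + y) = fps_bracket br z x + fps_bracket br z y"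
  by (rule fps_ext; simp add: fps_bracket_nth sum.distrib)+

lemma fps_bracket_scale_left: "fps_bracket br (fps_scale s c x) z = fps_scale s c (fps_bracket br x z)"
  by (rule fps_ext; simp add: fps_bracket_nth fps_scale_def scale_sum_right)+

lemma fps_bracket_swap: "fps_bracket br x y = - fps_bracket br y x"
proof (rule fps_ext)
  fix n
  have "(\<Sum>i=0..n. br (x $ i) (y $ (n - i))) = (\<Sum>i=0..n. - br (y $ i) (x $ (n - i)))"
    by (rule sum.reindex_bij_witness[of _ "\<lambda>i. n - i" "\<lambda>i. n - i"]) (auto intro: br_swap[symmetric])
  then show "fps_bracket br x y $ n = (- fps_bracket br y x) $ n"
    by (simp add: fps_bracket_nth sum_negf)
qed

lemma fps_bracket_zero [simp]: "fps_bracket br 0 x = 0" "fps_bracket br x 0 = 0"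
  by (rule fps_ext; simp add: fps_bracket_nth)+

end

text \<open>The module is a subspace \<open>Vc\<close> of an ambient space because the induced
  module will be realised as the range of a projection. The assumption \<open>generated\<close> says
  that \<open>Vc\<close> lies in every submodule containing \<open>vac\<close> and serves as an
  induction principle. That \<open>vac\<close> is nonzero is proved separately for the concrete
  module.\<close>

locale affine_module = lie_algebra_form s br \<kappa> + V: vector_space sv
  for s :: "complex \<Rightarrow> 'g::ab_group_add \<Rightarrow> 'g" and br and \<kappa> and sv :: "complex \<Rightarrow> 'v::ab_group_add \<Rightarrow> 'v" +
  fixes A :: "'g affine \<Rightarrow> 'v \<Rightarrow> 'v" and vac :: 'v and Vc :: "'v set"
  assumes A_add: "A x (v + w) = A x v + A x w"
    and A_scale: "A x (sv c v) = sv c (A x v)"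
    and A_add_left: "A (x + y) v = A x v + A y v"
    and A_scale_left: "A (affine_scale s c x) v = sv c (A x v)"
    and A_bracket: "A x (A y v) - A y (A x v) = A (affine_bracket s br \<kappa> x y) v"
    and Vc_subspace: "V.subspace Vc"
    and A_closed: "v \<in> Vc \<Longrightarrow> A x v \<in> Vc"
    and vac_in: "vac \<in> Vc"
    and generated: "V.subspace W \<Longrightarrow> vac \<in> W \<Longrightarrow> (\<And>x v. v \<in> W \<Longrightarrow> A x v \<in> W) \<Longrightarrow> Vc \<subseteq> W"
    and vac_ann: "A (fps_to_fls f, 0) vac = 0"
    and vac_central: "A (0, 1) vac = vac"
begin

definition act :: "'g fps \<Rightarrow> 'v \<Rightarrow> 'v" where
  "act f = A (fps_to_fls f, 0)"

definition mode :: "'g \<Rightarrow> int \<Rightarrow> 'v \<Rightarrow> 'v" where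
  "mode b p = A (fls_mono b p, 0)"

lemma A_zero_left [simp]: "A 0 v = 0"
  by (rule additive_fun_zero[of "\<lambda>x. A x v"]) (rule A_add_left)

lemma A_zero [simp]: "A x 0 = 0"
  by (rule additive_fun_zero[of "A x"]) (rule A_add)

text \<open>The vectors fixed by K form a subspace containing \<open>vac\<close>, and K commutes
  with every operator; so this subspace is stable and contains \<open>Vc\<close>.\<close>

lemma A_central:
  assumes "v \<in> Vc" shows "A (0, c) v = sv c v"
proof -
  have "Vc \<subseteq> {v. A (0, 1) v = v}"
  proof (rule generated)
    show "V.subspace {v. A (0, 1) v = v}"
      by (auto simp: V.subspace_def A_add A_scale)
    fix x v assume v: "v \<in> {v. A (0, 1) v = v}"
    have "A (0, 1) (A x v) - A x (A (0, 1) v) = 0"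
      by (simp add: A_bracket affine_bracket_central)
    then show "A x v \<in> {v. A (0, 1) v = v}" using v by simp
  qed (simp add: vac_central)
  then have "A (affine_scale s c (0, 1)) v = sv c v"
    using assms by (auto simp: A_scale_left)
  moreover have "affine_scale s c (0, 1) = (0, c)"
    by (rule affine_eqI) auto
  ultimately show ?thesis by simp
qed

lemma mode_add [simp]: "mode b p (v + w) = mode b p v + mode b p w"
  and mode_scale [simp]: "mode b p (sv c v) = sv c (mode b p v)"
  by (simp_all add: mode_def A_add A_scale)

lemma mode_add_left [simp]: "mode (b + c) p v = mode b p v + mode c p v"
proof -
  have "(fls_mono (b + c) p, 0) = (fls_mono b p, 0) + (fls_mono c p, 0 :: complex)"
    by (rule affine_eqI) auto
  then show ?thesis by (simp only: mode_def A_add_left)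
qed

lemma mode_scale_left [simp]: "mode (s c b) p v = sv c (mode b p v)"
proof -
  have "(fls_mono (s c b) p, 0) = affine_scale s c (fls_mono b p, 0)"
    by (rule affine_eqI) auto
  then show ?thesis by (simp add: mode_def A_scale_left)
qed

lemma mode_zero [simp]: "mode 0 p v = 0" "mode b p 0 = 0"
  and mode_minus [simp]: "mode (- b) p v = - mode b p v" "mode b p (- v) = - mode b p v"
  and mode_diff [simp]: "mode b p (v - w) = mode b p v - mode b p w"
  by (simp_all add: additive_fun_zero[of "\<lambda>x. mode x p v" for p v] additive_fun_zero[of "mode b p" for b p]
      additive_fun_minus[of "\<lambda>x. mode x p v" for p v] additive_fun_minus[of "mode b p" for b p]
      additive_fun_diff[of "mode b p" for b p])

lemma mode_sum: "mode b p (sum f S) = (\<Sum>i\<in>S. mode b p (f i))"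
  and mode_sum_left: "mode (sum g S) p v = (\<Sum>i\<in>S. mode (g i) p v)"
  by (rule additive_fun_sum, simp)+

lemma mode_closed: "v \<in> Vc \<Longrightarrow> mode b p v \<in> Vc"
  by (simp add: mode_def A_closed)

lemma mode_commutator:
  assumes "v \<in> Vc"
  shows "mode b p (mode c q v) - mode c q (mode b p v)
    = mode (br b c) (p + q) v + sv (if p + q = 0 then of_int p * \<kappa> b c else 0) v"
proof -
  define z where "z = (if p + q = 0 then of_int p * \<kappa> b c else 0)"
  have "mode b p (mode c q v) - mode c q (mode b p v) = A (fls_mono (br b c) (p + q), z) v"
    by (simp add: mode_def A_bracket affine_bracket_mono z_def)
  also have "(fls_mono (br b c) (p + q), z) = (fls_mono (br b c) (p + q), 0) + (0, z)" by simp
  finally show ?thesis by (simp only: A_add_left A_central[OF assms] mode_def z_def)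
qed

lemma act_pos_mono: "act (pos_mono b p) v = (if 0 < p then mode b p v else 0)"
proof -
  have "(0, 0) = (0 :: 'g affine)" by (simp add: zero_prod_def)
  then show ?thesis by (simp add: act_def mode_def fps_to_fls_pos_mono)
qed

lemma act_add: "act x (v + w) = act x v + act x w"
  and act_scale: "act x (sv c v) = sv c (act x v)"
  by (simp_all add: act_def A_add A_scale)

lemma act_zero [simp]: "act x 0 = 0" "act 0 v = 0"
  using act_pos_mono[of 0 0 v] by (simp_all add: act_def additive_fun_zero[of "A _", OF A_add] pos_mono_nonpos)

lemma act_add_left: "act (x + y) v = act x v + act y v"
proof -
  have "(fps_to_fls (x + y), 0) = (fps_to_fls x, 0) + (fps_to_fls y, 0 :: complex)"
    by (rule affine_eqI) auto
  then show ?thesis by (simp only: act_def A_add_left)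
qed

lemma act_scale_left: "act (fps_scale s c x) v = sv c (act x v)"
proof -
  have "(fps_to_fls (fps_scale s c x), 0) = affine_scale s c (fps_to_fls x, 0)"
    by (rule affine_eqI) (auto simp: fps_scale_def)
  then show ?thesis by (simp add: act_def A_scale_left)
qed

lemma act_closed: "v \<in> Vc \<Longrightarrow> act x v \<in> Vc"
  by (simp add: act_def A_closed)

lemma act_const: "act (fps_const a) = mode a 0"
proof -
  have "fps_to_fls (fps_const a) = fls_mono a 0" by (rule fls_eqI) auto
  then show ?thesis by (simp add: act_def mode_def)
qed

lemmas Vc_closed = V.subspace_add[OF Vc_subspace] V.subspace_scale[OF Vc_subspace]
  V.subspace_0[OF Vc_subspace] V.subspace_diff[OF Vc_subspace] V.subspace_neg[OF Vc_subspace]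
  V.subspace_sum[OF Vc_subspace]

abbreviation diff :: "('g fps list \<Rightarrow> 'v) \<Rightarrow> 'g fps list \<Rightarrow> 'v" where
  "diff \<equiv> cartan_diff act (fps_bracket br)"

text \<open>One number N bounds two things: the degrees of the arguments that \<phi> can see, and
  the modes that do not kill its values. Both make the sums over modes finite. The vanishing
  condition leaves coefficient 0 free, so constants are killed as well, which is the condition
  relative to g.\<close>

definition mode_cochain :: "nat \<Rightarrow> ('g fps list \<Rightarrow> 'v) \<Rightarrow> bool" where
  "mode_cochain N \<phi> \<longleftrightarrow> (\<forall>xs. \<phi> xs \<in> Vc) \<and> slot_additive \<phi> \<and> slot_homogeneous (fps_scale s) sv \<phi> \<and>
     slot_alternating \<phi> \<and> slot_vanishing (\<lambda>x. \<forall>i. 0 < i \<and> i < N \<longrightarrow> x $ i = 0) \<phi> \<and>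
     (\<forall>xs c r. int N \<le> r \<longrightarrow> mode c r (\<phi> xs) = 0)"

lemma mode_cochain_insert: "mode_cochain N \<phi> \<Longrightarrow> mode_cochain N (\<lambda>ys. \<phi> (x # ys))"
  unfolding mode_cochain_def
  by (blast intro: slot_additive_insert slot_homogeneous_insert slot_alternating_insert slot_vanishing_insert)

lemma mode_cochainD:
  assumes "mode_cochain N \<phi>"
  shows "\<phi> xs \<in> Vc" "slot_additive \<phi>" "slot_homogeneous (fps_scale s) sv \<phi>" "slot_alternating \<phi>"
    "int N \<le> r \<Longrightarrow> mode c r (\<phi> xs) = 0"
    "p \<le> 0 \<or> int N \<le> p \<Longrightarrow> \<phi> (pos_mono b p # zs) = 0"
    "p \<le> 0 \<or> int N \<le> p \<Longrightarrow> \<phi> (u # pos_mono b p # zs) = 0"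
  using assms slot_vanishing_first[of "\<lambda>x. \<forall>i. 0 < i \<and> i < N \<longrightarrow> x $ i = 0" \<phi> "pos_mono b p" zs]
    slot_vanishing_second[of "\<lambda>x. \<forall>i. 0 < i \<and> i < N \<longrightarrow> x $ i = 0" \<phi> "pos_mono b p" u zs]
  by (auto simp: mode_cochain_def pos_mono_nth)

lemma mode_cochain_linear:
  assumes "mode_cochain N \<phi>"
  shows "\<phi> (pos_mono (b + c) p # zs) = \<phi> (pos_mono b p # zs) + \<phi> (pos_mono c p # zs)"
    "\<phi> (pos_mono (s k b) p # zs) = sv k (\<phi> (pos_mono b p # zs))"
    "\<phi> (u # pos_mono (b + c) p # zs) = \<phi> (u # pos_mono b p # zs) + \<phi> (u # pos_mono c p # zs)"
    "\<phi> (u # pos_mono (s k b) p # zs) = sv k (\<phi> (u # pos_mono b p # zs))"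
    "\<phi> (pos_mono (- b) p # zs) = - \<phi> (pos_mono b p # zs)"
    "\<phi> (u # pos_mono (- b) p # zs) = - \<phi> (u # pos_mono b p # zs)"
    "\<phi> (0 # zs) = 0" "\<phi> (u # 0 # zs) = 0"
  using mode_cochainD(2,3)[OF assms]
  by (simp_all add: pos_mono_add pos_mono_scale pos_mono_minus slot_additive_first slot_additive_second
      slot_homogeneous_first[of "fps_scale s" sv \<phi>] slot_homogeneous_second[of "fps_scale s" sv \<phi>]
      slot_additive_minus_first slot_additive_zero_first)

end

text \<open>\<open>\<Omega>\<close> stands for \<open>\<kappa> - \<kappa>\<^sub>c\<close>; the last assumption is all that is needed of this relation
  between \<open>\<Omega>\<close> and \<open>\<kappa>\<close>.\<close>

locale sugawara_module = affine_module s br \<kappa> sv A vac Vc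
  for s :: "complex \<Rightarrow> 'g::ab_group_add \<Rightarrow> 'g" and br and \<kappa> and sv :: "complex \<Rightarrow> 'v::ab_group_add \<Rightarrow> 'v"
    and A vac Vc +
  fixes B :: "'g set" and dual :: "'g \<Rightarrow> 'g" and \<Omega> :: "'g \<Rightarrow> 'g \<Rightarrow> complex"
  assumes finite_B: "finite B"
    and \<Omega>_sym: "\<Omega> x y = \<Omega> y x"
    and \<Omega>_invariant: "\<Omega> (br x y) z = \<Omega> x (br y z)"
    and \<Omega>_add: "\<Omega> x (y + z) = \<Omega> x y + \<Omega> x z"
    and \<Omega>_scale: "\<Omega> x (s c z) = c * \<Omega> x z"
    and dual_expansion: "x = (\<Sum>a\<in>B. s (\<Omega> x (dual a)) a)"
    and casimir: "(\<Sum>a\<in>B. s (\<kappa> b (dual a)) a) + (\<Sum>a\<in>B. s (\<kappa> b (dual a)) a)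
      + (\<Sum>a\<in>B. br a (br (dual a) b)) = b + b"
begin

text \<open>The tensor sum of a \<otimes> \<open>dual a\<close> is symmetric: expanding
  \<open>dual a\<close> in the basis gives the coefficients \<Omega>(\<open>dual a\<close>,
  \<open>dual b\<close>), and \<Omega> is symmetric.\<close>

lemma dual_swap:
  assumes "bilinear_map sw f"
  shows "(\<Sum>a\<in>B. f a (dual a)) = (\<Sum>a\<in>B. f (dual a) a)"
proof -
  have l: "f (\<Sum>i\<in>B. s (k i) i) y = (\<Sum>i\<in>B. sw (k i) (f i y))"
    and r: "f y (\<Sum>i\<in>B. s (k i) i) = (\<Sum>i\<in>B. sw (k i) (f y i))" for k y
    using assms additive_fun_sum[of "\<lambda>x. f x y" "\<lambda>i. s (k i) i" B] additive_fun_sum[of "f y" "\<lambda>i. s (k i) i" B]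
    by (simp_all add: bilinear_map_def)
  have "(\<Sum>a\<in>B. f a (dual a)) = (\<Sum>a\<in>B. \<Sum>b\<in>B. sw (\<Omega> (dual a) (dual b)) (f a b))"
    by (rule sum.cong[OF refl], subst dual_expansion[of "dual _"]) (rule r)
  also have "\<dots> = (\<Sum>b\<in>B. \<Sum>a\<in>B. sw (\<Omega> (dual b) (dual a)) (f a b))"
    by (subst sum.swap) (simp add: \<Omega>_sym)
  also have "\<dots> = (\<Sum>b\<in>B. f (dual b) b)"
    by (rule sum.cong[OF refl], subst (2) dual_expansion[of "dual _"]) (rule l[symmetric])
  finally show ?thesis .
qed

lemma dual_expansion': "x = (\<Sum>a\<in>B. s (\<Omega> x a) (dual a))"
proof -
  have "(\<Sum>a\<in>B. s (\<Omega> x a) (dual a)) = (\<Sum>a\<in>B. s (\<Omega> x (dual a)) a)"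
    by (rule dual_swap[of s]) (simp add: bilinear_map_def \<Omega>_add \<Omega>_scale scale_left_distrib scale_right_distrib
        mult.commute)
  then show ?thesis using dual_expansion[of x] by simp
qed

text \<open>The tensor sum of a \<otimes> \<open>dual a\<close> is invariant under ad y: the
  coefficients of [a, y] in the basis are, by invariance of \<Omega>, those of
  [y, \<open>dual b\<close>] in the dual basis.\<close>

lemma dual_invariance:
  assumes f: "bilinear_map sw f"
  shows "(\<Sum>a\<in>B. f (br y a) (dual a)) = - (\<Sum>a\<in>B. f a (br y (dual a)))"
proof -
  have l: "f (\<Sum>i\<in>B. s (k i) i) y = (\<Sum>i\<in>B. sw (k i) (f i y))"
    and r: "f y (\<Sum>i\<in>B. s (k i) (dual i)) = (\<Sum>i\<in>B. sw (k i) (f y (dual i)))" for k y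
    using assms additive_fun_sum[of "\<lambda>x. f x y" "\<lambda>i. s (k i) i" B] additive_fun_sum[of "f y" "\<lambda>i. s (k i) (dual i)" B]
    by (simp_all add: bilinear_map_def)
  have neg: "f (- x) z = - f x z" for x z
    using f additive_fun_minus[of "\<lambda>x. f x z"] by (simp add: bilinear_map_def)
  have "(\<Sum>a\<in>B. f (br a y) (dual a)) = (\<Sum>a\<in>B. \<Sum>b\<in>B. sw (\<Omega> (br a y) (dual b)) (f b (dual a)))"
    by (rule sum.cong[OF refl], subst dual_expansion[of "br _ y"]) (rule l)
  also have "\<dots> = (\<Sum>a\<in>B. \<Sum>b\<in>B. sw (\<Omega> (br y (dual b)) a) (f b (dual a)))"
    by (simp add: \<Omega>_invariant \<Omega>_sym[of _ "br y _"])
  also have "\<dots> = (\<Sum>b\<in>B. \<Sum>a\<in>B. sw (\<Omega> (br y (dual b)) a) (f b (dual a)))"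
    by (rule sum.swap)
  also have "\<dots> = (\<Sum>b\<in>B. f b (br y (dual b)))"
    by (simp add: r[symmetric] dual_expansion'[symmetric])
  finally have "(\<Sum>a\<in>B. f (br a y) (dual a)) = (\<Sum>b\<in>B. f b (br y (dual b)))" .
  moreover have "f (br y a) (dual a) = - f (br a y) (dual a)" for a
    by (subst br_swap) (rule neg)
  ultimately show ?thesis by (simp add: sum_negf)
qed

end

section \<open>Contributions to the anticommutator, summed over dual bases and modes\<close>

context sugawara_module
begin

text \<open>Invariance and symmetry of the dual tensor express every noncentral term through the
  single function \<open>g\<close>, taken at q, p + q and p - q, so that
  \<open>sum_modes_first_order\<close> leaves twice \<open>g p\<close>, which is the action of the
  constants. The central term arises only at q = p, where the cocycle supplies the factor p.\<close>

lemma homotopy_coefficient_part: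
  fixes b :: 'g
  assumes \<phi>: "mode_cochain N \<phi>" and p: "0 < p"
  defines "y \<equiv> pos_mono b p"
  shows "(\<Sum>a\<in>B. \<Sum>q\<in>{1..<int N}.
      (act y (mode (dual a) (- q) (\<phi> (pos_mono a q # zs))) - mode (dual a) (- q) (act y (\<phi> (pos_mono a q # zs))))
      + (act y (mode (dual a) (- q) (\<phi> (pos_mono a q # zs))) - mode (dual a) (- q) (act y (\<phi> (pos_mono a q # zs))))
      + mode (dual a) (- q) (\<phi> (fps_bracket br y (pos_mono a q) # zs))
      + mode (dual a) (- q) (\<phi> (fps_bracket br y (pos_mono a q) # zs))
      + act (mode_ad (dual a) (- q) y) (\<phi> (pos_mono a q # zs))
      - act (pos_mono a q) (\<phi> (mode_ad (dual a) (- q) y # zs)))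
    = sv (of_int p) (\<phi> (pos_mono ((\<Sum>a\<in>B. s (\<kappa> b (dual a)) a) + (\<Sum>a\<in>B. s (\<kappa> b (dual a)) a)) p # zs))
      + (\<Sum>a\<in>B. mode (dual a) 0 (\<phi> (pos_mono (br a b) p # zs)) + mode (dual a) 0 (\<phi> (pos_mono (br a b) p # zs)))"
    (is "(\<Sum>a\<in>B. \<Sum>q\<in>{1..<int N}. ?t a q) = _")
proof -
  note lin = mode_cochain_linear[OF \<phi>] V.scale_right_distrib V.scale_left_distrib
  define g where "g j = (\<Sum>a\<in>B. mode (br b (dual a)) (p - j) (\<phi> (pos_mono a j # zs)))" for j
  define c where "c = (\<Sum>a\<in>B. sv (of_int p * \<kappa> b (dual a)) (\<phi> (pos_mono a p # zs)))"
  have g0: "g j = 0" if "j \<le> 0 \<or> j \<ge> int N \<or> p - j \<ge> int N" for j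
    using that mode_cochainD(5,6)[OF \<phi>] unfolding g_def by (auto intro!: sum.neutral)
  have bil: "bilinear_map sv (\<lambda>u v. mode v k (\<phi> (pos_mono u j # zs)))"
      "bilinear_map sv (\<lambda>u v. mode (br b v) k (\<phi> (pos_mono u j # zs)))"
      "bilinear_map sv (\<lambda>u v. mode u k (\<phi> (pos_mono v j # zs)))"
      "bilinear_map sv (\<lambda>u v. mode (br b u) k (\<phi> (pos_mono v j # zs)))" for k j
    unfolding bilinear_map_def by (simp_all add: lin)
  have S1: "(\<Sum>a\<in>B. mode (dual a) (- q) (\<phi> (pos_mono (br b a) (p + q) # zs))) = - g (p + q)" for q
    unfolding g_def using dual_invariance[OF bil(1)[of "- q" "p + q"], of b] by simp
  have S2: "(\<Sum>a\<in>B. mode a q (\<phi> (pos_mono (br (dual a) b) (p - q) # zs))) = g (p - q)" for q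
  proof -
    have "(\<Sum>a\<in>B. mode a q (\<phi> (pos_mono (br (dual a) b) (p - q) # zs)))
      = (\<Sum>a\<in>B. mode (br b a) q (\<phi> (pos_mono (dual a) (p - q) # zs)))"
      using dual_invariance[OF bil(3)[of q "p - q"], of b] by (subst br_swap) (simp add: lin sum_negf)
    also have "\<dots> = g (p - q)" unfolding g_def using dual_swap[OF bil(4)[of q "p - q"]]
      dual_swap[OF bil(2)[of q "p - q"]] by simp
    finally show ?thesis .
  qed
  have S3: "(\<Sum>a\<in>B. mode (dual a) 0 (\<phi> (pos_mono (br a b) p # zs))) = g p"
    unfolding g_def using dual_invariance[OF bil(1)[of 0 p], of b]
    by (subst br_swap) (simp add: lin sum_negf)
  have t: "(\<Sum>a\<in>B. ?t a q) = (g q + g q - g (p + q) - g (p + q) - (if q < p then g q else 0) - g (p - q))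
      + (if q = p then c + c else 0)" if q: "q \<in> {1..<int N}" for q
  proof -
    have com: "act y (mode (dual a) (- q) w) - mode (dual a) (- q) (act y w)
      = mode (br b (dual a)) (p - q) w + (if q = p then sv (of_int p * \<kappa> b (dual a)) w else 0)" if "w \<in> Vc" for a w
      using p mode_commutator[OF that, of b p "dual a" "- q"] by (auto simp: y_def act_pos_mono)
    have "(\<Sum>a\<in>B. ?t a q) = (\<Sum>a\<in>B.
       (mode (br b (dual a)) (p - q) (\<phi> (pos_mono a q # zs))
          + (if q = p then sv (of_int p * \<kappa> b (dual a)) (\<phi> (pos_mono a p # zs)) else 0))
       + (mode (br b (dual a)) (p - q) (\<phi> (pos_mono a q # zs))
          + (if q = p then sv (of_int p * \<kappa> b (dual a)) (\<phi> (pos_mono a p # zs)) else 0))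
       + mode (dual a) (- q) (\<phi> (pos_mono (br b a) (p + q) # zs))
       + mode (dual a) (- q) (\<phi> (pos_mono (br b a) (p + q) # zs))
       - (if q < p then mode (br b (dual a)) (p - q) (\<phi> (pos_mono a q # zs)) else 0)
       - mode a q (\<phi> (pos_mono (br (dual a) b) (p - q) # zs)))"
    proof (rule sum.cong[OF refl])
      fix a
      have 1: "fps_bracket br y (pos_mono a q) = pos_mono (br b a) (p + q)"
        using p q by (simp add: y_def fps_bracket_pos_mono)
      have 2: "mode_ad (dual a) (- q) y = pos_mono (br (dual a) b) (p - q)"
        using p by (simp add: y_def mode_ad_pos_mono)
      have 3: "mode (br (dual a) b) (p - q) w = - mode (br b (dual a)) (p - q) w" for w
        by (subst br_swap) simp
      show "?t a q = (mode (br b (dual a)) (p - q) (\<phi> (pos_mono a q # zs))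
          + (if q = p then sv (of_int p * \<kappa> b (dual a)) (\<phi> (pos_mono a p # zs)) else 0))
       + (mode (br b (dual a)) (p - q) (\<phi> (pos_mono a q # zs))
          + (if q = p then sv (of_int p * \<kappa> b (dual a)) (\<phi> (pos_mono a p # zs)) else 0))
       + mode (dual a) (- q) (\<phi> (pos_mono (br b a) (p + q) # zs))
       + mode (dual a) (- q) (\<phi> (pos_mono (br b a) (p + q) # zs))
       - (if q < p then mode (br b (dual a)) (p - q) (\<phi> (pos_mono a q # zs)) else 0)
       - mode a q (\<phi> (pos_mono (br (dual a) b) (p - q) # zs))"
        unfolding com[OF mode_cochainD(1)[OF \<phi>]] 1 2
        using q by (auto simp: act_pos_mono 3)
    qed
    also have "\<dots> = (g q + g q - g (p + q) - g (p + q) - (if q < p then g q else 0) - g (p - q))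
      + (if q = p then c + c else 0)"
      unfolding sum.distrib sum_subtractf S1 S2
      by (auto simp: g_def c_def)
    finally show ?thesis .
  qed
  have c: "(\<Sum>q\<in>{1..<int N}. if q = p then c + c else 0) = c + c"
    using p mode_cochainD(6)[OF \<phi>, of p] by (subst sum.delta) (auto simp: c_def)
  have c': "\<phi> (pos_mono (\<Sum>a\<in>B. s (\<kappa> b (dual a)) a) p # zs) = (\<Sum>a\<in>B. sv (\<kappa> b (dual a)) (\<phi> (pos_mono a p # zs)))"
    by (subst additive_fun_sum[of "\<lambda>x. \<phi> (pos_mono x p # zs)"]) (simp_all add: lin)
  have "(\<Sum>a\<in>B. \<Sum>q\<in>{1..<int N}. ?t a q) = (\<Sum>q\<in>{1..<int N}. \<Sum>a\<in>B. ?t a q)" by (rule sum.swap)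
  also have "\<dots> = (g p + g p) + (c + c)"
    using sum_modes_first_order[of p g "int N"] p g0
    by (simp only: sum.cong[OF refl t] sum.distrib c) simp
  finally show ?thesis
    by (simp add: c_def c' lin sum.distrib S3 V.scale_sum_right algebra_simps)
qed

text \<open>For 0 < q < p the element \<open>dual a\<close> t^-q lowers b t^p to degree p - q and a
  t^q raises it back, giving the same double bracket each time; there are p - 1 such q. For q \<ge>
  p the lowered monomial leaves tg[[t]] and is 0.\<close>

lemma homotopy_contraction_part:
  fixes b :: 'g
  assumes \<phi>: "mode_cochain N \<phi>" and p: "0 < p"
  defines "y \<equiv> pos_mono b p"
  shows "(\<Sum>a\<in>B. \<Sum>q\<in>{1..<int N}. \<phi> (fps_bracket br (pos_mono a q) (mode_ad (dual a) (- q) y) # zs))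
    = sv (of_int (p - 1)) (\<phi> (pos_mono (\<Sum>a\<in>B. br a (br (dual a) b)) p # zs))"
proof -
  note lin = mode_cochain_linear[OF \<phi>]
  define X where "X = \<phi> (pos_mono (\<Sum>a\<in>B. br a (br (dual a) b)) p # zs)"
  have X: "X = (\<Sum>a\<in>B. \<phi> (pos_mono (br a (br (dual a) b)) p # zs))"
    unfolding X_def by (rule additive_fun_sum[of "\<lambda>x. \<phi> (pos_mono x p # zs)"]) (simp add: lin)
  have "(\<Sum>a\<in>B. \<Sum>q\<in>{1..<int N}. \<phi> (fps_bracket br (pos_mono a q) (mode_ad (dual a) (- q) y) # zs))
    = (\<Sum>a\<in>B. \<Sum>q\<in>{1..<int N}. if q < p then \<phi> (pos_mono (br a (br (dual a) b)) p # zs) else 0)"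
    by (intro sum.cong refl) (use p in \<open>auto simp: y_def mode_ad_pos_mono fps_bracket_pos_mono lin\<close>)
  also have "\<dots> = (\<Sum>q\<in>{1..<int N}. if q < p then X else 0)"
    by (subst sum.swap) (auto simp: X intro!: sum.cong)
  also have "\<dots> = sv (of_int (p - 1)) X"
  proof (cases "p \<le> int N")
    case True
    have "(\<Sum>q\<in>{1..<int N}. if q < p then X else 0) = (\<Sum>q\<in>{1..<p}. X)"
      by (rule sum.mono_neutral_cong_right) (use True in auto)
    also have "\<dots> = sv (of_int (p - 1)) X"
      using p by (simp add: V.sum_constant_scale)
    finally show ?thesis .
  next
    case False
    \<comment> \<open>With p > N the modes below N are fewer than p - 1, but then \<phi> does not
      see degree p at all.\<close>
    then have "X = 0" unfolding X_def using mode_cochainD(6)[OF \<phi>] by auto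
    then show ?thesis by (simp cong: if_cong)
  qed
  finally show ?thesis by (simp add: X_def)
qed

text \<open>Here the action on one further argument z is isolated. The Jacobi identity gives
  \<alpha> = \<beta> + \<gamma>; alternation of \<phi> combined with symmetry and invariance of the
  dual tensor gives the reflection \<alpha> j = - \<gamma> (p + r - j). With these two relations the
  mode sum collapses to twice \<gamma> p, the diagonal rotation of both arguments.\<close>

lemma homotopy_tensor_identity:
  fixes b c :: 'g
  assumes \<phi>: "mode_cochain N \<phi>" and p: "0 < p" and r: "0 < r"
  defines "y \<equiv> pos_mono b p" and "z \<equiv> pos_mono c r"
  shows "(\<Sum>a\<in>B. \<Sum>q\<in>{1..<int N}.
      \<phi> (pos_mono a q # (fps_bracket br y (mode_ad (dual a) (- q) z) - mode_ad (dual a) (- q) (fps_bracket br y z)) # zs)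
      + \<phi> (fps_bracket br y (pos_mono a q) # mode_ad (dual a) (- q) z # zs)
      + \<phi> (pos_mono a q # fps_bracket br (mode_ad (dual a) (- q) y) z # zs)
      - \<phi> (mode_ad (dual a) (- q) y # fps_bracket br (pos_mono a q) z # zs))
    = (\<Sum>a\<in>B. \<phi> (pos_mono (br a b) p # mode_ad (dual a) 0 z # zs)
        + \<phi> (pos_mono (br a b) p # mode_ad (dual a) 0 z # zs))"
    (is "(\<Sum>a\<in>B. \<Sum>q\<in>{1..<int N}. ?t a q) = _")
proof -
  note lin = mode_cochain_linear[OF \<phi>]
  define \<alpha> where "\<alpha> j = (\<Sum>a\<in>B. \<phi> (pos_mono a j # pos_mono (br b (br (dual a) c)) (p + r - j) # zs))" for j
  define \<beta> where "\<beta> j = (\<Sum>a\<in>B. \<phi> (pos_mono a j # pos_mono (br (dual a) (br b c)) (p + r - j) # zs))" for j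
  define \<gamma> where "\<gamma> j = (\<Sum>a\<in>B. \<phi> (pos_mono a j # pos_mono (br (br b (dual a)) c) (p + r - j) # zs))" for j
  have bil: "bilinear_map sv (\<lambda>u v. \<phi> (pos_mono u j # pos_mono (br v c) k # zs))"
    "bilinear_map sv (\<lambda>u v. \<phi> (pos_mono (br b v) j # pos_mono u k # zs))"
    "bilinear_map sv (\<lambda>u v. \<phi> (pos_mono u j # pos_mono (br b v) k # zs))"
    "bilinear_map sv (\<lambda>u v. \<phi> (pos_mono (br b u) j # pos_mono (br v c) k # zs))"
    "bilinear_map sv (\<lambda>u v. \<phi> (pos_mono u j # pos_mono (br (br b v) c) k # zs))"
    for j k
    unfolding bilinear_map_def by (simp_all add: lin)
  have ab: "\<alpha> j = \<beta> j + \<gamma> j" for j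
    unfolding \<alpha>_def \<beta>_def \<gamma>_def sum.distrib[symmetric] br_leibniz[of b] by (simp add: lin add.commute)
  have \<gamma>0: "\<gamma> j = 0" if "j \<le> 0 \<or> j \<ge> int N \<or> p + r - j \<ge> int N \<or> p + r - j \<le> 0" for j
    using that mode_cochainD(6,7)[OF \<phi>] unfolding \<gamma>_def by (auto intro!: sum.neutral)
  have alt: "\<alpha> j = - \<gamma> (p + r - j)" for j
  proof -
    have "\<alpha> j = - (\<Sum>a\<in>B. \<phi> (pos_mono (br b (br (dual a) c)) (p + r - j) # pos_mono a j # zs))"
      unfolding \<alpha>_def sum_negf[symmetric]
      by (rule sum.cong[OF refl]) (rule slot_alternating_first[OF mode_cochainD(4)[OF \<phi>]])
    also have "(\<Sum>a\<in>B. \<phi> (pos_mono (br b (br (dual a) c)) (p + r - j) # pos_mono a j # zs))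
        = (\<Sum>a\<in>B. \<phi> (pos_mono (br b (dual a)) (p + r - j) # pos_mono (br c a) j # zs))"
      using dual_invariance[OF bil(2)[of "p + r - j" j], of c]
      by (subst br_swap) (simp add: lin sum_negf)
    also have "\<dots> = - (\<Sum>a\<in>B. \<phi> (pos_mono (br b (dual a)) (p + r - j) # pos_mono (br a c) j # zs))"
      by (subst (2) br_swap) (simp add: lin sum_negf)
    also have "(\<Sum>a\<in>B. \<phi> (pos_mono (br b (dual a)) (p + r - j) # pos_mono (br a c) j # zs))
      = (\<Sum>a\<in>B. \<phi> (pos_mono (br b a) (p + r - j) # pos_mono (br (dual a) c) j # zs))"
      using dual_swap[OF bil(4)[of "p + r - j" j]] by simp
    also have "\<dots> = - \<gamma> (p + r - j)"
      unfolding \<gamma>_def using dual_invariance[OF bil(1)[of "p + r - j" j], of b] by simp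
    finally show ?thesis by simp
  qed
  have S2: "(\<Sum>a\<in>B. \<phi> (pos_mono (br b a) (p + q) # pos_mono (br (dual a) c) (r - q) # zs)) = - \<gamma> (p + q)" for q
    unfolding \<gamma>_def using dual_invariance[OF bil(1)[of "p + q" "r - q"], of b] by simp
  have S4: "(\<Sum>a\<in>B. \<phi> (pos_mono (br (dual a) b) (p - q) # pos_mono (br a c) (q + r) # zs)) = \<gamma> (p - q)" for q
  proof -
    have "(\<Sum>a\<in>B. \<phi> (pos_mono (br (dual a) b) (p - q) # pos_mono (br a c) (q + r) # zs))
      = - (\<Sum>a\<in>B. \<phi> (pos_mono (br b (dual a)) (p - q) # pos_mono (br a c) (q + r) # zs))"
      by (subst br_swap) (simp add: lin sum_negf)
    also have "\<dots> = - (\<Sum>a\<in>B. \<phi> (pos_mono (br b a) (p - q) # pos_mono (br (dual a) c) (q + r) # zs))"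
      using dual_swap[OF bil(4)[of "p - q" "q + r"]] by simp
    also have "\<dots> = \<gamma> (p - q)"
      unfolding \<gamma>_def using dual_invariance[OF bil(1)[of "p - q" "q + r"], of b] by (simp add: add.commute)
    finally show ?thesis .
  qed
  have S5: "(\<Sum>a\<in>B. \<phi> (pos_mono (br a b) p # pos_mono (br (dual a) c) r # zs)) = \<gamma> p"
    unfolding \<gamma>_def using dual_invariance[OF bil(1)[of p r], of b]
    by (subst br_swap) (simp add: lin sum_negf)
  have t: "(\<Sum>a\<in>B. ?t a q) = (if q < r then \<alpha> q else 0) - \<beta> q - \<gamma> (p + q) - (if q < p then \<gamma> q else 0) - \<gamma> (p - q)"
    if q: "q \<in> {1..<int N}" for q
  proof -
    have "(\<Sum>a\<in>B. ?t a q) = (\<Sum>a\<in>B.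
       (if q < r then \<phi> (pos_mono a q # pos_mono (br b (br (dual a) c)) (p + r - q) # zs) else 0)
       - \<phi> (pos_mono a q # pos_mono (br (dual a) (br b c)) (p + r - q) # zs)
       + \<phi> (pos_mono (br b a) (p + q) # pos_mono (br (dual a) c) (r - q) # zs)
       - (if q < p then \<phi> (pos_mono a q # pos_mono (br (br b (dual a)) c) (p + r - q) # zs) else 0)
       - \<phi> (pos_mono (br (dual a) b) (p - q) # pos_mono (br a c) (q + r) # zs))"
    proof (rule sum.cong[OF refl])
      fix a
      have 1: "fps_bracket br y (mode_ad (dual a) (- q) z)
         = (if q < r then pos_mono (br b (br (dual a) c)) (p + r - q) else 0)"
        using p q r by (simp add: y_def z_def mode_ad_pos_mono fps_bracket_pos_mono algebra_simps)
      have 2: "mode_ad (dual a) (- q) (fps_bracket br y z) = pos_mono (br (dual a) (br b c)) (p + r - q)"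
        using p q r by (simp add: y_def z_def mode_ad_pos_mono fps_bracket_pos_mono)
      have 3: "fps_bracket br y (pos_mono a q) = pos_mono (br b a) (p + q)"
        using p q by (simp add: y_def fps_bracket_pos_mono)
      have 4: "mode_ad (dual a) (- q) z = pos_mono (br (dual a) c) (r - q)"
        "mode_ad (dual a) (- q) y = pos_mono (br (dual a) b) (p - q)"
        using p r by (simp_all add: y_def z_def mode_ad_pos_mono)
      have 5: "fps_bracket br (mode_ad (dual a) (- q) y) z
         = (if q < p then - pos_mono (br (br b (dual a)) c) (p + r - q) else 0)"
        unfolding 4 z_def using p q r
        by (subst br_swap) (auto simp: fps_bracket_pos_mono pos_mono_nonpos pos_mono_minus[symmetric] algebra_simps)
      have 6: "fps_bracket br (pos_mono a q) z = pos_mono (br a c) (q + r)"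
        using q r by (simp add: z_def fps_bracket_pos_mono)
      show "?t a q = (if q < r then \<phi> (pos_mono a q # pos_mono (br b (br (dual a) c)) (p + r - q) # zs) else 0)
       - \<phi> (pos_mono a q # pos_mono (br (dual a) (br b c)) (p + r - q) # zs)
       + \<phi> (pos_mono (br b a) (p + q) # pos_mono (br (dual a) c) (r - q) # zs)
       - (if q < p then \<phi> (pos_mono a q # pos_mono (br (br b (dual a)) c) (p + r - q) # zs) else 0)
       - \<phi> (pos_mono (br (dual a) b) (p - q) # pos_mono (br a c) (q + r) # zs)"
        unfolding 1 2 3 5 6 unfolding 4
        using slot_additive_minus_first[OF mode_cochainD(2)[OF \<phi>]] by (auto simp: lin)
    qed
    also have "\<dots> = (if q < r then \<alpha> q else 0) - \<beta> q - \<gamma> (p + q) - (if q < p then \<gamma> q else 0) - \<gamma> (p - q)"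
      unfolding sum.distrib sum_subtractf S2 S4
      by (auto simp: \<alpha>_def \<beta>_def \<gamma>_def)
    finally show ?thesis .
  qed
  have "(\<Sum>a\<in>B. \<Sum>q\<in>{1..<int N}. ?t a q) = (\<Sum>q\<in>{1..<int N}. \<Sum>a\<in>B. ?t a q)" by (rule sum.swap)
  also have "\<dots> = \<gamma> p + \<gamma> p"
    by (rule trans[OF sum.cong[OF refl t] sum_modes_second_order[where \<alpha> = \<alpha> and \<beta> = \<beta> and \<gamma> = \<gamma>, OF p r]])
      (assumption | fact ab | fact alt | fact \<gamma>0)+
  finally show ?thesis
    using r by (simp add: sum.distrib S5 z_def mode_ad_pos_mono)
qed

text \<open>These are the test arguments for all operator identities. The shifts
  \<open>mode_ad\<close> and the degree derivation map the set, which contains 0, to itself, and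
  alternating cochains of the kind considered are determined on lists of its elements.\<close>

definition pos_monos :: "'g fps set" where
  "pos_monos = {pos_mono b p | b p. 0 < p}"

text \<open>The operators act on zs one slot at a time, so each z needs only the two-argument
  identity. Bringing z in front of the contracted element costs the sign recorded in
  \<open>ins\<close>.\<close>

lemma homotopy_derivation_part:
  fixes b :: 'g
  assumes "mode_cochain N \<phi>" and p: "0 < p" and "set zs \<subseteq> pos_monos"
  defines "y \<equiv> pos_mono b p"
  shows "(\<Sum>a\<in>B. \<Sum>q\<in>{1..<int N}.
      slot_der (\<lambda>x. fps_bracket br y (mode_ad (dual a) (- q) x) - mode_ad (dual a) (- q) (fps_bracket br y x))
          (\<lambda>ys. \<phi> (pos_mono a q # ys)) zs
      + slot_der (mode_ad (dual a) (- q)) (\<lambda>ys. \<phi> (fps_bracket br y (pos_mono a q) # ys)) zs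
      + slot_der (fps_bracket br (mode_ad (dual a) (- q) y)) (\<lambda>ys. \<phi> (pos_mono a q # ys)) zs
      - slot_der (fps_bracket br (pos_mono a q)) (\<lambda>ys. \<phi> (mode_ad (dual a) (- q) y # ys)) zs)
    = (\<Sum>a\<in>B. slot_der (mode_ad (dual a) 0) (\<lambda>ys. \<phi> (pos_mono (br a b) p # ys)) zs
        + slot_der (mode_ad (dual a) 0) (\<lambda>ys. \<phi> (pos_mono (br a b) p # ys)) zs)"
  using assms(1,3)
proof (induction zs arbitrary: \<phi>)
  case (Cons z zs)
  obtain c r where z: "z = pos_mono c r" and r: "0 < r"
    using Cons.prems(2) by (auto simp: pos_monos_def)
  have ins: "slot_der T (\<lambda>ys. \<phi> (u # ys)) (z # zs)
      = - slot_der T (\<lambda>ys. \<phi> (z # u # ys)) zs - \<phi> (u # T z # zs)" for T u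
  proof -
    have "(\<lambda>ys. \<phi> (u # z # ys)) = (\<lambda>ys. - \<phi> (z # u # ys))"
      using slot_alternating_first[OF mode_cochainD(4)[OF Cons.prems(1)]] by blast
    then show ?thesis by (simp add: slot_der_minus)
  qed
  have arrange: "(- a1 - b1) + (- a2 - b2) + (- a3 - b3) - (- a4 - b4)
      = - (a1 + a2 + a3 - a4) - (b1 + b2 + b3 - b4)" for a1 a2 a3 a4 b1 b2 b3 b4 :: 'v by simp
  have arrange': "(- a1 - b1) + (- a2 - b2) = - (a1 + a2) - (b1 + b2)" for a1 a2 b1 b2 :: 'v by simp
  have dist: "(\<Sum>a\<in>B. \<Sum>q\<in>Q. - f a q - g a q) = - (\<Sum>a\<in>B. \<Sum>q\<in>Q. f a q) - (\<Sum>a\<in>B. \<Sum>q\<in>Q. g a q)"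
    for f g :: "'g \<Rightarrow> int \<Rightarrow> 'v" and Q by (simp add: sum_subtractf sum_negf)
  have dist': "(\<Sum>a\<in>B. - f a - g a) = - (\<Sum>a\<in>B. f a) - (\<Sum>a\<in>B. g a)"
    for f g :: "'g \<Rightarrow> 'v" by (simp add: sum_subtractf sum_negf)
  show ?case
    unfolding ins arrange unfolding arrange' dist dist'
    using Cons.IH[OF mode_cochain_insert[OF Cons.prems(1)], of z] Cons.prems(2)
      homotopy_tensor_identity[OF Cons.prems(1) p r, of b c zs]
    unfolding y_def z by simp
qed simp

end

text \<open>The shifted and unshifted sums differ only by a block of indices between 0 and p. With F
  p and F 0 it becomes the sum over both j and p - j, and each of the |p| pairs contributes C. The
  two cases are the two signs of p.\<close>

lemma sum_modes_telescope:
  fixes F :: "int \<Rightarrow> 'v::ab_group_add" and N :: int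
  assumes V: "vector_space sv" and sym: "\<And>j. F j + F (p - j) = C" and F0: "\<And>j. j \<ge> N - \<bar>p\<bar> \<Longrightarrow> F j = 0"
    and p: "\<bar>p\<bar> < N"
  shows "(\<Sum>q\<in>{1..<N}. F (p + q) + F (p + q) - F q - F q) + F p - F 0 = - sv (of_int p) C"
proof -
  interpret V: vector_space sv by (rule V)
  have c: "(\<Sum>q\<in>S. C) = sv (of_nat (card S)) C" for S :: "int set"
    by (simp add: V.sum_constant_scale)
  show ?thesis
  proof (cases "p \<ge> 0")
    case True
    define T where "T = (\<Sum>q\<in>{1..p}. F q)"
    have "(\<Sum>q\<in>{1..<N}. F (p + q) + F (p + q) - F q - F q)
      = (\<Sum>q\<in>{1..<N}. (if p < q then F q else 0) + (if p < q then F q else 0) - F q - F q)"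
      unfolding sum.distrib sum_subtractf by (subst (1 2) sum_shift_up[of p N F]) (use True F0 in auto)
    also have "\<dots> = (\<Sum>q\<in>{1..p}. - F q - F q)"
      by (rule sum.mono_neutral_cong_right) (use p True in auto)
    finally have 1: "(\<Sum>q\<in>{1..<N}. F (p + q) + F (p + q) - F q - F q) = - T - T"
      by (simp add: T_def sum_subtractf sum_negf)
    have "(\<Sum>q\<in>{1..p}. F (p - q)) = (\<Sum>q\<in>{0..<p}. F q)"
      by (rule sum.reindex_bij_witness[of _ "\<lambda>q. p - q" "\<lambda>q. p - q"]) auto
    moreover have S: "(\<Sum>q\<in>{0..<p}. F q) + F p = F 0 + T"
    proof -
      have "{0..<p} \<union> {p} = {0..p}" "{0} \<union> {1..p} = {0..p}" using True by auto
      then show ?thesis unfolding T_def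
        using sum.union_disjoint[of "{0..<p}" "{p}" F] sum.union_disjoint[of "{0}" "{1..p}" F] by simp
    qed
    moreover have "T + (\<Sum>q\<in>{1..p}. F (p - q)) = sv (of_int p) C"
      using True by (simp add: T_def sum.distrib[symmetric] sym c)
    ultimately have U: "(\<Sum>q\<in>{1..p}. F (p - q)) = F 0 + T - F p" and TU: "T + (\<Sum>q\<in>{1..p}. F (p - q)) = sv (of_int p) C"
      by (simp_all add: eq_diff_eq)
    have 2: "T + T + F 0 - F p = sv (of_int p) C" unfolding TU[symmetric] U by simp
    show ?thesis unfolding 1 2[symmetric] by (simp add: algebra_simps)
  next
    case False
    define T where "T = (\<Sum>q\<in>{p+1..0}. F q)"
    have "(\<Sum>q\<in>{1..<N}. F (p + q)) = (\<Sum>q\<in>{p+1..<N+p}. F q)"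
      by (rule sum.reindex_bij_witness[of _ "\<lambda>q. q - p" "\<lambda>q. p + q"]) auto
    also have "\<dots> = T + (\<Sum>q\<in>{1..<N+p}. F q)"
    proof -
      have "{p+1..<N+p} = {p+1..0} \<union> {1..<N+p}" using False p by auto
      moreover have "{p+1..0} \<inter> {1..<N+p} = {}" by auto
      ultimately show ?thesis unfolding T_def using sum.union_disjoint[of "{p+1..0}" "{1..<N+p}" F] by simp
    qed
    also have "(\<Sum>q\<in>{1..<N+p}. F q) = (\<Sum>q\<in>{1..<N}. F q)"
      by (rule sum.mono_neutral_left) (use False F0 in auto)
    finally have 1: "(\<Sum>q\<in>{1..<N}. F (p + q) + F (p + q) - F q - F q) = T + T"
      by (simp add: sum.distrib sum_subtractf)
    have "(\<Sum>q\<in>{p+1..0}. F (p - q)) = (\<Sum>q\<in>{p..<0}. F q)"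
      by (rule sum.reindex_bij_witness[of _ "\<lambda>q. p - q" "\<lambda>q. p - q"]) auto
    moreover have S: "(\<Sum>q\<in>{p..<0}. F q) + F 0 = F p + T"
    proof -
      have "{p..<0} \<union> {0} = {p..0}" "{p} \<union> {p+1..0} = {p..0}" using False by auto
      then show ?thesis unfolding T_def
        using sum.union_disjoint[of "{p..<0}" "{0}" F] sum.union_disjoint[of "{p}" "{p+1..0}" F] by simp
    qed
    moreover have "T + (\<Sum>q\<in>{p+1..0}. F (p - q)) = sv (- of_int p) C"
      using False by (simp add: T_def sum.distrib[symmetric] sym c)
    ultimately have U: "(\<Sum>q\<in>{p+1..0}. F (p - q)) = F p + T - F 0" and TU: "T + (\<Sum>q\<in>{p+1..0}. F (p - q)) = sv (- of_int p) C"
      by (simp_all add: eq_diff_eq)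
    have 2: "T + T + F p - F 0 = sv (- of_int p) C" unfolding TU[symmetric] U by simp
    show ?thesis unfolding 1 2[symmetric] using 2 by simp
  qed
qed

section \<open>The degree derivation and the rotations by constants\<close>

context complex_lie_algebra
begin

definition euler :: "'g fps \<Rightarrow> 'g fps" where
  "euler x = Abs_fps (\<lambda>n. s (of_nat n) (x $ n))"

lemma euler_nth: "euler x $ n = s (of_nat n) (x $ n)"
  by (simp add: euler_def)

lemma euler_add: "euler (x + y) = euler x + euler y"
  and euler_scale: "euler (fps_scale s c x) = fps_scale s c (euler x)"
  by (rule fps_ext; simp add: euler_nth fps_scale_def scale_right_distrib mult.commute)+

lemma euler_pos_mono: "euler (pos_mono b p) = fps_scale s (of_int p) (pos_mono b p)"
proof (rule fps_ext)
  fix n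
  show "euler (pos_mono b p) $ n = fps_scale s (of_int p) (pos_mono b p) $ n"
    by (cases "int n = p") (auto simp: euler_nth pos_mono_nth fps_scale_def)
qed

end

context affine_module
begin

text \<open>The diagonal action of a constant, written with \<open>mode_ad c 0\<close> so that it
  has the shape of the zero mode in the sums over q. It drops the constant terms of arguments but
  agrees with the Lie derivative on positive monomials.\<close>

definition rot :: "'g \<Rightarrow> ('g fps list \<Rightarrow> 'v) \<Rightarrow> 'g fps list \<Rightarrow> 'v" where
  "rot c \<phi> zs = mode c 0 (\<phi> zs) + slot_der (mode_ad c 0) \<phi> zs"

lemma rot_insert: "rot c \<phi> (y # zs) = rot c (\<lambda>ys. \<phi> (y # ys)) zs - \<phi> (mode_ad c 0 y # zs)"
  by (simp add: rot_def)

lemma rot_diff: "rot c (\<lambda>ys. \<phi> ys - \<psi> ys) zs = rot c \<phi> zs - rot c \<psi> zs"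
  by (simp add: rot_def slot_der_diff)

end

context sugawara_module
begin

section \<open>The homotopy formula\<close>

text \<open>Twice the operator h of the overview. For a \<open>mode_cochain N\<close> the truncation
  loses nothing, since \<phi> vanishes once a monomial of degree at least N is inserted.\<close>

definition homotopy :: "nat \<Rightarrow> ('g fps list \<Rightarrow> 'v) \<Rightarrow> 'g fps list \<Rightarrow> 'v" where
  "homotopy N \<phi> zs = (\<Sum>a\<in>B. \<Sum>q\<in>{1..<int N}.
     homotopy_term (mode (dual a) (- q)) (mode_ad (dual a) (- q)) (pos_mono a q) \<phi> zs)"

text \<open>Twice the Sugawara operator, truncated to the modes below \<open>N\<close>.\<close>

definition sug :: "nat \<Rightarrow> 'v \<Rightarrow> 'v" where
  "sug N v = (\<Sum>q\<in>{1..<int N}. \<Sum>a\<in>B. mode (dual a) (- q) (mode a q v) + mode (dual a) (- q) (mode a q v))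
     + (\<Sum>a\<in>B. mode (dual a) 0 (mode a 0 v))"

text \<open>On the empty list, h d gives the nonzero modes of the Sugawara operator and the
  rotations its zero mode. A new argument b t^p adds the coefficient, derivation and contraction
  parts; the first two produce the mixed rotation terms \<open>Q\<close> twice, which the Casimir
  sum of rotations removes.\<close>

lemma homotopy_formula:
  assumes "mode_cochain N \<phi>" "set xs \<subseteq> pos_monos"
  shows "diff (homotopy N \<phi>) xs + homotopy N (diff \<phi>) xs + (\<Sum>a\<in>B. rot (dual a) (rot a \<phi>) xs)
    = sug N (\<phi> xs) - slot_der euler \<phi> xs - slot_der euler \<phi> xs"
  using assms
proof (induction xs arbitrary: \<phi>)
  case Nil
  have "homotopy N (diff \<phi>) [] = (\<Sum>q\<in>{1..<int N}. \<Sum>a\<in>B.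
      mode (dual a) (- q) (mode a q (\<phi> [])) + mode (dual a) (- q) (mode a q (\<phi> [])))"
    unfolding homotopy_def
    by (subst sum.swap) (auto simp: homotopy_term_def lie_der_def act_pos_mono intro!: sum.cong)
  then show ?case by (simp add: sug_def rot_def)
next
  case (Cons y zs)
  obtain b p where y: "y = pos_mono b p" and p: "0 < p" and zs: "set zs \<subseteq> pos_monos" using Cons.prems(2) by (auto simp: pos_monos_def)
  note \<phi> = Cons.prems(1)
  note lin = mode_cochain_linear[OF \<phi>] V.scale_right_distrib V.scale_left_distrib
  let ?i = "\<lambda>ys. \<phi> (y # ys)"
  define K where "K = (\<Sum>a\<in>B. s (\<kappa> b (dual a)) a)"
  define C where "C = (\<Sum>a\<in>B. br a (br (dual a) b))"
  define Q where "Q = (\<Sum>a\<in>B. rot (dual a) (\<lambda>ys. \<phi> (pos_mono (br a b) p # ys)) zs)"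
  have diff_homotopy: "diff (homotopy N \<psi>) us = (\<Sum>a\<in>B. \<Sum>q\<in>{1..<int N}.
     diff (homotopy_term (mode (dual a) (- q)) (mode_ad (dual a) (- q)) (pos_mono a q) \<psi>) us)" for \<psi> us
    unfolding homotopy_def[abs_def] by (simp add: cartan_diff_sum[OF act_add])
  have e1: "diff (homotopy N \<phi>) (y # zs) + homotopy N (diff \<phi>) (y # zs)
    = diff (homotopy N ?i) zs + homotopy N (diff ?i) zs
      + (sv (of_int p) (\<phi> (pos_mono (K + K) p # zs))
          + (\<Sum>a\<in>B. mode (dual a) 0 (\<phi> (pos_mono (br a b) p # zs)) + mode (dual a) 0 (\<phi> (pos_mono (br a b) p # zs))))
      + (\<Sum>a\<in>B. slot_der (mode_ad (dual a) 0) (\<lambda>ys. \<phi> (pos_mono (br a b) p # ys)) zs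
          + slot_der (mode_ad (dual a) 0) (\<lambda>ys. \<phi> (pos_mono (br a b) p # ys)) zs)
      + sv (of_int (p - 1)) (\<phi> (pos_mono C p # zs))"
  proof -
    have dist: "(\<Sum>a\<in>B. \<Sum>q\<in>{1..<int N}. f1 a q + f2 a q + f3 a q + f4 a q + f5 a q)
      = (\<Sum>a\<in>B. \<Sum>q\<in>{1..<int N}. f1 a q) + (\<Sum>a\<in>B. \<Sum>q\<in>{1..<int N}. f2 a q)
        + (\<Sum>a\<in>B. \<Sum>q\<in>{1..<int N}. f3 a q) + (\<Sum>a\<in>B. \<Sum>q\<in>{1..<int N}. f4 a q)
        + (\<Sum>a\<in>B. \<Sum>q\<in>{1..<int N}. f5 a q)" for f1 f2 f3 f4 f5 :: "'g \<Rightarrow> int \<Rightarrow> 'v"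
      by (simp only: sum.distrib)
    have "diff (homotopy N \<phi>) (y # zs) + homotopy N (diff \<phi>) (y # zs) = (\<Sum>a\<in>B. \<Sum>q\<in>{1..<int N}.
        diff (homotopy_term (mode (dual a) (- q)) (mode_ad (dual a) (- q)) (pos_mono a q) \<phi>) (y # zs)
        + homotopy_term (mode (dual a) (- q)) (mode_ad (dual a) (- q)) (pos_mono a q) (diff \<phi>) (y # zs))"
      by (simp only: diff_homotopy homotopy_def sum.distrib)
    also have "\<dots> = diff (homotopy N ?i) zs + homotopy N (diff ?i) zs
      + (sv (of_int p) (\<phi> (pos_mono (K + K) p # zs))
          + (\<Sum>a\<in>B. mode (dual a) 0 (\<phi> (pos_mono (br a b) p # zs)) + mode (dual a) 0 (\<phi> (pos_mono (br a b) p # zs))))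
      + (\<Sum>a\<in>B. slot_der (mode_ad (dual a) 0) (\<lambda>ys. \<phi> (pos_mono (br a b) p # ys)) zs
          + slot_der (mode_ad (dual a) 0) (\<lambda>ys. \<phi> (pos_mono (br a b) p # ys)) zs)
      + sv (of_int (p - 1)) (\<phi> (pos_mono C p # zs))"
      unfolding homotopy_term_anticommutator[where R = "mode c i" for c i,
        OF act_add mode_add mode_cochainD(2,4)[OF \<phi>] fps_bracket_swap] dist
      unfolding y homotopy_coefficient_part[OF \<phi> p] homotopy_contraction_part[OF \<phi> p]
        homotopy_derivation_part[OF \<phi> p zs]
      by (simp only: diff_homotopy homotopy_def K_def C_def)
    finally show ?thesis .
  qed
  have e2: "(\<Sum>a\<in>B. rot (dual a) (rot a \<phi>) (y # zs))
      = (\<Sum>a\<in>B. rot (dual a) (rot a ?i) zs) - Q - Q + \<phi> (pos_mono C p # zs)"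
  proof -
    have "rot c (rot a \<phi>) (y # zs) = rot c (rot a ?i) zs - rot c (\<lambda>ys. \<phi> (pos_mono (br a b) p # ys)) zs
        - rot a (\<lambda>ys. \<phi> (pos_mono (br c b) p # ys)) zs + \<phi> (pos_mono (br a (br c b)) p # zs)" for a c
      by (simp add: rot_insert rot_diff y mode_ad_pos_mono[OF p])
    moreover have "(\<Sum>a\<in>B. rot a (\<lambda>ys. \<phi> (pos_mono (br (dual a) b) p # ys)) zs) = Q"
    proof -
      have add: "(\<lambda>ys. \<phi> (pos_mono (u + v) p # ys)) = (\<lambda>ys. \<phi> (pos_mono u p # ys) + \<phi> (pos_mono v p # ys))"
        and sc: "(\<lambda>ys. \<phi> (pos_mono (s k u) p # ys)) = (\<lambda>ys. sv k (\<phi> (pos_mono u p # ys)))" for u v k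
        by (simp_all add: lin)
      note \<psi> = mode_cochain_insert[OF \<phi>]
      have "bilinear_map sv (\<lambda>u v. rot v (\<lambda>ys. \<phi> (pos_mono (br u b) p # ys)) zs)"
        unfolding bilinear_map_def rot_def br_add_left br_scale_left add sc
          mode_ad_add_left[abs_def] mode_ad_scale_left[abs_def]
          slot_der_add_map[OF mode_cochainD(2)[OF \<psi>]]
          slot_der_scale_map[OF mode_cochainD(3)[OF \<psi>] V.scale_right_distrib]
        by (simp add: slot_der_add slot_der_hom[of "sv _", OF V.scale_right_distrib] lin algebra_simps)
      from dual_swap[OF this] show ?thesis by (simp add: Q_def)
    qed
    moreover have "\<phi> (pos_mono C p # zs) = (\<Sum>a\<in>B. \<phi> (pos_mono (br a (br (dual a) b)) p # zs))"
      unfolding C_def by (rule additive_fun_sum[of "\<lambda>x. \<phi> (pos_mono x p # zs)"]) (simp add: lin)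
    ultimately show ?thesis by (simp add: sum.distrib sum_subtractf Q_def)
  qed
  have e3: "Q = (\<Sum>a\<in>B. mode (dual a) 0 (\<phi> (pos_mono (br a b) p # zs)))
      + (\<Sum>a\<in>B. slot_der (mode_ad (dual a) 0) (\<lambda>ys. \<phi> (pos_mono (br a b) p # ys)) zs)"
    by (simp add: Q_def rot_def sum.distrib)
  \<comment> \<open>The Casimir sum of rotations supplies the one double bracket missing from p - 1.
    Then 2K + C = 2b, scaled by p, is the step at which the dual bases yield exactly twice the
    degree.\<close>
  have e4: "sv (of_int p) (\<phi> (pos_mono (K + K) p # zs)) + sv (of_int (p - 1)) (\<phi> (pos_mono C p # zs))
      + \<phi> (pos_mono C p # zs) = sv (of_int p) (\<phi> (y # zs)) + sv (of_int p) (\<phi> (y # zs))"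
  proof -
    have "\<phi> (pos_mono (K + K) p # zs) + \<phi> (pos_mono C p # zs) = \<phi> (y # zs) + \<phi> (y # zs)"
      using casimir[of b] unfolding y K_def[symmetric] C_def[symmetric] lin(1)[symmetric] by simp
    then have "sv (of_int p) (\<phi> (pos_mono (K + K) p # zs)) + sv (of_int p) (\<phi> (pos_mono C p # zs))
       = sv (of_int p) (\<phi> (y # zs)) + sv (of_int p) (\<phi> (y # zs))"
      by (simp only: V.scale_right_distrib[symmetric])
    then show ?thesis by (simp add: V.scale_left_diff_distrib)
  qed
  have e5: "slot_der euler \<phi> (y # zs) = slot_der euler ?i zs - sv (of_int p) (\<phi> (y # zs))"
    by (simp add: y euler_pos_mono slot_homogeneous_first[OF mode_cochainD(3)[OF \<phi>]])
  have e6: "diff (homotopy N ?i) zs + homotopy N (diff ?i) zs + (\<Sum>a\<in>B. rot (dual a) (rot a ?i) zs)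
    = sug N (\<phi> (y # zs)) - slot_der euler ?i zs - slot_der euler ?i zs"
    by (rule Cons.IH[OF mode_cochain_insert[OF \<phi>] zs])
  have e4': "sv (of_int p) (\<phi> (pos_mono (K + K) p # zs)) = sv (of_int p) (\<phi> (y # zs)) + sv (of_int p) (\<phi> (y # zs))
      - \<phi> (pos_mono C p # zs) - sv (of_int (p - 1)) (\<phi> (pos_mono C p # zs))"
    using e4 by (simp only: eq_diff_eq)
  have e6': "diff (homotopy N ?i) zs = sug N (\<phi> (y # zs)) - slot_der euler ?i zs - slot_der euler ?i zs
      - (\<Sum>a\<in>B. rot (dual a) (rot a ?i) zs) - homotopy N (diff ?i) zs"
    using e6 by (simp only: eq_diff_eq)
  show ?case
    unfolding e1 e2 e5 unfolding e3 e4' e6' sum.distrib by (simp only: algebra_simps)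
qed

section \<open>The Sugawara operator\<close>

lemma sug_stable:
  assumes "\<And>c r. int N \<le> r \<Longrightarrow> mode c r v = 0" "N \<le> M" shows "sug M v = sug N v"
proof -
  have "(\<Sum>q\<in>{1..<int M}. \<Sum>a\<in>B. mode (dual a) (- q) (mode a q v) + mode (dual a) (- q) (mode a q v))
     = (\<Sum>q\<in>{1..<int N}. \<Sum>a\<in>B. mode (dual a) (- q) (mode a q v) + mode (dual a) (- q) (mode a q v))"
    by (rule sum.mono_neutral_right) (use assms in auto)
  then show ?thesis by (simp add: sug_def)
qed

lemma sug_add: "sug N (v + w) = sug N v + sug N w"
  by (simp add: sug_def sum.distrib algebra_simps)

lemma sug_scale: "sug N (sv c v) = sv c (sug N v)"
  by (simp add: sug_def V.scale_sum_right V.scale_right_distrib sum.distrib algebra_simps)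

lemma sug_closed: "v \<in> Vc \<Longrightarrow> sug N v \<in> Vc"
  unfolding sug_def by (intro Vc_closed mode_closed)

text \<open>This is the Sugawara commutator [L_0, b t^p] = - p b t^p, doubled. The noncentral terms
  are differences of \<open>F\<close> and telescope to -p times the Casimir bracket
  \<open>C\<close>; the central terms at q = p or q = -p give -2p times \<open>K\<close>. The
  Casimir identity 2K + C = 2b combines them.\<close>

lemma sug_mode:
  assumes v: "v \<in> Vc" and kill: "\<And>c r. r \<ge> int N - \<bar>p\<bar> \<Longrightarrow> mode c r v = 0" and p: "\<bar>p\<bar> < int N"
  shows "sug N (mode b p v) - mode b p (sug N v) = - sv (of_int p) (mode b p v) - sv (of_int p) (mode b p v)"
proof -
  define F where "F j = (\<Sum>a\<in>B. mode (dual a) (p - j) (mode (br a b) j v))" for j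
  define K where "K = (\<Sum>a\<in>B. s (\<kappa> b (dual a)) a)"
  define C where "C = (\<Sum>a\<in>B. br a (br (dual a) b))"
  have bil: "bilinear_map sv (\<lambda>u w. mode w i (mode u j v))" 
    "bilinear_map sv (\<lambda>u w. mode u i (mode w j v))" 
    "bilinear_map sv (\<lambda>u w. mode (br u b) i (mode w j v))" for i j
    unfolding bilinear_map_def by simp_all
  have S: "(\<Sum>a\<in>B. mode (br (dual a) b) i (mode a j v)) = - (\<Sum>a\<in>B. mode (dual a) i (mode (br a b) j v))" for i j
    using dual_invariance[OF bil(1)[of i j], of b] 
    by (subst (1 2) br_swap) (simp add: sum_negf)
  have kK: "(\<Sum>a\<in>B. sv (\<kappa> b (dual a)) (mode a p v)) = mode K p v"
    by (simp add: K_def mode_sum_left)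
  have kK': "(\<Sum>a\<in>B. sv (\<kappa> b a) (mode (dual a) p v)) = mode K p v"
    unfolding kK[symmetric] 
    by (rule dual_swap[of sv "\<lambda>u w. sv (\<kappa> b u) (mode w p v)"])
      (simp add: bilinear_map_def V.scale_left_distrib V.scale_right_distrib mult.commute)
  have pK: "(\<Sum>a\<in>B. sv (of_int p * \<kappa> b (dual a)) (mode a p v)) = sv (of_int p) (mode K p v)"
    "(\<Sum>a\<in>B. sv (of_int p * \<kappa> b a) (mode (dual a) p v)) = sv (of_int p) (mode K p v)"
    unfolding kK[symmetric] V.scale_sum_right by (simp, simp add: kK'[unfolded kK[symmetric]] V.scale_sum_right[symmetric] flip: V.scale_scale)
  have per_mode: "(\<Sum>a\<in>B. mode (dual a) (- q) (mode a q (mode b p v)) - mode b p (mode (dual a) (- q) (mode a q v)))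
    = F (p + q) - F q + (if q = - p then sv (- of_int p) (mode K p v) else 0)
      + (if q = p then sv (- of_int p) (mode K p v) else 0)" for q
  proof -
    have "mode (dual a) (- q) (mode a q (mode b p v)) - mode b p (mode (dual a) (- q) (mode a q v))
      = mode (dual a) (- q) (mode (br a b) (p + q) v) + mode (br (dual a) b) (p - q) (mode a q v)
       + (if q = - p then sv (- of_int p) (sv (\<kappa> b a) (mode (dual a) p v)) else 0)
       + (if q = p then sv (- of_int p) (sv (\<kappa> b (dual a)) (mode a p v)) else 0)" for a
    proof -
      have 1: "mode a q (mode b p v) = mode b p (mode a q v) + mode (br a b) (p + q) v
          + sv (if q = - p then - of_int p * \<kappa> b a else 0) v"
        using mode_commutator[OF v, of a q b p] by (auto simp: algebra_simps form_sym[of a] split: if_splits)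
      have 2: "mode (dual a) (- q) (mode b p (mode a q v)) = mode b p (mode (dual a) (- q) (mode a q v))
          + mode (br (dual a) b) (p - q) (mode a q v) + sv (if q = p then - of_int p * \<kappa> b (dual a) else 0) (mode a q v)"
        using mode_commutator[OF mode_closed[OF v], of "dual a" "- q" b p a q]
        by (auto simp: algebra_simps form_sym[of "dual a"] split: if_splits)
      show ?thesis unfolding 1 by (auto simp: 2)
    qed
    then show ?thesis 
      by (simp add: sum.distrib S F_def sum_negf pK)
  qed
  \<comment> \<open>The zero mode occurs once in \<open>sug\<close>, while the other modes are
    doubled. This single F p - F 0 is the boundary term that makes the telescoping
    symmetric.\<close>
  have zero_mode: "(\<Sum>a\<in>B. mode (dual a) 0 (mode a 0 (mode b p v)) - mode b p (mode (dual a) 0 (mode a 0 v)))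
    = F p - F 0"
    using per_mode[of 0] by (cases "p = 0") auto
  have dbl: "(\<Sum>a\<in>B. (f a + f a) - mode b p (g a + g a))
     = (\<Sum>a\<in>B. f a - mode b p (g a)) + (\<Sum>a\<in>B. f a - mode b p (g a))" for f g
    by (simp add: sum_subtractf sum.distrib mode_add)
  have "sug N (mode b p v) - mode b p (sug N v)
    = (\<Sum>q\<in>{1..<int N}. F (p + q) + F (p + q) - F q - F q) + F p - F 0
      + (\<Sum>q\<in>{1..<int N}. (if q = - p then sv (- of_int p) (mode K p v + mode K p v) else 0)
        + (if q = p then sv (- of_int p) (mode K p v + mode K p v) else 0))"
  proof -
    have "sug N (mode b p v) - mode b p (sug N v) = (\<Sum>q\<in>{1..<int N}.
       (\<Sum>a\<in>B. (mode (dual a) (- q) (mode a q (mode b p v)) + mode (dual a) (- q) (mode a q (mode b p v)))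
         - mode b p (mode (dual a) (- q) (mode a q v) + mode (dual a) (- q) (mode a q v)))) + (F p - F 0)"
      by (simp add: sug_def mode_sum sum_subtractf zero_mode[symmetric] algebra_simps)
    also have "(\<Sum>q\<in>{1..<int N}.
       (\<Sum>a\<in>B. (mode (dual a) (- q) (mode a q (mode b p v)) + mode (dual a) (- q) (mode a q (mode b p v)))
         - mode b p (mode (dual a) (- q) (mode a q v) + mode (dual a) (- q) (mode a q v))))
      = (\<Sum>q\<in>{1..<int N}. (F (p + q) + F (p + q) - F q - F q)
        + ((if q = - p then sv (- of_int p) (mode K p v + mode K p v) else 0)
        + (if q = p then sv (- of_int p) (mode K p v + mode K p v) else 0)))"
      unfolding dbl per_mode by (intro sum.cong refl) (simp add: V.scale_right_distrib)
    finally show ?thesis by (simp add: sum.distrib)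
  qed
  also have "(\<Sum>q\<in>{1..<int N}. (if q = - p then sv (- of_int p) (mode K p v + mode K p v) else 0)
        + (if q = p then sv (- of_int p) (mode K p v + mode K p v) else 0))
      = - sv (of_int p) (mode (K + K) p v)"
    using p by (cases "p = 0") (auto simp: sum.distrib)
  also have "(\<Sum>q\<in>{1..<int N}. F (p + q) + F (p + q) - F q - F q) + F p - F 0 = - sv (of_int p) (mode C p v)"
  proof (cases "p = 0")
    case False
    show ?thesis
    proof (rule sum_modes_telescope[where sv = sv and C = "mode C p v"])
      show "vector_space sv" by (rule V.vector_space_axioms)
      fix j
      have "F (p - j) = - (\<Sum>a\<in>B. mode (br (dual a) b) j (mode a (p - j) v))"
        by (simp add: F_def S)
      also have "(\<Sum>a\<in>B. mode (br (dual a) b) j (mode a (p - j) v)) = (\<Sum>a\<in>B. mode (br a b) j (mode (dual a) (p - j) v))"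
        using dual_swap[OF bil(3)[of j "p - j"]] by simp
      finally have "F j + F (p - j)
        = (\<Sum>a\<in>B. mode (dual a) (p - j) (mode (br a b) j v) - mode (br a b) j (mode (dual a) (p - j) v))"
        by (simp add: F_def sum_subtractf)
      also have "\<dots> = (\<Sum>a\<in>B. mode (br (dual a) (br a b)) p v)"
        using mode_commutator[OF v, of "dual _" "p - j" "br _ b" j] False by simp
      also have "\<dots> = mode C p v"
        using dual_swap[of sv "\<lambda>u w. mode (br u (br w b)) p v"]
        by (simp add: C_def mode_sum_left bilinear_map_def)
      finally show "F j + F (p - j) = mode C p v" .
    qed (use kill p in \<open>auto simp: F_def\<close>)
  qed simp
  finally have "sug N (mode b p v) - mode b p (sug N v) = - sv (of_int p) (mode (K + K + C) p v)"
    by (simp add: V.scale_right_distrib)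
  also have "K + K + C = b + b" unfolding K_def C_def by (rule casimir)
  finally show ?thesis by (simp add: V.scale_right_distrib)
qed

end

section \<open>Vanishing criteria for derivations and inversion of annihilated operators\<close>

lemma slot_der_zero_on:
  assumes "\<And>x. x \<in> set xs \<Longrightarrow> x \<in> H \<and> T x \<in> H" "\<And>ys. set ys \<subseteq> H \<Longrightarrow> \<phi> ys = 0"
  shows "slot_der T \<phi> xs = 0"
  using assms by (induction T \<phi> xs rule: slot_der.induct) (auto simp: subset_iff)

lemma slot_der_zero_map:
  assumes "slot_vanishing P \<phi>" "\<And>x. P (T x)"
  shows "slot_der T \<phi> xs = 0"
  using assms(1)
proof (induction xs arbitrary: \<phi>)
  case (Cons x xs)
  then show ?case
    using Cons.IH[OF slot_vanishing_insert[OF Cons.prems]] slot_vanishing_first[OF Cons.prems] assms(2) by simp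
qed simp

lemma slot_der_length:
  assumes "\<And>ys. length ys = length xs \<Longrightarrow> \<phi> ys = 0"
  shows "slot_der T \<phi> xs = 0"
  using assms by (induction T \<phi> xs rule: slot_der.induct) auto

lemma slot_der_hom_on:
  fixes f :: "'v::ab_group_add \<Rightarrow> 'w::ab_group_add"
  assumes "\<And>x y. x \<in> W \<Longrightarrow> y \<in> W \<Longrightarrow> f (x - y) = f x - f y" "f 0 = 0" "0 \<in> W"
    "\<And>x y. x \<in> W \<Longrightarrow> y \<in> W \<Longrightarrow> x - y \<in> W" "\<And>ys. \<phi> ys \<in> W"
  shows "slot_der T (\<lambda>ys. f (\<phi> ys)) xs = f (slot_der T \<phi> xs) \<and> slot_der T \<phi> xs \<in> W"
  using assms(5) by (induction xs arbitrary: \<phi>) (auto simp: assms)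

lemma slot_vanishing_front:
  assumes alt: "slot_alternating \<phi>" and front: "\<And>x vs. P x \<Longrightarrow> \<phi> (x # vs) = (0::'v::ab_group_add)"
  shows "slot_vanishing P \<phi>"
proof -
  have "\<phi> (us @ x # vs) = 0" if "P x" for us x vs
  proof (induction us arbitrary: vs rule: rev_induct)
    case (snoc u us)
    then show ?case using slot_alternatingD[OF alt, of us u x vs] by simp
  qed (simp add: front that)
  then show ?thesis by (simp add: slot_vanishing_def)
qed

text \<open>If a polynomial in \<open>L\<close> with nonzero roots annihilates \<open>\<phi>\<close>, then \<open>L\<close> is invertible on the span of
  the iterates of \<open>\<phi>\<close>.\<close>

lemma preimage_of_annihilated:
  fixes L :: "('a \<Rightarrow> 'v::ab_group_add) \<Rightarrow> 'a \<Rightarrow> 'v" and sv :: "complex \<Rightarrow> 'v \<Rightarrow> 'v"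
  assumes V: "vector_space sv"
    and C: "\<And>\<phi> \<psi> a b. \<phi> \<in> C \<Longrightarrow> \<psi> \<in> C \<Longrightarrow> (\<lambda>x. sv a (\<phi> x) + sv b (\<psi> x)) \<in> C"
    and L: "\<And>\<phi> \<psi> a b. \<phi> \<in> C \<Longrightarrow> \<psi> \<in> C \<Longrightarrow> L (\<lambda>x. sv a (\<phi> x) + sv b (\<psi> x)) = (\<lambda>x. sv a (L \<phi> x) + sv b (L \<psi> x))"
    and LC: "\<And>\<phi>. \<phi> \<in> C \<Longrightarrow> L \<phi> \<in> C"
    and ws: "0 \<notin> set ws" "fold (\<lambda>w \<phi> x. L \<phi> x - sv w (\<phi> x)) ws \<phi> = (\<lambda>_. 0)" "\<phi> \<in> C"
  shows "\<exists>\<psi>\<in>C. \<phi> = L \<psi>"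
  using ws
proof (induction ws arbitrary: \<phi>)
  interpret V: vector_space sv by (rule V)
  case Nil
  then have "\<phi> = L (\<lambda>x. sv 0 (\<phi> x) + sv 0 (\<phi> x))" by (subst L) auto
  then show ?case using C[OF Nil(3) Nil(3), of 0 0] by blast
next
  interpret V: vector_space sv by (rule V)
  case (Cons w ws)
  let ?\<phi> = "\<lambda>x. L \<phi> x - sv w (\<phi> x)"
  have "?\<phi> \<in> C" using C[OF LC[OF Cons.prems(3)] Cons.prems(3), of 1 "- w"] by simp
  with Cons obtain \<psi> where \<psi>: "\<psi> \<in> C" "?\<phi> = L \<psi>" by auto
  \<comment> \<open>In L \<phi> - w \<phi> = L \<psi> the root w is nonzero, so dividing by it
    presents \<phi> as a value of L.\<close>
  have "\<phi> = (\<lambda>x. sv (1 / w) (L \<phi> x) + sv (- 1 / w) (L \<psi> x))"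
  proof
    fix x
    have "L \<psi> x = L \<phi> x - sv w (\<phi> x)" using \<psi>(2) by metis
    then show "\<phi> x = sv (1 / w) (L \<phi> x) + sv (- 1 / w) (L \<psi> x)"
      using Cons.prems(1) by (simp add: V.scale_right_diff_distrib)
  qed
  also have "\<dots> = L (\<lambda>x. sv (1 / w) (\<phi> x) + sv (- 1 / w) (\<psi> x))"
    by (simp only: L[OF Cons.prems(3) \<psi>(1)])
  finally show ?case using C[OF Cons.prems(3) \<psi>(1)] by blast
qed

context complex_lie_algebra
begin

lemma fps_bracket_const: "fps_bracket br (fps_const a) x $ n = br a (x $ n)"
proof -
  have "fps_bracket br (fps_const a) x $ n = (\<Sum>i=0..n. if i = 0 then br a (x $ n) else 0)"
    unfolding fps_bracket_nth by (rule sum.cong) auto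
  then show ?thesis by simp
qed

lemma fps_bracket_vanishes: "(\<And>i. i < N \<Longrightarrow> x $ i = 0) \<Longrightarrow> n < N \<Longrightarrow> fps_bracket br x y $ n = 0"
  by (simp add: fps_bracket_nth)

lemma euler_bracket: "euler (fps_bracket br x y) = fps_bracket br (euler x) y + fps_bracket br x (euler y)"
proof (rule fps_ext)
  fix n
  have "s (of_nat n) (br (x $ i) (y $ (n - i)))
    = br (s (of_nat i) (x $ i)) (y $ (n - i)) + br (x $ i) (s (of_nat (n - i)) (y $ (n - i)))"
    if "i \<in> {0..n}" for i
    using that by (simp add: scale_left_distrib[symmetric] of_nat_diff)
  then show "euler (fps_bracket br x y) $ n = (fps_bracket br (euler x) y + fps_bracket br x (euler y)) $ n"
    by (simp add: euler_nth fps_bracket_nth scale_sum_right sum.distrib[symmetric])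
qed

end

section \<open>Smoothness and weights of a module generated by a vacuum vector\<close>

context affine_module
begin

text \<open>If f starts in degree M + K + 1 and x in degree -K, the bracket starts in degree M + 1
  and kills v. The summand 1 makes the total degree positive even for M = 0, so no central term
  arises.\<close>

lemma smooth_step:
  assumes sm: "\<And>f. (\<And>i. i < M \<Longrightarrow> f $ i = 0) \<Longrightarrow> act f v = 0"
    and x: "\<And>i. i < - int K \<Longrightarrow> fst x $$ i = 0" and f: "\<And>i. i < M + K + 1 \<Longrightarrow> f $ i = 0"
  shows "act f (A x v) = 0"
proof -
  define g where "g = Abs_fps (\<lambda>n. fst (abr (fps_to_fls f, 0) x) $$ int n)"
  have fx: "fst (abr (fps_to_fls f, 0) x) $$ n = (\<Sum>i=int (M + K + 1)..n + int K. br (fps_to_fls f $$ i) (fst x $$ (n - i)))" for n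
    by (subst affine_bracket_fst[of "int (M + K + 1)" _ "- int K"]) (use f x in auto)
  have "abr (fps_to_fls f, 0) x = (fps_to_fls g, 0)"
  proof (rule affine_eqI)
    fix n show "fst (abr (fps_to_fls f, 0) x) $$ n = fst (fps_to_fls g, 0) $$ n"
      by (cases "n < 0") (auto simp: g_def fx)
    show "snd (abr (fps_to_fls f, 0) x) = snd (fps_to_fls g, 0)"
      by (subst affine_bracket_snd[of "int (M + K + 1)" _ "- int K"]) (use f x in auto)
  qed
  moreover have "act g v = 0"
    by (rule sm) (simp add: g_def fx)
  moreover have "act f v = 0" by (rule sm) (use f in auto)
  ultimately show ?thesis
    using A_bracket[of "(fps_to_fls f, 0)" x v] by (simp add: act_def)
qed

text \<open>The vectors killed by some t^M g[[t]] form a submodule containing \<open>vac\<close>; M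
  may depend on the vector.\<close>

lemma smooth:
  assumes "v \<in> Vc"
  shows "\<exists>M. \<forall>f. (\<forall>i<M. f $ i = 0) \<longrightarrow> act f v = 0"
proof -
  let ?W = "{v. \<exists>M. \<forall>f. (\<forall>i<M. f $ i = 0) \<longrightarrow> act f v = 0}"
  have "Vc \<subseteq> ?W"
  proof (rule generated)
    show "V.subspace ?W"
      unfolding V.subspace_def
    proof (intro conjI ballI allI)
      fix v w assume "v \<in> ?W" "w \<in> ?W"
      then obtain M1 M2 where "\<forall>f. (\<forall>i<M1. f $ i = 0) \<longrightarrow> act f v = 0" "\<forall>f. (\<forall>i<M2. f $ i = 0) \<longrightarrow> act f w = 0"
        by auto
      then have "\<forall>f. (\<forall>i<max M1 M2. f $ i = 0) \<longrightarrow> act f (v + w) = 0" by (auto simp: act_add)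
      then show "v + w \<in> ?W" by blast
    qed (auto simp: act_scale)
    show "vac \<in> ?W" by (simp add: act_def vac_ann)
    fix x :: "'g affine" and v assume "v \<in> ?W"
    then obtain M where M: "\<And>f. (\<And>i. i < M \<Longrightarrow> f $ i = 0) \<Longrightarrow> act f v = 0" by blast
    obtain K where K: "\<And>i. i < - int K \<Longrightarrow> fst x $$ i = 0"
    proof -
      obtain K :: nat where "\<forall>n>K. fst x $$ (- int n) = 0" by (rule fls_nth_vanishes_below_natE)
      then have "fst x $$ i = 0" if "i < - int K" for i
        using that by (auto dest: spec[of _ "nat (- i)"])
      then show thesis by (rule that)
    qed
    have "\<forall>f. (\<forall>i<M + K + 1. f $ i = 0) \<longrightarrow> act f (A x v) = 0"
      using smooth_step[OF M K] by blast
    then show "A x v \<in> ?W" by blast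
  qed
  then show ?thesis using assms by blast
qed

definition killed_from :: "nat \<Rightarrow> 'v \<Rightarrow> bool" where
  "killed_from N v \<longleftrightarrow> (\<forall>c r. int N \<le> r \<longrightarrow> mode c r v = 0)"

lemma fls_mono_nat: "fls_mono c (int n) = fps_to_fls (Abs_fps (\<lambda>i. if i = n then c else 0))"
  by (rule fls_eqI) auto

lemma mode_nonneg: "0 \<le> r \<Longrightarrow> mode c r = act (Abs_fps (\<lambda>i. if i = nat r then c else 0))"
  unfolding mode_def act_def fls_mono_nat[symmetric] by simp

lemma killed_fromE:
  assumes "v \<in> Vc" obtains N where "killed_from N v"
proof -
  obtain M where M: "\<And>f. (\<And>i. i < M \<Longrightarrow> f $ i = 0) \<Longrightarrow> act f v = 0" using smooth[OF assms] by blast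
  have "killed_from M v"
    unfolding killed_from_def by (auto simp: mode_nonneg intro!: M)
  then show thesis by (rule that)
qed

lemma killed_from_mono: "killed_from N v \<Longrightarrow> N \<le> M \<Longrightarrow> killed_from M v"
  by (auto simp: killed_from_def)

lemma affine_decomposition:
  fixes x :: "'g affine"
  assumes "\<And>i. i < - int K \<Longrightarrow> fst x $$ i = 0"
  shows "x = (\<Sum>p\<in>{- int K..<int M}. (fls_mono (fst x $$ p) p, 0))
    + (fps_to_fls (Abs_fps (\<lambda>n. if n < M then 0 else fst x $$ int n)), 0) + (0, snd x)"
proof (rule affine_eqI)
  fix n
  have "fst (\<Sum>p\<in>{- int K..<int M}. (fls_mono (fst x $$ p) p, 0 :: complex)) $$ n
     = (\<Sum>p\<in>{- int K..<int M}. if p = n then fst x $$ n else 0)"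
    unfolding fst_sum by (subst additive_fun_sum[of "\<lambda>f. f $$ n"]) (auto intro: sum.cong)
  then show "fst x $$ n = fst ((\<Sum>p\<in>{- int K..<int M}. (fls_mono (fst x $$ p) p, 0))
    + (fps_to_fls (Abs_fps (\<lambda>n. if n < M then 0 else fst x $$ int n)), 0) + (0, snd x)) $$ n"
    using assms by auto
qed (simp add: snd_sum)

text \<open>On a fixed vector the tail of x acts by 0, so x acts through finitely many modes and a
  scalar. In this way facts about modes reach every element of the affine algebra, although Laurent
  series have infinitely many coefficients.\<close>

lemma A_expansion:
  assumes v: "v \<in> Vc"
  obtains K M where "A x v = (\<Sum>p\<in>{- int K..<int M}. mode (fst x $$ p) p v) + sv (snd x) v"
proof -
  obtain M where M: "\<And>f. (\<And>i. i < M \<Longrightarrow> f $ i = 0) \<Longrightarrow> act f v = 0" using smooth[OF v] by blast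
  obtain K :: nat where "\<forall>n>K. fst x $$ (- int n) = 0" by (rule fls_nth_vanishes_below_natE)
  then have K: "fst x $$ i = 0" if "i < - int K" for i
    using that by (auto dest: spec[of _ "nat (- i)"])
  have "A x v = A ((\<Sum>p\<in>{- int K..<int M}. (fls_mono (fst x $$ p) p, 0))
    + (fps_to_fls (Abs_fps (\<lambda>n. if n < M then 0 else fst x $$ int n)), 0) + (0, snd x)) v"
    using arg_cong[OF affine_decomposition[OF K, where M = M], where f = "\<lambda>x. A x v"] .
  also have "\<dots> = (\<Sum>p\<in>{- int K..<int M}. A (fls_mono (fst x $$ p) p, 0) v)
     + A (fps_to_fls (Abs_fps (\<lambda>n. if n < M then 0 else fst x $$ int n)), 0) v + A (0, snd x) v"
    unfolding A_add_left additive_fun_sum[of "\<lambda>x. A x v", OF A_add_left] by (rule refl)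
  also have "A (fps_to_fls (Abs_fps (\<lambda>n. if n < M then 0 else fst x $$ int n)), 0) v = 0"
    using M by (simp add: act_def)
  finally show thesis by (intro that[of K M]) (simp add: mode_def A_central[OF v])
qed

lemma act_vanishes:
  assumes v: "v \<in> Vc" and kill: "killed_from N v" and f: "\<And>i. i < N \<Longrightarrow> f $ i = 0"
  shows "act f v = 0"
proof -
  obtain K M where "A (fps_to_fls f, 0) v
      = (\<Sum>p\<in>{- int K..<int M}. mode (fst (fps_to_fls f, 0 :: complex) $$ p) p v) + sv (snd (fps_to_fls f, 0)) v"
    by (rule A_expansion[OF v])
  also have "\<dots> = 0"
    using f kill by (auto simp: killed_from_def not_le intro!: sum.neutral) (metis mode_zero(1) nat_less_iff not_less)
  finally show ?thesis by (simp add: act_def)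
qed

lemma mode_vac: "0 \<le> r \<Longrightarrow> mode c r vac = 0"
  by (simp add: mode_nonneg act_def vac_ann)

text \<open>For r at least N + |p| + 1 the shifted index r + p is at least N and positive, so the
  commutator is a mode that kills v, without a central term.\<close>

lemma killed_from_mode:
  assumes v: "v \<in> Vc" and kill: "killed_from N v"
  shows "killed_from (N + nat \<bar>p\<bar> + 1) (mode b p v)"
  unfolding killed_from_def
proof (intro allI impI)
  fix c r assume r: "int (N + nat \<bar>p\<bar> + 1) \<le> r"
  then show "mode c r (mode b p v) = 0"
    using mode_commutator[OF v, of c r b p] kill by (auto simp: killed_from_def)
qed

text \<open>Words in the creation operators b t^-q applied to the vacuum, each carried along with
  its energy, since the resulting vector does not display it.\<close>

inductive_set neg_words :: "(int \<times> 'v) set" where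
  vac: "(0, vac) \<in> neg_words"
| mode: "(w, v) \<in> neg_words \<Longrightarrow> 0 < q \<Longrightarrow> (w + q, mode b (- q) v) \<in> neg_words"

lemma neg_words_closed: "(w, v) \<in> neg_words \<Longrightarrow> v \<in> Vc"
  by (induction rule: neg_words.induct) (auto intro: vac_in mode_closed)

lemma neg_words_weight: "(w, v) \<in> neg_words \<Longrightarrow> w > 0 \<or> w = 0 \<and> v = vac"
  by (induction rule: neg_words.induct) auto

text \<open>A mode is commuted past the leading creation operator. The three resulting terms involve
  modes of the shorter word or the word itself.\<close>

lemma neg_words_span: "(w, v) \<in> neg_words \<Longrightarrow> mode b p v \<in> V.span (snd ` neg_words)"
proof (induction arbitrary: b p rule: neg_words.induct)
  case vac
  show ?case
  proof (cases "p < 0")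
    case True
    then show ?thesis using neg_words.mode[OF neg_words.vac, of "- p" b] by (force intro: V.span_base)
  qed (simp add: mode_vac V.span_zero)
next
  case (mode w v q c)
  have "mode c (- q) u \<in> V.span (snd ` neg_words)" if "u \<in> V.span (snd ` neg_words)" for u
    using that
  proof (induction rule: V.span_induct_alt)
    case (step k x y)
    then obtain w' where "(w', x) \<in> neg_words" by auto
    then have "mode c (- q) x \<in> V.span (snd ` neg_words)"
      using neg_words.mode[OF _ mode(2)] by (force intro: V.span_base)
    then show ?case using step by (simp add: V.span_add V.span_scale)
  qed (simp add: V.span_zero)
  moreover have "mode b p (mode c (- q) v) = mode c (- q) (mode b p v) + mode (br b c) (p + - q) v
      + sv (if p + - q = 0 then of_int p * \<kappa> b c else 0) v"
    using mode_commutator[OF neg_words_closed[OF mode(1)], of b p c "- q"] by (simp only: algebra_simps)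
  moreover have "v \<in> V.span (snd ` neg_words)" using mode(1) by (force intro: V.span_base)
  ultimately show ?case using mode.IH by (metis V.span_add V.span_scale)
qed

definition weights_below :: "nat \<Rightarrow> 'v set" where
  "weights_below M = V.span {v. \<exists>w\<le>int M. (w, v) \<in> neg_words}"

lemma weights_below_mono:
  assumes "M \<le> M'" shows "weights_below M \<subseteq> weights_below M'"
proof -
  have "int M \<le> int M'" using assms by simp
  then show ?thesis
    unfolding weights_below_def by (intro V.span_mono Collect_mono impI) (meson order_trans)
qed

text \<open>The span of all words contains the vacuum and is stable under modes, hence by
  \<open>A_expansion\<close> under the affine algebra, so it exhausts the module. A given vector
  uses finitely many words and therefore has a largest weight.\<close>

lemma weights_exhaust:
  assumes "v \<in> Vc" obtains M where "v \<in> weights_below M"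
proof -
  have "Vc \<subseteq> V.span (snd ` neg_words)"
  proof (rule generated)
    show "V.subspace (V.span (snd ` neg_words))" by (rule V.subspace_span)
    show "vac \<in> V.span (snd ` neg_words)" using neg_words.vac by (force intro: V.span_base)
    fix x :: "'g affine" and v assume "v \<in> V.span (snd ` neg_words)"
    then show "A x v \<in> V.span (snd ` neg_words)"
    proof (induction rule: V.span_induct_alt)
      case (step k u y)
      then obtain w where w: "(w, u) \<in> neg_words" by auto
      obtain K M where "A x u = (\<Sum>p\<in>{- int K..<int M}. mode (fst x $$ p) p u) + sv (snd x) u"
        by (rule A_expansion[OF neg_words_closed[OF w]])
      moreover have "u \<in> V.span (snd ` neg_words)" using step(1) by (rule V.span_base)
      ultimately have "A x u \<in> V.span (snd ` neg_words)"
        using neg_words_span[OF w] by (auto intro!: V.span_add V.span_sum V.span_scale)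
      then show ?case using step by (simp add: A_add A_scale V.span_add V.span_scale)
    qed (simp add: V.span_zero)
  qed
  then have "v \<in> V.span (snd ` neg_words)" using assms by blast
  then have "\<exists>M. v \<in> weights_below M"
  proof (induction rule: V.span_induct_alt)
    case base
    then show ?case by (simp add: weights_below_def V.span_zero)
  next
    case (step k x y)
    then obtain w M where w: "(w, x) \<in> neg_words" "y \<in> weights_below M" by auto
    have "x \<in> weights_below (max M (nat w))"
      unfolding weights_below_def using w(1) by (intro V.span_base CollectI exI[of _ w]) auto
    moreover have "y \<in> weights_below (max M (nat w))"
      using w(2) weights_below_mono[of M "max M (nat w)"] by auto
    ultimately have "sv k x + y \<in> weights_below (max M (nat w))"
      unfolding weights_below_def by (intro V.span_add V.span_scale)
    then show ?case by blast
  qed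
  then show thesis using that by blast
qed

end

section \<open>Spectrum of the Sugawara operator and the invariant vectors\<close>

context sugawara_module
begin

text \<open>Any truncation beyond which all modes kill v gives the same value, so the choice of N is
  harmless; the half undoes the doubling in \<open>sug\<close>.\<close>

definition sugawara :: "'v \<Rightarrow> 'v" where
  "sugawara v = sv (1 / 2) (sug (SOME N. killed_from N v) v)"

lemma sugawara_eq:
  assumes "killed_from N v" shows "sugawara v = sv (1 / 2) (sug N v)"
proof -
  define N' where "N' = (SOME N. killed_from N v)"
  have N': "killed_from N' v" unfolding N'_def using assms by (rule someI)
  have "sug (max N N') v = sug N v" "sug (max N N') v = sug N' v"
    using assms N' by (auto intro!: sug_stable simp: killed_from_def)
  then show ?thesis by (simp add: sugawara_def N'_def)
qed

lemma sugawara_twice: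
  assumes "killed_from N v" shows "sug N v = sugawara v + sugawara v"
  by (simp add: sugawara_eq[OF assms] V.scale_left_distrib[symmetric])

lemma killed_from_common:
  assumes "v \<in> Vc" "w \<in> Vc" obtains N where "killed_from N v" "killed_from N w"
proof -
  obtain N M where "killed_from N v" "killed_from M w"
    using killed_fromE assms by metis
  then have "killed_from (max N M) v" "killed_from (max N M) w"
    by (auto intro: killed_from_mono)
  then show thesis by (rule that)
qed

lemma sugawara_add:
  assumes "v \<in> Vc" "w \<in> Vc" shows "sugawara (v + w) = sugawara v + sugawara w"
proof -
  obtain N where N: "killed_from N v" "killed_from N w" by (rule killed_from_common[OF assms])
  then have "killed_from N (v + w)" by (simp add: killed_from_def)
  then show ?thesis using N by (simp add: sugawara_eq sug_add V.scale_right_distrib)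
qed

lemma sugawara_scale:
  assumes "v \<in> Vc" shows "sugawara (sv c v) = sv c (sugawara v)"
proof -
  obtain N where N: "killed_from N v" by (rule killed_fromE[OF assms])
  then have "killed_from N (sv c v)" by (simp add: killed_from_def)
  then show ?thesis using N by (simp add: sugawara_eq sug_scale mult.commute)
qed

lemma sugawara_closed: "v \<in> Vc \<Longrightarrow> sugawara v \<in> Vc"
  by (simp add: sugawara_def Vc_closed sug_closed)

lemma sugawara_zero [simp]: "sugawara 0 = 0"
  using sugawara_scale[of 0 0] Vc_closed(3) by simp

lemma sugawara_diff:
  assumes "v \<in> Vc" "w \<in> Vc" shows "sugawara (v - w) = sugawara v - sugawara w"
  using sugawara_add[OF assms(1) Vc_closed(2)[OF assms(2), of "-1"]] sugawara_scale[OF assms(2), of "-1"]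
  by simp

lemma sugawara_mode:
  assumes v: "v \<in> Vc"
  shows "sugawara (mode b p v) = mode b p (sugawara v) - sv (of_int p) (mode b p v)"
proof -
  obtain N0 where "killed_from N0 v" by (rule killed_fromE[OF v])
  \<comment> \<open>The surplus |p| + 1 meets both side conditions of \<open>sug_mode\<close>: |p| <
    N, and v is killed from N - |p| on.\<close>
  define N where "N = N0 + nat \<bar>p\<bar> + 1"
  have N: "killed_from N v" "killed_from N (mode b p v)"
    using killed_from_mode[OF v \<open>killed_from N0 v\<close>] killed_from_mono[OF \<open>killed_from N0 v\<close>]
    by (simp_all add: N_def)
  have "sug N (mode b p v) - mode b p (sug N v) = - sv (of_int p) (mode b p v) - sv (of_int p) (mode b p v)"
    by (rule sug_mode[OF v]) (use \<open>killed_from N0 v\<close> in \<open>auto simp: N_def killed_from_def\<close>)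
  then have "sug N (mode b p v) = mode b p (sug N v) - (sv (of_int p) (mode b p v) + sv (of_int p) (mode b p v))"
    by (simp add: algebra_simps)
  then have "sugawara (mode b p v) = mode b p (sugawara v)
      - sv (1 / 2) (sv (of_int p) (mode b p v) + sv (of_int p) (mode b p v))"
    using N by (simp add: sugawara_eq V.scale_right_diff_distrib)
  also have "sv (1 / 2) (sv (of_int p) (mode b p v) + sv (of_int p) (mode b p v)) = sv (of_int p) (mode b p v)"
    by (simp add: V.scale_left_distrib[symmetric])
  finally show ?thesis .
qed

lemma sugawara_vac: "sugawara vac = 0"
proof -
  have "killed_from 0 vac" by (simp add: killed_from_def mode_vac)
  then show ?thesis by (simp add: sugawara_eq sug_def mode_vac)
qed

lemma sugawara_neg_words: "(w, v) \<in> neg_words \<Longrightarrow> sugawara v = sv (of_int w) v"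
proof (induction rule: neg_words.induct)
  case (mode w v q b)
  then show ?case
    by (simp add: sugawara_mode[OF neg_words_closed] V.scale_left_distrib)
qed (simp add: sugawara_vac)

text \<open>The operator is the product of the factors L_0 + t - w over the roots w in
  \<open>ws\<close>. The shift t will be the total degree of monomial arguments, which the energy
  adds to the Sugawara eigenvalue.\<close>

lemma sugawara_fold:
  fixes t :: int
  defines "f \<equiv> \<lambda>w v. sugawara v + sv (of_int t) v - sv w v"
  shows sugawara_fold_linear:
      "u \<in> Vc \<Longrightarrow> u' \<in> Vc \<Longrightarrow> fold f ws (sv k u + u') = sv k (fold f ws u) + fold f ws u'"
    and sugawara_fold_zero: "fold f ws 0 = 0"
    and sugawara_fold_eigen: "sugawara u = sv (of_int m) u \<Longrightarrow> u \<in> Vc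
      \<Longrightarrow> fold f ws u = sv (\<Prod>w\<leftarrow>ws. of_int (m + t) - w) u"
proof -
  show lin: "fold f ws (sv k u + u') = sv k (fold f ws u) + fold f ws u'" if "u \<in> Vc" "u' \<in> Vc" for u u' k ws
    using that
  proof (induction ws arbitrary: u u')
    case (Cons w ws)
    have "f w (sv k u + u') = sv k (f w u) + f w u'"
      using Cons.prems by (simp add: f_def sugawara_add sugawara_scale Vc_closed V.scale_right_distrib
          V.scale_right_diff_distrib mult.commute algebra_simps)
    then show ?case using Cons.prems Cons.IH[of "f w u" "f w u'"]
      by (simp add: f_def Vc_closed sugawara_closed)
  qed simp
  show zero: "fold f ws 0 = 0" for ws by (induction ws) (auto simp: f_def)
  show "fold f ws u = sv (\<Prod>w\<leftarrow>ws. of_int (m + t) - w) u" if "sugawara u = sv (of_int m) u" "u \<in> Vc"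
  proof (induction ws)
    case (Cons w ws)
    have "f w u = sv (of_int (m + t) - w) u + 0"
      using that by (simp add: f_def V.scale_left_distrib V.scale_left_diff_distrib)
    then have "fold f (w # ws) u = sv (of_int (m + t) - w) (fold f ws u) + fold f ws 0"
      using lin[OF that(2) Vc_closed(3)] by (simp del: of_int_add)
    then show ?case using Cons zero by simp
  qed simp
qed

text \<open>A word of weight m is an eigenvector on which the factor with w = m + t vanishes;
  linearity covers the span.\<close>

lemma sugawara_annihilated:
  assumes "v \<in> V.span {v. \<exists>m\<in>I. (m, v) \<in> neg_words}" "\<And>m. m \<in> I \<Longrightarrow> of_int (m + t) \<in> set ws"
  shows "fold (\<lambda>w v. sugawara v + sv (of_int t) v - sv w v) ws v = 0"
proof -
  let ?f = "\<lambda>w v. sugawara v + sv (of_int t) v - sv w v"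
  have "v \<in> Vc \<and> fold ?f ws v = 0"
    using assms(1)
  proof (induction rule: V.span_induct_alt)
    case base
    then show ?case using Vc_closed(3) sugawara_fold_zero by simp
  next
    case (step k u y)
    then obtain m where m: "m \<in> I" "(m, u) \<in> neg_words" by auto
    have "(\<Prod>w\<leftarrow>ws. of_int (m + t) - w) = (0::complex)"
      using assms(2)[OF m(1)] by (auto simp: prod_list_zero_iff simp del: of_int_add)
    then have "fold ?f ws u = 0"
      using sugawara_fold_eigen[OF sugawara_neg_words[OF m(2)] neg_words_closed[OF m(2)]] by simp
    then show ?case using step sugawara_fold_linear[OF neg_words_closed[OF m(2)], of y] neg_words_closed[OF m(2)]
      by (simp add: Vc_closed)
  qed
  then show ?thesis by simp
qed

text \<open>Every term of the Sugawara operator applies a nonnegative mode, so an invariant vector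
  has energy 0. So has its component u in the weights 1 to M, since the remaining component is a
  multiple of the vacuum. The product of the factors L_0 - w with w from 1 to M annihilates u, but
  it also multiplies u by the nonzero product of the -w.\<close>

lemma invariant_vectors:
  assumes v: "v \<in> Vc" and inv: "\<And>f. act f v = 0"
  shows "\<exists>c. v = sv c vac"
proof -
  have k: "killed_from 0 v" using inv by (simp add: killed_from_def mode_nonneg)
  then have "sug 0 v = 0" by (simp add: sug_def killed_from_def)
  then have S: "sugawara v = 0" by (simp add: sugawara_eq[OF k])
  obtain M where "v \<in> weights_below M" by (rule weights_exhaust[OF v])
  let ?P = "{v. \<exists>w\<in>{1..int M}. (w, v) \<in> neg_words}"
  have "\<exists>c u. v = sv c vac + u \<and> u \<in> V.span ?P"
    using \<open>v \<in> weights_below M\<close> unfolding weights_below_def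
  proof (induction rule: V.span_induct_alt)
    case base
    show ?case by (rule exI[of _ 0], rule exI[of _ 0]) (simp add: V.span_zero)
  next
    case (step k x y)
    obtain w where w: "w \<le> int M" "(w, x) \<in> neg_words" using step(1) by auto
    obtain c u where cu: "y = sv c vac + u" "u \<in> V.span ?P" using step(2) by auto
    show ?case
    proof (cases "w > 0")
      case True
      then have "x \<in> ?P" using w by (intro CollectI bexI[of _ w]) auto
      then have "sv k x + u \<in> V.span ?P" by (rule V.span_add[OF V.span_scale[OF V.span_base] cu(2)])
      then show ?thesis using cu by (intro exI[of _ c] exI[of _ "sv k x + u"]) (simp add: algebra_simps)
    next
      case False
      then have "x = vac" using neg_words_weight[OF w(2)] by auto
      then show ?thesis using cu by (intro exI[of _ "k + c"] exI[of _ u]) (simp add: V.scale_left_distrib)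
    qed
  qed
  then obtain c u where cu: "v = sv c vac + u" "u \<in> V.span ?P" by blast
  have "?P \<subseteq> Vc" using neg_words_closed by auto
  then have uV: "u \<in> Vc" using cu(2) V.span_minimal[OF _ Vc_subspace] by blast
  have Su: "sugawara u = sv (of_int 0) u"
    using S sugawara_add[OF Vc_closed(2)[OF vac_in] uV] sugawara_scale[OF vac_in] sugawara_vac cu(1) by simp
  define ws where "ws = map (of_nat :: nat \<Rightarrow> complex) [1..<Suc M]"
  have "of_int (m + 0) \<in> set ws" if "m \<in> {1..int M}" for m
  proof -
    have "nat m \<in> set [1..<Suc M]" "of_int (m + 0) = (of_nat (nat m) :: complex)" using that by auto
    then show ?thesis unfolding ws_def set_map by (metis imageI)
  qed
  from sugawara_annihilated[OF cu(2) this] sugawara_fold_eigen[OF Su uV, of 0 ws]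
  have "sv (\<Prod>w\<leftarrow>ws. of_int (0 + 0) - w) u = 0" by simp
  moreover have "(\<Prod>w\<leftarrow>ws. of_int (0 + 0) - w) \<noteq> 0"
    by (auto simp: prod_list_zero_iff ws_def)
  ultimately have "u = 0" by (simp only: V.scale_eq_0_iff) simp
  then show ?thesis using cu(1) by auto
qed

end

section \<open>Closure properties of truncated cochains and the invariant subcomplex\<close>

lemma slot_vanishing_weaken: "slot_vanishing P \<phi> \<Longrightarrow> (\<And>x. Q x \<Longrightarrow> P x) \<Longrightarrow> slot_vanishing Q \<phi>"
  by (auto simp: slot_vanishing_def)

context affine_module
begin

lemma euler_zero: "euler (fps_const a) = 0"
  by (rule fps_ext) (simp add: euler_nth)

abbreviation lie :: "'g fps \<Rightarrow> ('g fps list \<Rightarrow> 'v) \<Rightarrow> 'g fps list \<Rightarrow> 'v" where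
  "lie \<equiv> lie_der act (fps_bracket br)"

definition invariant_cochain :: "('g fps list \<Rightarrow> 'v) \<Rightarrow> bool" where
  "invariant_cochain \<phi> \<longleftrightarrow> (\<forall>a xs. lie (fps_const a) \<phi> xs = 0)"

lemma mode_cochain_mono: "mode_cochain N \<phi> \<Longrightarrow> N \<le> M \<Longrightarrow> mode_cochain M \<phi>"
  unfolding mode_cochain_def by (auto intro: slot_vanishing_weaken)

lemma mode_cochain_combination:
  assumes "mode_cochain N \<phi>" "mode_cochain N \<psi>"
  shows "mode_cochain N (\<lambda>xs. sv a (\<phi> xs) + sv b (\<psi> xs))"
proof -
  note d = mode_cochainD[OF assms(1)] and e = mode_cochainD[OF assms(2)]
  have "slot_alternating (\<lambda>xs. sv a (\<phi> xs) + sv b (\<psi> xs))"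
    unfolding slot_alternating_def
  proof (intro allI)
    fix us x y vs
    show "sv a (\<phi> (us @ x # y # vs)) + sv b (\<psi> (us @ x # y # vs))
      = - (sv a (\<phi> (us @ y # x # vs)) + sv b (\<psi> (us @ y # x # vs)))"
      using slot_alternatingD[OF d(4), of us x y vs] slot_alternatingD[OF e(4), of us x y vs] by simp
  qed
  moreover have "slot_homogeneous (fps_scale s) sv (\<lambda>xs. sv a (\<phi> xs) + sv b (\<psi> xs))"
    using d(3) e(3) by (simp add: slot_homogeneous_def V.scale_right_distrib mult.commute)
  moreover have "slot_additive (\<lambda>xs. sv a (\<phi> xs) + sv b (\<psi> xs))"
    using d(2) e(2) by (simp add: slot_additive_def V.scale_right_distrib algebra_simps)
  moreover have "slot_vanishing (\<lambda>x. \<forall>i. 0 < i \<and> i < N \<longrightarrow> x $ i = 0) (\<lambda>xs. sv a (\<phi> xs) + sv b (\<psi> xs))"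
    using assms by (auto simp: mode_cochain_def slot_vanishing_def)
  ultimately show ?thesis using d(1,5) e(1,5) by (simp add: mode_cochain_def Vc_closed)
qed

lemma mode_cochain_zero: "mode_cochain N (\<lambda>xs. 0)"
  unfolding mode_cochain_def slot_additive_def slot_homogeneous_def slot_vanishing_def slot_alternating_def
  by (auto intro: Vc_closed)

lemma mode_cochain_sum:
  assumes "\<And>i. i \<in> I \<Longrightarrow> mode_cochain N (\<phi> i)"
  shows "mode_cochain N (\<lambda>xs. \<Sum>i\<in>I. \<phi> i xs)"
  using assms
proof (induction I rule: infinite_finite_induct)
  case (insert i I)
  then show ?case using mode_cochain_combination[of N "\<phi> i" "\<lambda>xs. \<Sum>i\<in>I. \<phi> i xs" 1 1] by simp
qed (simp_all add: mode_cochain_zero)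

lemma slot_der_closed:
  assumes "\<And>ys. \<phi> ys \<in> Vc" shows "slot_der T \<phi> xs \<in> Vc"
  using slot_der_hom_on[of Vc "\<lambda>v. v" \<phi> T xs] assms by (simp add: Vc_closed)

lemma mode_cochain_slot_der:
  assumes \<phi>: "mode_cochain N \<phi>" and T: "\<And>x y. T (x + y) = T x + T y" "\<And>c x. T (fps_scale s c x) = fps_scale s c (T x)"
    and M: "N \<le> M" "\<And>x. (\<forall>i. 0 < i \<and> i < M \<longrightarrow> x $ i = 0) \<Longrightarrow> (\<forall>i. 0 < i \<and> i < N \<longrightarrow> T x $ i = 0)"
  shows "mode_cochain M (slot_der T \<phi>)"
  unfolding mode_cochain_def
proof (intro conjI allI impI)
  note d = mode_cochainD[OF \<phi>]
  show "slot_der T \<phi> xs \<in> Vc" for xs by (rule slot_der_closed) (rule d)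
  show "slot_additive (slot_der T \<phi>)" by (rule slot_additive_slot_der[OF d(2) T(1)])
  show "slot_homogeneous (fps_scale s) sv (slot_der T \<phi>)"
    by (rule slot_homogeneous_slot_der[OF d(3) T(2) V.scale_right_distrib])
  show "slot_alternating (slot_der T \<phi>)" by (rule slot_alternating_slot_der[OF d(4)])
  show "slot_vanishing (\<lambda>x. \<forall>i. 0 < i \<and> i < M \<longrightarrow> x $ i = 0) (slot_der T \<phi>)"
    by (rule slot_vanishing_slot_der[of "\<lambda>x. \<forall>i. 0 < i \<and> i < N \<longrightarrow> x $ i = 0"])
      (use \<phi> M in \<open>auto simp: mode_cochain_def\<close>)
  show "mode c r (slot_der T \<phi> xs) = 0" if "int M \<le> r" for c r xs
  proof -
    have "mode c r (slot_der T \<phi> xs) = slot_der T (\<lambda>ys. mode c r (\<phi> ys)) xs"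
      by (rule slot_der_hom[symmetric]) simp
    also have "(\<lambda>ys. mode c r (\<phi> ys)) = (\<lambda>ys. 0)" using d(5) that M(1) by auto
    finally show ?thesis by (simp add: slot_der_zero)
  qed
qed

lemma mode_cochain_mode:
  assumes \<phi>: "mode_cochain N \<phi>" and M: "N + nat \<bar>p\<bar> + 1 \<le> M"
  shows "mode_cochain M (\<lambda>xs. mode b p (\<phi> xs))"
  unfolding mode_cochain_def
proof (intro conjI allI impI)
  note d = mode_cochainD[OF \<phi>]
  show "mode b p (\<phi> xs) \<in> Vc" for xs by (rule mode_closed) (rule d)
  show "slot_additive (\<lambda>xs. mode b p (\<phi> xs))" using d(2) by (simp add: slot_additive_def)
  show "slot_homogeneous (fps_scale s) sv (\<lambda>xs. mode b p (\<phi> xs))" using d(3) by (simp add: slot_homogeneous_def)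
  show "slot_alternating (\<lambda>xs. mode b p (\<phi> xs))"
    unfolding slot_alternating_def by (intro allI) (subst slot_alternatingD[OF d(4)], simp)
  show "slot_vanishing (\<lambda>x. \<forall>i. 0 < i \<and> i < M \<longrightarrow> x $ i = 0) (\<lambda>xs. mode b p (\<phi> xs))"
    using \<phi> M by (auto simp: mode_cochain_def slot_vanishing_def)
  show "mode c r (mode b p (\<phi> xs)) = 0" if "int M \<le> r" for c r xs
    using killed_from_mode[OF d(1), of N xs p b] d(5) M that by (auto simp: killed_from_def)
qed

lemma diff_closed: "(\<And>xs. \<phi> xs \<in> Vc) \<Longrightarrow> diff \<phi> xs \<in> Vc"
  by (induction xs arbitrary: \<phi>) (auto simp: lie_der_def intro!: Vc_closed act_closed slot_der_closed)

lemma lie_closed: "(\<And>xs. \<phi> xs \<in> Vc) \<Longrightarrow> lie x \<phi> xs \<in> Vc"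
  by (auto simp: lie_der_def intro!: Vc_closed act_closed slot_der_closed)

lemma slot_additive_lie: "slot_additive \<phi> \<Longrightarrow> slot_additive (lie u \<phi>)"
  using slot_additive_slot_der[of \<phi> "fps_bracket br u"]
  by (simp add: slot_additive_def lie_der_def act_add fps_bracket_add_right algebra_simps)

lemma slot_additive_diff:
  assumes "slot_additive \<phi>" shows "slot_additive (diff \<phi>)"
proof -
  have "diff \<phi> (us @ (x + y) # vs) = diff \<phi> (us @ x # vs) + diff \<phi> (us @ y # vs)" for us x y vs
    using assms
  proof (induction us arbitrary: \<phi>)
    case Nil
    have "(\<lambda>ys. \<phi> ((x + y) # ys)) = (\<lambda>ys. \<phi> (x # ys) + \<phi> (y # ys))"
      using slot_additive_first[OF Nil] by auto
    moreover have "lie (x + y) \<phi> vs = lie x \<phi> vs + lie y \<phi> vs"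
      by (simp add: lie_der_def act_add_left fps_bracket_add_left[abs_def] slot_der_add_map[OF Nil])
    ultimately show ?case by (simp add: cartan_diff_add[OF act_add])
  next
    case (Cons u us)
    then show ?case
      using Cons.IH[OF slot_additive_insert[OF Cons.prems], of u] slot_additive_lie[OF Cons.prems, of u]
      by (simp add: slot_additive_def)
  qed
  then show ?thesis by (simp add: slot_additive_def)
qed

text \<open>This is where invariance makes the relative cochains a subcomplex: on a constant a,
  Cartan's formula gives L_a \<phi> minus the differential of the contraction, and both are 0. On a
  series starting in degree N every term of the formula vanishes separately.\<close>

lemma slot_vanishing_diff:
  assumes \<phi>: "mode_cochain N \<phi>" and inv: "invariant_cochain \<phi>"
  shows "slot_vanishing (\<lambda>x. \<forall>i. 0 < i \<and> i < N \<longrightarrow> x $ i = 0) (diff \<phi>)"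
proof (rule slot_vanishing_front)
  note d = mode_cochainD[OF \<phi>]
  let ?P = "\<lambda>x. \<forall>i. 0 < i \<and> i < N \<longrightarrow> x $ i = 0"
  have van: "slot_vanishing ?P \<phi>" using \<phi> by (simp add: mode_cochain_def)
  show "slot_alternating (diff \<phi>)"
    by (rule slot_alternating_cartan_diff[OF act_add d(4,2) fps_bracket_swap])
  fix x :: "'g fps" and vs assume x: "?P x"
  define t where "t = x - fps_const (x $ 0)"
  have t: "t $ i = 0" if "i < N" for i using x that by (cases "i = 0") (auto simp: t_def)
  have "slot_der (fps_bracket br t) \<phi> vs = 0"
    by (rule slot_der_zero_map[OF van]) (simp add: fps_bracket_vanishes[of N t] t)
  moreover have "act t (\<phi> vs) = 0"
    by (rule act_vanishes[OF d(1), of N]) (use d(5) t in \<open>auto simp: killed_from_def\<close>)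
  moreover have "(\<lambda>ys. \<phi> (t # ys)) = (\<lambda>ys. 0)" "(\<lambda>ys. \<phi> (fps_const (x $ 0) # ys)) = (\<lambda>ys. 0)"
    by (rule ext, rule slot_vanishing_first[OF van], simp add: t)+
  ultimately have "diff \<phi> (t # vs) = 0" "diff \<phi> (fps_const (x $ 0) # vs) = 0"
    using inv by (simp_all add: lie_der_def[of _ _ t] cartan_diff_zero[OF act_add] invariant_cochain_def)
  moreover have "x = t + fps_const (x $ 0)" by (simp add: t_def)
  ultimately show "diff \<phi> (x # vs) = 0"
    using slot_additive_first[OF slot_additive_diff[OF d(2)], of t "fps_const (x $ 0)" vs] by simp
qed

end

section \<open>The total energy operator on cochains\<close>

context sugawara_module
begin

text \<open>Slot by slot, from the left, an argument is a finite sum of positive monomials plus a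
  remainder invisible to F.\<close>

lemma positive_lists_determine:
  fixes F :: "'g fps list \<Rightarrow> 'v"
  assumes add: "slot_additive F" and van: "slot_vanishing (\<lambda>x. \<forall>i. 0 < i \<and> i < N \<longrightarrow> x $ i = 0) F"
    and zero: "\<And>xs. set xs \<subseteq> pos_monos \<Longrightarrow> F xs = 0"
  shows "F xs = 0"
proof -
  have "F (us @ vs) = 0" if "set us \<subseteq> pos_monos" for us vs
    using that
  proof (induction vs arbitrary: us)
    case (Cons x vs)
    \<comment> \<open>The remainder keeps the constant term and all degrees from N on.\<close>
    define r where "r = Abs_fps (\<lambda>i. if 0 < i \<and> i < N then 0 else x $ i)"
    have x: "x = (\<Sum>p\<in>{1..<N}. pos_mono (x $ p) (int p)) + r"
    proof (rule fps_ext)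
      fix n
      have "(\<Sum>p\<in>{1..<N}. pos_mono (x $ p) (int p)) $ n = (\<Sum>p\<in>{1..<N}. if p = n then x $ n else 0)"
        unfolding fps_sum_nth by (rule sum.cong) (auto simp: pos_mono_nth)
      then show "x $ n = ((\<Sum>p\<in>{1..<N}. pos_mono (x $ p) (int p)) + r) $ n"
        by (auto simp: r_def)
    qed
    have a: "F (us @ (y + z) # vs) = F (us @ y # vs) + F (us @ z # vs)" for y z
      using add by (simp add: slot_additive_def)
    have "F (us @ r # vs) = 0" using van by (auto simp: slot_vanishing_def r_def)
    moreover have "F (us @ (\<Sum>p\<in>{1..<N}. pos_mono (x $ p) (int p)) # vs)
        = (\<Sum>p\<in>{1..<N}. F (us @ pos_mono (x $ p) (int p) # vs))"
      by (rule additive_fun_sum[of "\<lambda>y. F (us @ y # vs)"]) (rule a)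
    moreover have "F (us @ pos_mono (x $ p) (int p) # vs) = 0" if "p \<in> {1..<N}" for p
    proof -
      have "pos_mono (x $ p) (int p) \<in> pos_monos"
        unfolding pos_monos_def using that by (intro CollectI exI conjI refl) auto
      then show ?thesis using Cons.IH[of "us @ [pos_mono (x $ p) (int p)]"] Cons.prems by simp
    qed
    ultimately show ?case by (subst x) (simp add: a)
  qed (simp add: zero)
  from this[of "[]"] show ?thesis by simp
qed

text \<open>Since \<open>slot_der\<close> is the dual action with its minus sign, subtracting it
  adds the total degree on monomial arguments; the two contributions reinforce each other and cannot
  cancel.\<close>

definition energy :: "('g fps list \<Rightarrow> 'v) \<Rightarrow> 'g fps list \<Rightarrow> 'v" where
  "energy \<phi> xs = sugawara (\<phi> xs) - slot_der euler \<phi> xs"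

lemma slot_der_sugawara:
  assumes "\<And>ys. \<phi> ys \<in> Vc"
  shows "slot_der T (\<lambda>ys. sugawara (\<phi> ys)) xs = sugawara (slot_der T \<phi> xs)"
  using slot_der_hom_on[of Vc sugawara \<phi> T xs] assms by (simp add: sugawara_diff Vc_closed)

lemma energy_insert: "energy \<phi> (x # xs) = energy (\<lambda>ys. \<phi> (x # ys)) xs + \<phi> (euler x # xs)"
  by (simp add: energy_def)

lemma energy_diff_fun:
  assumes "\<And>xs. \<phi> xs \<in> Vc" "\<And>xs. \<psi> xs \<in> Vc"
  shows "energy (\<lambda>xs. \<phi> xs - \<psi> xs) xs = energy \<phi> xs - energy \<psi> xs"
  by (simp add: energy_def sugawara_diff assms slot_der_diff)

lemma energy_combination:
  assumes "\<And>xs. \<phi> xs \<in> Vc" "\<And>xs. \<psi> xs \<in> Vc"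
  shows "energy (\<lambda>xs. sv a (\<phi> xs) + sv b (\<psi> xs)) xs = sv a (energy \<phi> xs) + sv b (energy \<psi> xs)"
  by (simp add: energy_def sugawara_add sugawara_scale Vc_closed assms slot_der_add
      slot_der_hom[of "sv _", OF V.scale_right_distrib] V.scale_right_diff_distrib algebra_simps)

lemma mode_cochain_energy:
  assumes \<phi>: "mode_cochain N \<phi>"
  shows "mode_cochain N (energy \<phi>)"
proof -
  note d = mode_cochainD[OF \<phi>]
  have "mode_cochain N (slot_der euler \<phi>)"
    by (rule mode_cochain_slot_der[OF \<phi>]) (auto simp: euler_add euler_scale euler_nth)
  moreover have "mode_cochain N (\<lambda>xs. sugawara (\<phi> xs))"
    unfolding mode_cochain_def
  proof (intro conjI allI impI)
    show "sugawara (\<phi> xs) \<in> Vc" for xs by (rule sugawara_closed) (rule d)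
    show "slot_additive (\<lambda>xs. sugawara (\<phi> xs))" using d(2) by (simp add: slot_additive_def sugawara_add d(1))
    show "slot_homogeneous (fps_scale s) sv (\<lambda>xs. sugawara (\<phi> xs))"
      using d(3) by (simp add: slot_homogeneous_def sugawara_scale d(1))
    show "slot_alternating (\<lambda>xs. sugawara (\<phi> xs))"
      unfolding slot_alternating_def
    proof (intro allI)
      fix us x y vs
      show "sugawara (\<phi> (us @ x # y # vs)) = - sugawara (\<phi> (us @ y # x # vs))"
        using slot_alternatingD[OF d(4), of us x y vs] sugawara_diff[OF Vc_closed(3) d(1)] by simp
    qed
    show "slot_vanishing (\<lambda>x. \<forall>i. 0 < i \<and> i < N \<longrightarrow> x $ i = 0) (\<lambda>xs. sugawara (\<phi> xs))"
      using \<phi> by (auto simp: mode_cochain_def slot_vanishing_def)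
    show "mode c r (sugawara (\<phi> xs)) = 0" if "int N \<le> r" for c r xs
      using sugawara_mode[OF d(1), of c r xs] d(5)[OF that] by simp
  qed
  ultimately show ?thesis
    using mode_cochain_combination[of N "\<lambda>xs. sugawara (\<phi> xs)" "slot_der euler \<phi>" 1 "-1"]
    by (simp add: energy_def[abs_def])
qed

text \<open>The derivation rule for \<open>euler\<close> on arguments and the Sugawara commutator on
  values produce the same correction \<open>lie (euler y)\<close>. The commutator enters as a
  hypothesis because it is available for constants and for monomials.\<close>

lemma lie_energy:
  assumes \<phi>: "mode_cochain N \<phi>"
    and y: "\<And>v. v \<in> Vc \<Longrightarrow> sugawara (act y v) = act y (sugawara v) - act (euler y) v"
  shows "lie y (energy \<phi>) zs = energy (lie y \<phi>) zs + lie (euler y) \<phi> zs"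
proof -
  note d = mode_cochainD[OF \<phi>]
  have "slot_der euler (slot_der (fps_bracket br y) \<phi>) zs - slot_der (fps_bracket br y) (slot_der euler \<phi>) zs
      = slot_der (fps_bracket br (euler y)) \<phi> zs"
    unfolding slot_der_commutator[OF d(2)] by (simp add: euler_bracket)
  then have c: "slot_der (fps_bracket br y) (slot_der euler \<phi>) zs
    = slot_der euler (slot_der (fps_bracket br y) \<phi>) zs - slot_der (fps_bracket br (euler y)) \<phi> zs"
    by (simp add: algebra_simps)
  show ?thesis
    unfolding lie_der_def energy_def
    by (simp add: sugawara_add act_closed slot_der_closed d(1) y slot_der_diff slot_der_add c
        slot_der_sugawara[OF d(1)] slot_der_hom[of "act y", OF act_add]
        additive_fun_diff[of "act y", OF act_add] algebra_simps)
qed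

lemma invariant_energy:
  assumes \<phi>: "mode_cochain N \<phi>" and inv: "invariant_cochain \<phi>"
  shows "invariant_cochain (energy \<phi>)"
  unfolding invariant_cochain_def
proof (intro allI)
  fix a xs
  have "lie (fps_const a) (energy \<phi>) xs = energy (lie (fps_const a) \<phi>) xs + lie (euler (fps_const a)) \<phi> xs"
    by (rule lie_energy[OF \<phi>]) (simp add: act_const sugawara_mode euler_zero)
  also have "lie (fps_const a) \<phi> = (\<lambda>ys. 0)" using inv by (auto simp: invariant_cochain_def)
  also have "energy (\<lambda>ys. 0) xs = 0" by (simp add: energy_def slot_der_zero)
  also have "lie (euler (fps_const a)) \<phi> xs = 0"
    using slot_der_zero_map[of "\<lambda>x. x = 0" \<phi> "fps_bracket br 0" xs] slot_additive_zero[OF mode_cochainD(2)[OF \<phi>]]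
    by (simp add: euler_zero lie_der_def slot_vanishing_def)
  finally show "lie (fps_const a) (energy \<phi>) xs = 0" by simp
qed

text \<open>By induction through Cartan's formula: for y of degree p the Lie derivative along y and
  the contraction with y both shift the energy by p, and these shifts match the degree that y
  contributes to the energy of the differential.\<close>

lemma diff_energy:
  assumes "mode_cochain N \<phi>" "set xs \<subseteq> pos_monos"
  shows "diff (energy \<phi>) xs = energy (diff \<phi>) xs"
  using assms
proof (induction xs arbitrary: \<phi>)
  case (Cons y zs)
  obtain b p where y: "y = pos_mono b p" and p: "0 < p" and zs: "set zs \<subseteq> pos_monos"
    using Cons.prems(2) by (auto simp: pos_monos_def)
  note \<phi> = Cons.prems(1)
  note d = mode_cochainD[OF \<phi>] and i = mode_cochain_insert[OF \<phi>, of y]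
  have ey: "euler y = fps_scale s (of_int p) y" by (simp add: y euler_pos_mono)
  have "lie y (energy \<phi>) zs = energy (lie y \<phi>) zs + lie (euler y) \<phi> zs"
    by (rule lie_energy[OF \<phi>]) (use p in \<open>simp add: y euler_pos_mono act_scale_left act_pos_mono sugawara_mode\<close>)
  also have "lie (euler y) \<phi> zs = sv (of_int p) (lie y \<phi> zs)"
    by (simp add: ey lie_der_def act_scale_left fps_bracket_scale_left[abs_def]
        slot_der_scale_map[OF d(3) V.scale_right_distrib] V.scale_right_distrib)
  finally have 1: "lie y (energy \<phi>) zs = energy (lie y \<phi>) zs + sv (of_int p) (lie y \<phi> zs)" .
  have "(\<lambda>ys. energy \<phi> (y # ys)) = (\<lambda>ys. energy (\<lambda>ys. \<phi> (y # ys)) ys + sv (of_int p) (\<phi> (y # ys)))"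
    by (simp add: energy_insert ey slot_homogeneous_first[OF d(3)])
  then have 2: "diff (energy \<phi>) (y # zs) = lie y (energy \<phi>) zs - energy (diff (\<lambda>ys. \<phi> (y # ys))) zs
      - sv (of_int p) (diff (\<lambda>ys. \<phi> (y # ys)) zs)"
    by (simp add: cartan_diff_add[OF act_add] Cons.IH[OF i zs]
        cartan_diff_hom[where f = "sv (of_int p)" and act = act, OF V.scale_right_distrib act_scale])
  have "energy (diff \<phi>) (y # zs) = energy (lie y \<phi>) zs - energy (diff (\<lambda>ys. \<phi> (y # ys))) zs
      + diff \<phi> (euler y # zs)"
    unfolding energy_insert using energy_diff_fun[of "lie y \<phi>" "diff (\<lambda>ys. \<phi> (y # ys))" zs]
    by (simp add: lie_closed diff_closed d(1))
  also have "diff \<phi> (euler y # zs) = sv (of_int p) (lie y \<phi> zs - diff (\<lambda>ys. \<phi> (y # ys)) zs)"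
  proof -
    have "(\<lambda>ys. \<phi> (euler y # ys)) = (\<lambda>ys. sv (of_int p) (\<phi> (y # ys)))"
      by (simp add: ey slot_homogeneous_first[OF d(3)])
    then show ?thesis
      by (simp add: \<open>lie (euler y) \<phi> zs = _\<close> V.scale_right_diff_distrib
        cartan_diff_hom[where f = "sv (of_int p)" and act = act, OF V.scale_right_distrib act_scale])
  qed
  finally show ?case unfolding 2 1 by (simp add: V.scale_right_diff_distrib algebra_simps)
qed (simp add: energy_def)

text \<open>A summand with q < N applies a mode of index -q to the values and lowers arguments by q;
  both bounds grow from N by at most about q, hence 2N + 1.\<close>

lemma mode_cochain_homotopy:
  assumes \<phi>: "mode_cochain N \<phi>"
  shows "mode_cochain (2 * N + 1) (homotopy N \<phi>)"
proof -
  have "mode_cochain (2 * N + 1) (homotopy_term (mode (dual a) (- q)) (mode_ad (dual a) (- q)) (pos_mono a q) \<phi>)"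
    if q: "q \<in> {1..<int N}" for a q
  proof -
    note i = mode_cochain_insert[OF \<phi>, of "pos_mono a q"]
    have m: "mode_cochain (2 * N + 1) (\<lambda>zs. mode (dual a) (- q) (\<phi> (pos_mono a q # zs)))"
      by (rule mode_cochain_mode[OF i]) (use q in auto)
    have "mode_cochain (2 * N + 1) (slot_der (mode_ad (dual a) (- q)) (\<lambda>zs. \<phi> (pos_mono a q # zs)))"
    proof (rule mode_cochain_slot_der[OF i])
      fix x :: "'g fps" assume x: "\<forall>i. 0 < i \<and> i < 2 * N + 1 \<longrightarrow> x $ i = 0"
      have "x $ nat (int i + q) = 0" if "0 < i" "i < N" for i
        using x that q by (intro x[rule_format]) auto
      then show "\<forall>i. 0 < i \<and> i < N \<longrightarrow> mode_ad (dual a) (- q) x $ i = 0"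
        by (simp add: mode_ad_nth)
    qed (simp_all add: mode_ad_add mode_ad_scale)
    from mode_cochain_combination[OF m m, of 1 1, THEN mode_cochain_combination, OF this, of 1 1]
    show ?thesis by (simp add: homotopy_term_def[abs_def])
  qed
  then show ?thesis
    unfolding homotopy_def[abs_def] by (intro mode_cochain_sum)
qed

text \<open>For each fixed q the Lie derivative along a constant acts on the dual tensor alone,
  which is invariant. A constant has degree 0, so its commutator with a mode has no central
  term.\<close>

lemma invariant_homotopy:
  assumes \<phi>: "mode_cochain N \<phi>" and inv: "invariant_cochain \<phi>"
  shows "invariant_cochain (homotopy N \<phi>)"
  unfolding invariant_cochain_def
proof (intro allI)
  fix c :: 'g and zs :: "'g fps list"
  note lin = mode_cochain_linear[OF \<phi>] V.scale_right_distrib V.scale_left_distrib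
  note d = mode_cochainD[OF \<phi>]
  let ?y = "fps_const c"
  let ?h = "\<lambda>a q. homotopy_term (mode (dual a) (- q)) (mode_ad (dual a) (- q)) (pos_mono a q)"
  have z: "lie ?y \<phi> = (\<lambda>ys. 0)" using inv by (auto simp: invariant_cochain_def)
  have lie_sum: "lie ?y (\<lambda>zs. \<Sum>i\<in>I. \<psi> i zs) xs = (\<Sum>i\<in>I. lie ?y (\<psi> i) xs)" for I :: "'i set" and \<psi> xs
    by (simp add: lie_der_def slot_der_sum sum.distrib additive_fun_sum[of "act _", OF act_add])
  have per_term: "lie ?y (?h a q \<phi>) zs
    = (mode (br c (dual a)) (- q) (\<phi> (pos_mono a q # zs)) + mode (dual a) (- q) (\<phi> (pos_mono (br c a) q # zs)))
      + (mode (br c (dual a)) (- q) (\<phi> (pos_mono a q # zs)) + mode (dual a) (- q) (\<phi> (pos_mono (br c a) q # zs)))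
      + (slot_der (mode_ad (br c (dual a)) (- q)) (\<lambda>ys. \<phi> (pos_mono a q # ys)) zs
         + slot_der (mode_ad (dual a) (- q)) (\<lambda>ys. \<phi> (pos_mono (br c a) q # ys)) zs)"
    if q: "q \<in> {1..<int N}" for a q
  proof -
    have m: "act ?y (mode (dual a) (- q) w) - mode (dual a) (- q) (act ?y w) = mode (br c (dual a)) (- q) w"
      if "w \<in> Vc" for w
      using mode_commutator[OF that, of c 0 "dual a" "- q"] q by (simp add: act_const)
    have b: "fps_bracket br ?y (pos_mono a q) = pos_mono (br c a) q"
      by (rule fps_ext) (simp add: fps_bracket_const pos_mono_nth)
    have t: "(\<lambda>x. fps_bracket br ?y (mode_ad (dual a) (- q) x) - mode_ad (dual a) (- q) (fps_bracket br ?y x))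
       = mode_ad (br c (dual a)) (- q)"
      by (intro ext fps_ext) (simp add: fps_bracket_const mode_ad_nth br_leibniz[of c])
    have h0: "?h a q (\<lambda>ys. 0) zs = 0" by (simp add: homotopy_term_def slot_der_zero)
    show ?thesis
      using lie_der_homotopy_term[where R = "mode (dual a) (- q)" and act = act and ad = "fps_bracket br"
          and y = ?y and T = "mode_ad (dual a) (- q)" and u = "pos_mono a q" and zs = zs, OF act_add mode_add d(2)]
      unfolding z h0 b t m[OF d(1)] by (simp add: algebra_simps)
  qed
  have \<psi>: "(\<lambda>ys. \<phi> (pos_mono (u + v) q # ys)) = (\<lambda>ys. \<phi> (pos_mono u q # ys) + \<phi> (pos_mono v q # ys))"
    "(\<lambda>ys. \<phi> (pos_mono (s k u) q # ys)) = (\<lambda>ys. sv k (\<phi> (pos_mono u q # ys)))" for u v k q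
    by (simp_all add: lin)
  have bil1: "bilinear_map sv (\<lambda>u v. mode v (- q) (\<phi> (pos_mono u q # zs)))" for q
    unfolding bilinear_map_def by (simp add: lin)
  have bil2: "bilinear_map sv (\<lambda>u v. slot_der (mode_ad v (- q)) (\<lambda>ys. \<phi> (pos_mono u q # ys)) zs)" for q
    unfolding bilinear_map_def \<psi> mode_ad_add_left[abs_def] mode_ad_scale_left[abs_def]
      slot_der_add_map[OF mode_cochainD(2)[OF mode_cochain_insert[OF \<phi>]]]
      slot_der_scale_map[OF mode_cochainD(3)[OF mode_cochain_insert[OF \<phi>]] V.scale_right_distrib]
    by (simp add: slot_der_add slot_der_hom[of "sv _", OF V.scale_right_distrib])
  have "lie ?y (homotopy N \<phi>) zs = (\<Sum>a\<in>B. \<Sum>q\<in>{1..<int N}. lie ?y (?h a q \<phi>) zs)"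
    unfolding homotopy_def[abs_def] by (simp add: lie_sum)
  also have "\<dots> = (\<Sum>q\<in>{1..<int N}. \<Sum>a\<in>B. lie ?y (?h a q \<phi>) zs)" by (rule sum.swap)
  also have "\<dots> = 0"
  proof (rule sum.neutral, rule ballI)
    fix q assume q: "q \<in> {1..<int N}"
    show "(\<Sum>a\<in>B. lie ?y (?h a q \<phi>) zs) = 0"
      unfolding per_term[OF q] sum.distrib using dual_invariance[OF bil1[of q], of c] dual_invariance[OF bil2[of q], of c]
      by simp
  qed
  finally show "lie ?y (homotopy N \<phi>) zs = 0" .
qed

lemma slot_der_euler_degree:
  assumes \<phi>: "mode_cochain N \<phi>"
  shows "slot_der euler \<phi> (map (\<lambda>(b, p). pos_mono b p) bps)
    = - sv (of_int (sum_list (map snd bps))) (\<phi> (map (\<lambda>(b, p). pos_mono b p) bps))"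
  using \<phi>
proof (induction bps arbitrary: \<phi>)
  case (Cons bp bps)
  obtain b p where bp: "bp = (b, p)" by force
  show ?case
    using Cons.IH[OF mode_cochain_insert[OF Cons.prems], of "pos_mono b p"]
    by (simp add: bp euler_pos_mono slot_homogeneous_first[OF mode_cochainD(3)[OF Cons.prems]]
        V.scale_left_distrib)
qed simp

lemma pos_monosI: "pos_mono b p \<in> pos_monos"
proof (cases "p > 0")
  case False
  then have "pos_mono b p = pos_mono 0 1" by (simp add: pos_mono_nonpos)
  then show ?thesis unfolding pos_monos_def by (metis (mono_tags, lifting) CollectI zero_less_one)
qed (auto simp: pos_monos_def)

lemma mode_ad_pos_monos: "x \<in> pos_monos \<Longrightarrow> mode_ad c q x \<in> pos_monos"
proof -
  assume "x \<in> pos_monos"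
  then obtain b p where "x = pos_mono b p" "0 < p" by (auto simp: pos_monos_def)
  then show ?thesis by (simp add: mode_ad_pos_mono pos_monosI)
qed

lemma euler_pos_monos: "x \<in> pos_monos \<Longrightarrow> euler x \<in> pos_monos"
proof -
  assume "x \<in> pos_monos"
  then obtain b p where "x = pos_mono b p" by (auto simp: pos_monos_def)
  then show ?thesis by (simp add: euler_pos_mono pos_mono_scale[symmetric] pos_monosI)
qed

text \<open>The homotopy inserts and produces only positive monomials, so it suffices to know a
  cocycle equation on such lists.\<close>

lemma homotopy_zero_on_positive:
  assumes "\<And>ys. set ys \<subseteq> pos_monos \<Longrightarrow> \<theta> ys = 0" "set xs \<subseteq> pos_monos"
  shows "homotopy N \<theta> xs = 0"
proof -
  have "slot_der T (\<lambda>ys. \<theta> (pos_mono a q # ys)) xs = 0" if "\<And>x. x \<in> pos_monos \<Longrightarrow> T x \<in> pos_monos" for T a q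
    by (rule slot_der_zero_on[of _ pos_monos]) (use assms that pos_monosI in auto)
  then show ?thesis
    unfolding homotopy_def homotopy_term_def
    using assms pos_monosI by (auto intro!: sum.neutral mode_ad_pos_monos)
qed

lemma rot_invariant:
  assumes inv: "invariant_cochain \<phi>" and xs: "set xs \<subseteq> pos_monos"
  shows "rot a \<phi> xs = 0"
proof -
  have "slot_der (mode_ad a 0) \<phi> xs = slot_der (fps_bracket br (fps_const a)) \<phi> xs"
  proof (rule slot_der_cong)
    fix x assume "x \<in> set xs"
    then obtain b p where "x = pos_mono b p" "0 < p" using xs by (auto simp: pos_monos_def)
    then show "mode_ad a 0 x = fps_bracket br (fps_const a) x"
      by (auto simp: mode_ad_pos_mono fps_bracket_const pos_mono_nth intro!: fps_ext)
  qed
  then show ?thesis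
    using inv by (simp add: rot_def invariant_cochain_def lie_der_def act_const)
qed

text \<open>At a fixed list of monomials the energy is the Sugawara operator shifted by the total
  degree, so iterated factors on functions become iterated factors on one value. The closure
  statement is carried along because each step needs it.\<close>

lemma fold_energy:
  assumes "mode_cochain N \<phi>"
  shows "fold (\<lambda>w \<phi> x. energy \<phi> x - sv w (\<phi> x)) ws \<phi> (map (\<lambda>(b, p). pos_mono b p) bps)
    = fold (\<lambda>w v. sugawara v + sv (of_int (sum_list (map snd bps))) v - sv w v) ws (\<phi> (map (\<lambda>(b, p). pos_mono b p) bps))
    \<and> mode_cochain N (fold (\<lambda>w \<phi> x. energy \<phi> x - sv w (\<phi> x)) ws \<phi>)"
  using assms
proof (induction ws arbitrary: \<phi>)
  case (Cons w ws)
  have "mode_cochain N (\<lambda>x. energy \<phi> x - sv w (\<phi> x))"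
    using mode_cochain_combination[OF mode_cochain_energy[OF Cons.prems] Cons.prems, of 1 "- w"] by simp
  from Cons.IH[OF this] show ?case
    by (simp add: energy_def slot_der_euler_degree[OF Cons.prems])
qed simp

section \<open>Exactness of invariant cocycles in positive degree\<close>

definition cochain :: "nat \<Rightarrow> ('g fps list \<Rightarrow> 'v) \<Rightarrow> bool" where
  "cochain n \<phi> \<longleftrightarrow> (\<forall>xs. length xs \<noteq> n \<longrightarrow> \<phi> xs = 0) \<and> (\<exists>N. mode_cochain N \<phi>)"

lemma cochain_combination:
  assumes "cochain n \<phi>" "cochain n \<psi>"
  shows "cochain n (\<lambda>xs. sv a (\<phi> xs) + sv b (\<psi> xs))"
proof -
  obtain N M where "mode_cochain N \<phi>" "mode_cochain M \<psi>" using assms by (auto simp: cochain_def)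
  then have "mode_cochain (max N M) \<phi>" "mode_cochain (max N M) \<psi>" by (auto intro: mode_cochain_mono)
  from mode_cochain_combination[OF this] show ?thesis
    using assms by (auto simp: cochain_def)
qed

lemma lie_combination:
  "lie y (\<lambda>xs. sv a (\<phi> xs) + sv b (\<psi> xs)) xs = sv a (lie y \<phi> xs) + sv b (lie y \<psi> xs)"
  by (simp add: lie_der_def act_add act_scale slot_der_add slot_der_hom[of "sv _", OF V.scale_right_distrib]
      V.scale_right_distrib algebra_simps)

lemma diff_combination:
  "diff (\<lambda>xs. sv a (\<phi> xs) + sv b (\<psi> xs)) xs = sv a (diff \<phi> xs) + sv b (diff \<psi> xs)"
proof -
  have "diff (\<lambda>xs. sv c (\<phi> xs)) xs = sv c (diff \<phi> xs)" for c \<phi>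
    by (rule cartan_diff_hom[where f = "sv c"]) (simp_all add: V.scale_right_distrib act_scale)
  then show ?thesis by (simp add: cartan_diff_add[OF act_add])
qed

text \<open>Weights of the values lie between 0 and M. The n + 1 arguments that \<phi> sees have
  degrees from 1 to N - 1, so their total degree lies between 1 and (n + 1) N. All eigenvalues are
  thus among 1, ..., K; that 0 is excluded uses that there is at least one argument.\<close>

lemma energy_kills_weights:
  assumes \<phi>: "cochain (Suc n) \<phi>" and M: "\<And>xs. \<phi> xs \<in> weights_below M"
  shows "\<exists>ws. 0 \<notin> set ws \<and> fold (\<lambda>w \<phi> x. energy \<phi> x - sv w (\<phi> x)) ws \<phi> = (\<lambda>_. 0)"
proof -
  obtain N where N: "mode_cochain N \<phi>" using \<phi> by (auto simp: cochain_def)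
  define K where "K = M + Suc n * N"
  define ws where "ws = map (of_nat :: nat \<Rightarrow> complex) [1..<Suc K]"
  let ?G = "fold (\<lambda>w \<phi> x. energy \<phi> x - sv w (\<phi> x)) ws \<phi>"
  have G: "mode_cochain N ?G" using fold_energy[OF N] by blast
  have pos: "?G xs = 0" if xs: "set xs \<subseteq> pos_monos" for xs
  proof -
    have "\<exists>bps. xs = map (\<lambda>(b, p). pos_mono b p) bps \<and> (\<forall>(b, p)\<in>set bps. 0 < p)"
      using xs
    proof (induction xs)
      case (Cons x xs)
      then obtain b p bps where "x = pos_mono b p" "0 < p" "xs = map (\<lambda>(b, p). pos_mono b p) bps"
        "\<forall>(b, p)\<in>set bps. 0 < p" by (auto simp: pos_monos_def)
      then show ?case by (intro exI[of _ "(b, p) # bps"]) auto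
    qed simp
    then obtain bps where bps: "xs = map (\<lambda>(b, p). pos_mono b p) bps" "\<forall>(b, p)\<in>set bps. 0 < p" by blast
    define t where "t = sum_list (map snd bps)"
    have eq: "?G xs = fold (\<lambda>w v. sugawara v + sv (of_int t) v - sv w v) ws (\<phi> xs)"
      using fold_energy[OF N] by (simp add: bps(1) t_def)
    show ?thesis
    \<comment> \<open>In the first case some argument is too deep or the length is wrong, and \<phi>
      itself is 0 on the list; the second is the genuine eigenvalue estimate.\<close>
    proof (cases "length bps = Suc n \<and> (\<forall>(b, p)\<in>set bps. p < int N)")
      case False
      have "\<phi> xs = 0"
      proof (cases "length bps = Suc n")
        case True
        then obtain b p where bp: "(b, p) \<in> set bps" "int N \<le> p" using False by force
        then obtain us vs where "bps = us @ (b, p) # vs" by (meson split_list)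
        then have "xs = map (\<lambda>(b, p). pos_mono b p) us @ pos_mono b p # map (\<lambda>(b, p). pos_mono b p) vs"
          by (simp add: bps(1))
        moreover have "\<forall>i. 0 < i \<and> i < N \<longrightarrow> pos_mono b p $ i = 0" using bp(2) by (auto simp: pos_mono_nth)
        ultimately show ?thesis using N by (auto simp: mode_cochain_def slot_vanishing_def)
      next
        case False
        then show ?thesis using \<phi> bps(1) by (simp add: cochain_def)
      qed
      then show ?thesis unfolding eq by (simp add: sugawara_fold_zero)
    next
      case True
      have bound: "sum_list (map snd qs) \<le> int (length qs) * int N \<and> int (length qs) \<le> sum_list (map snd qs)"
        if "\<forall>(b, p)\<in>set qs. 0 < p \<and> p < int N" for qs :: "('g \<times> int) list"
        using that by (induction qs) (auto simp: algebra_simps)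
      have "\<forall>(b, p)\<in>set bps. 0 < p \<and> p < int N" using True bps(2) by auto
      from bound[OF this] True have t: "t \<le> int (Suc n * N)" "1 \<le> t"
        by (auto simp: t_def distrib_right)
      have "\<phi> xs \<in> V.span {v. \<exists>m\<in>{0..int M}. (m, v) \<in> neg_words}"
      proof -
        have "{v. \<exists>w\<le>int M. (w, v) \<in> neg_words} \<subseteq> {v. \<exists>m\<in>{0..int M}. (m, v) \<in> neg_words}"
          using neg_words_weight by fastforce
        then show ?thesis using M[of xs] V.span_mono unfolding weights_below_def by blast
      qed
      moreover have "of_int (m + t) \<in> set ws" if m: "m \<in> {0..int M}" for m
      proof -
        have b: "1 \<le> m + t" "m + t \<le> int K" using m t by (auto simp: K_def)
        then have "nat (m + t) \<in> set [1..<Suc K]" "of_int (m + t) = (of_nat (nat (m + t)) :: complex)"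
          by (auto simp: nat_le_iff le_nat_iff simp del: upt_Suc)
        then show ?thesis unfolding ws_def set_map by (metis imageI)
      qed
      ultimately show ?thesis unfolding eq by (rule sugawara_annihilated)
    qed
  qed
  have "?G = (\<lambda>_. 0)"
  proof
    show "?G xs = 0" for xs
      by (rule positive_lists_determine[OF mode_cochainD(2)[OF G] _ pos]) (use G in \<open>auto simp: mode_cochain_def\<close>)
  qed
  moreover have "0 \<notin> set ws" by (auto simp: ws_def)
  ultimately show ?thesis by blast
qed

text \<open>The cocycle is first written as the energy of another invariant cocycle \<theta>. For
  \<theta> the homotopy formula loses its h d and rotation terms and says that d of half the
  homotopy of \<theta> is the energy of \<theta>, that is \<phi>. Inverting before applying h avoids
  commuting h with the energy.\<close>

lemma invariant_cocycle_exact: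
  assumes \<phi>: "cochain (Suc n) \<phi>" "invariant_cochain \<phi>" and M: "\<And>xs. \<phi> xs \<in> weights_below M"
    and cyc: "\<And>xs. set xs \<subseteq> pos_monos \<Longrightarrow> diff \<phi> xs = 0"
  shows "\<exists>\<psi>. cochain n \<psi> \<and> invariant_cochain \<psi> \<and> diff \<psi> = \<phi>"
proof -
  \<comment> \<open>Closedness is required only on positive monomials because the energy commutes
    with d there; this keeps \<open>C\<close> stable under the energy.\<close>
  define C where "C = {\<phi>. cochain (Suc n) \<phi> \<and> invariant_cochain \<phi> \<and> (\<forall>xs. set xs \<subseteq> pos_monos \<longrightarrow> diff \<phi> xs = 0)}"
  have Vc: "\<theta> xs \<in> Vc" if "\<theta> \<in> C" for \<theta> xs using that mode_cochainD(1) by (auto simp: C_def cochain_def)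
  obtain ws where ws: "0 \<notin> set ws" "fold (\<lambda>w \<phi> x. energy \<phi> x - sv w (\<phi> x)) ws \<phi> = (\<lambda>_. 0)"
    using energy_kills_weights[OF \<phi>(1) M] by blast
  have "\<exists>\<theta>\<in>C. \<phi> = energy \<theta>"
  proof (rule preimage_of_annihilated[OF V.vector_space_axioms _ _ _ ws])
    fix \<theta> \<psi> a b assume "\<theta> \<in> C" "\<psi> \<in> C"
    then show "(\<lambda>x. sv a (\<theta> x) + sv b (\<psi> x)) \<in> C"
      by (simp add: C_def cochain_combination invariant_cochain_def lie_combination diff_combination)
    show "energy (\<lambda>x. sv a (\<theta> x) + sv b (\<psi> x)) = (\<lambda>x. sv a (energy \<theta> x) + sv b (energy \<psi> x))"
      using Vc \<open>\<theta> \<in> C\<close> \<open>\<psi> \<in> C\<close> by (intro ext energy_combination) auto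
  next
    fix \<theta> assume \<theta>: "\<theta> \<in> C"
    then obtain N where N: "mode_cochain N \<theta>" by (auto simp: C_def cochain_def)
    have "energy \<theta> xs = 0" if "length xs \<noteq> Suc n" for xs
    proof -
      have "slot_der euler \<theta> xs = 0" using \<theta> that by (intro slot_der_length) (auto simp: C_def cochain_def)
      then show ?thesis using \<theta> that by (simp add: energy_def C_def cochain_def)
    qed
    moreover have "diff (energy \<theta>) xs = 0" if "set xs \<subseteq> pos_monos" for xs
    proof -
      have "slot_der euler (diff \<theta>) xs = 0"
        by (rule slot_der_zero_on[of _ pos_monos]) (use \<theta> that euler_pos_monos in \<open>auto simp: C_def\<close>)
      then show ?thesis using diff_energy[OF N that] \<theta> that by (simp add: energy_def C_def)
    qed
    ultimately show "energy \<theta> \<in> C"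
      using mode_cochain_energy[OF N] invariant_energy[OF N] \<theta> by (auto simp: C_def cochain_def)
  next
    show "\<phi> \<in> C" using \<phi> cyc by (simp add: C_def)
  qed
  then obtain \<theta> where \<theta>: "\<theta> \<in> C" "\<phi> = energy \<theta>" by blast
  obtain N where N: "mode_cochain N \<theta>" using \<theta>(1) by (auto simp: C_def cochain_def)
  have inv: "invariant_cochain \<theta>" using \<theta>(1) by (simp add: C_def)
  \<comment> \<open>The factor 1/2 undoes the doubling in \<open>homotopy\<close>. The summand with
    coefficient 0 gives \<psi> the shape covered by the lemmas on linear combinations.\<close>
  define \<psi> where "\<psi> = (\<lambda>xs. sv (1 / 2) (homotopy N \<theta> xs) + sv 0 (homotopy N \<theta> xs))"
  have m\<psi>: "mode_cochain (2 * N + 1) \<psi>"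
    unfolding \<psi>_def by (rule mode_cochain_combination[OF mode_cochain_homotopy[OF N] mode_cochain_homotopy[OF N]])
  have i\<psi>: "invariant_cochain \<psi>"
    using invariant_homotopy[OF N inv] by (simp only: invariant_cochain_def \<psi>_def lie_combination) simp
  have "homotopy N \<theta> xs = 0" if "length xs \<noteq> n" for xs
  proof -
    have "slot_der T (\<lambda>ys. \<theta> (u # ys)) xs = 0" for T u
      by (rule slot_der_length) (use \<theta>(1) that in \<open>auto simp: C_def cochain_def\<close>)
    then show ?thesis
      using \<theta>(1) that by (simp add: homotopy_def homotopy_term_def C_def cochain_def)
  qed
  then have c\<psi>: "cochain n \<psi>" using m\<psi> by (auto simp: cochain_def \<psi>_def)
  have pos: "diff \<psi> xs = \<phi> xs" if xs: "set xs \<subseteq> pos_monos" for xs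
  proof -
    have "homotopy N (diff \<theta>) xs = 0"
      by (rule homotopy_zero_on_positive[OF _ xs]) (use \<theta>(1) in \<open>auto simp: C_def\<close>)
    moreover have "rot (dual a) (rot a \<theta>) xs = 0" for a
    proof -
      have "slot_der (mode_ad (dual a) 0) (rot a \<theta>) xs = 0"
        by (rule slot_der_zero_on[of _ pos_monos]) (use xs rot_invariant[OF inv] mode_ad_pos_monos in auto)
      then show ?thesis using rot_invariant[OF inv xs] by (simp add: rot_def[of "dual a"])
    qed
    ultimately have "diff (homotopy N \<theta>) xs = sug N (\<theta> xs) - slot_der euler \<theta> xs - slot_der euler \<theta> xs"
      using homotopy_formula[OF N xs] by simp
    also have "\<dots> = \<phi> xs + \<phi> xs"
      using sugawara_twice[of N "\<theta> xs"] mode_cochainD(5)[OF N]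
      by (simp add: \<theta>(2) energy_def killed_from_def)
    finally show ?thesis
      unfolding \<psi>_def diff_combination by (simp add: V.scale_right_distrib V.scale_left_distrib[symmetric])
  qed
  \<comment> \<open>The equation extends to all arguments: both sides ignore constants and high
    degrees, the left one because \<psi> is invariant.\<close>
  have "diff \<psi> xs = \<phi> xs" for xs
  proof -
    let ?F = "\<lambda>xs. diff \<psi> xs - \<phi> xs"
    obtain N' where N': "mode_cochain N' \<phi>" using \<phi>(1) by (auto simp: cochain_def)
    let ?M = "max N' (2 * N + 1)"
    have "slot_vanishing (\<lambda>x. \<forall>i. 0 < i \<and> i < ?M \<longrightarrow> x $ i = 0) (diff \<psi>)"
      "slot_vanishing (\<lambda>x. \<forall>i. 0 < i \<and> i < ?M \<longrightarrow> x $ i = 0) \<phi>"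
      using slot_vanishing_diff[OF mode_cochain_mono[OF m\<psi>] i\<psi>, of ?M] mode_cochain_mono[OF N', of ?M]
      by (simp_all add: mode_cochain_def)
    then have v: "slot_vanishing (\<lambda>x. \<forall>i. 0 < i \<and> i < ?M \<longrightarrow> x $ i = 0) ?F"
      unfolding slot_vanishing_def by auto
    have a: "slot_additive ?F"
      using slot_additive_diff[OF mode_cochainD(2)[OF m\<psi>]] mode_cochainD(2)[OF N'] by (simp add: slot_additive_def)
    have "?F xs = 0" by (rule positive_lists_determine[OF a v]) (simp add: pos)
    then show ?thesis by simp
  qed
  then show ?thesis using c\<psi> i\<psi> by blast
qed

end

section \<open>The Chevalley differential and alternating functions\<close>

lemma slot_der_eq_sum:
  "slot_der T \<phi> xs = - (\<Sum>i<length xs. \<phi> (xs[i := T (xs ! i)]))"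
proof (induction xs arbitrary: \<phi>)
  case (Cons x xs)
  show ?case by (simp add: Cons.IH sum.lessThan_Suc_shift del: sum.lessThan_Suc)
qed simp

lemma nths_compl_Suc: "nths (x # xs) (- {Suc i}) = x # nths xs (- {i})"
  and nths_compl_zero: "nths (x # xs) (- {0}) = xs"
  and nths_compl_Suc_Suc: "nths (x # xs) (- {Suc i, Suc j}) = x # nths xs (- {i, j})"
  and nths_compl_zero_Suc: "nths (x # xs) (- {0, Suc j}) = nths xs (- {j})"
proof -
  have "{k. Suc k \<in> - {Suc i}} = - {i}" "{k. Suc k \<in> - {0}} = UNIV"
    "{k. Suc k \<in> - {Suc i, Suc j}} = - {i, j}" "{k. Suc k \<in> - {0, Suc j}} = - {j}" by auto
  then show "nths (x # xs) (- {Suc i}) = x # nths xs (- {i})" "nths (x # xs) (- {0}) = xs"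
    "nths (x # xs) (- {Suc i, Suc j}) = x # nths xs (- {i, j})"
    "nths (x # xs) (- {0, Suc j}) = nths xs (- {j})" by (simp_all add: nths_Cons nths_all)
qed

context
  fixes sv :: "complex \<Rightarrow> 'v::ab_group_add \<Rightarrow> 'v"
  assumes sv: "vector_space sv"
begin

interpretation V: vector_space sv by (rule sv)

lemma slot_der_front:
  assumes "slot_alternating \<phi>"
  shows "slot_der T \<phi> xs = - (\<Sum>i<length xs. sv ((-1) ^ i) (\<phi> (T (xs ! i) # nths xs (- {i}))))"
  using assms
proof (induction xs arbitrary: \<phi>)
  case (Cons x xs)
  have "sv ((-1) ^ i) (\<phi> (x # T (xs ! i) # nths xs (- {i}))) = sv ((-1) ^ Suc i) (\<phi> (T (xs ! i) # x # nths xs (- {i})))" for i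
    using slot_alternating_first[OF Cons.prems, of x "T (xs ! i)"] by simp
  then show ?case
    using Cons.IH[OF slot_alternating_insert[OF Cons.prems], of x]
    by (simp add: sum.lessThan_Suc_shift nths_compl_Suc nths_compl_zero del: power_Suc sum.lessThan_Suc)
qed simp

text \<open>The Lie derivative along the first argument gives the terms with i = 0 in both sums,
  with brackets moved to the front by alternation. The contraction gives the others with shifted
  indices; its minus sign is the parity change of i in the first sum, and in the second it is
  absorbed in exchanging x with the bracket.\<close>

lemma cartan_diff_explicit:
  fixes act :: "'x::ab_group_add \<Rightarrow> 'v \<Rightarrow> 'v"
  assumes "slot_alternating \<phi>" "length xs = Suc n"
  shows "cartan_diff act ad \<phi> xs = (\<Sum>i\<le>n. sv ((-1) ^ i) (act (xs ! i) (\<phi> (nths xs (- {i})))))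
    + (\<Sum>j\<le>n. \<Sum>i<j. sv ((-1) ^ (i + j)) (\<phi> (ad (xs ! i) (xs ! j) # nths xs (- {i, j}))))"
  using assms
proof (induction xs arbitrary: \<phi> n)
  case (Cons x ys)
  show ?case
  proof (cases n)
    case 0
    then show ?thesis using Cons.prems(2) by (simp add: lie_der_def nths_compl_zero)
  next
    case (Suc m)
    have m: "length ys = Suc m" using Cons.prems(2) Suc by simp
    have sgn: "sv ((-1) ^ (i + j)) (\<phi> (ad (ys ! i) (ys ! j) # x # zs))
       = - sv ((-1) ^ (i + j)) (\<phi> (x # ad (ys ! i) (ys ! j) # zs))" for i j zs
      using slot_alternating_first[OF Cons.prems(1), of x "ad (ys ! i) (ys ! j)" zs] by simp
    have "cartan_diff act ad (\<lambda>zs. \<phi> (x # zs)) ys = (\<Sum>i\<le>m. sv ((-1) ^ i) (act (ys ! i) (\<phi> (x # nths ys (- {i})))))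
       + (\<Sum>j\<le>m. \<Sum>i<j. sv ((-1) ^ (i + j)) (\<phi> (x # ad (ys ! i) (ys ! j) # nths ys (- {i, j}))))"
      by (rule Cons.IH[OF slot_alternating_insert[OF Cons.prems(1)] m])
    moreover have "slot_der (ad x) \<phi> ys = - (\<Sum>j\<le>m. sv ((-1) ^ j) (\<phi> (ad x (ys ! j) # nths ys (- {j}))))"
      by (simp add: slot_der_front[OF Cons.prems(1)] m lessThan_Suc_atMost)
    ultimately show ?thesis
      unfolding Suc
      by (simp add: sum.atMost_Suc_shift sum.lessThan_Suc_shift nths_compl_Suc nths_compl_zero
          nths_compl_Suc_Suc nths_compl_zero_Suc lie_der_def sgn sum.distrib sum_negf sum_subtractf del: sum.atMost_Suc sum.lessThan_Suc)
  qed
qed simp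

lemma slot_alternating_transpose:
  assumes alt: "slot_alternating (\<phi> :: 'x list \<Rightarrow> 'v)"
  shows "\<phi> (us @ x # vs @ y # ws) = - \<phi> (us @ y # vs @ x # ws)"
proof (induction vs arbitrary: us)
  case Nil
  show ?case using slot_alternatingD[OF alt, of us x y ws] by simp
next
  case (Cons v vs)
  have "\<phi> (us @ x # (v # vs) @ y # ws) = - \<phi> ((us @ [v]) @ x # vs @ y # ws)"
    using slot_alternatingD[OF alt, of us x v "vs @ y # ws"] by simp
  also have "\<dots> = \<phi> (us @ v # y # vs @ x # ws)" by (subst Cons) simp
  also have "\<dots> = - \<phi> (us @ y # (v # vs) @ x # ws)"
    using slot_alternatingD[OF alt, of us v y "vs @ x # ws"] by simp
  finally show ?case .
qed

lemma slot_alternating_swap: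
  assumes alt: "slot_alternating (\<phi> :: 'x list \<Rightarrow> 'v)" and "a < length xs" "b < length xs" "a \<noteq> b"
  shows "\<phi> (xs[a := xs ! b, b := xs ! a]) = - \<phi> xs"
proof -
  have *: "\<phi> (xs[a := xs ! b, b := xs ! a]) = - \<phi> xs" if ab: "a < b" "b < length xs" for a b
  proof -
    define us where "us = take a xs"
    define vs where "vs = take (b - Suc a) (drop (Suc a) xs)"
    define ws where "ws = drop (Suc b) xs"
    obtain c d where cd: "c = xs ! a" "d = xs ! b" by blast
    have xs: "xs = us @ c # vs @ d # ws"
    proof -
      have "drop (Suc a) xs = vs @ drop (b - Suc a) (drop (Suc a) xs)" by (simp only: vs_def append_take_drop_id)
      also have "drop (b - Suc a) (drop (Suc a) xs) = drop b xs" using ab by simp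
      also have "\<dots> = d # ws" using ab by (simp add: ws_def cd Cons_nth_drop_Suc)
      finally show ?thesis using ab id_take_nth_drop[of a xs] by (simp add: us_def cd)
    qed
    have l: "length us = a" "length vs = b - Suc a" using ab by (auto simp: us_def vs_def)
    have "(us @ c # vs @ d # ws)[a := d, b := c] = us @ d # vs @ c # ws"
    proof -
      have "b = length us + Suc (length vs)" using l ab by simp
      then show ?thesis using l(1) by (simp add: list_update_append)
    qed
    then have "\<phi> (xs[a := d, b := c]) = \<phi> (us @ d # vs @ c # ws)" by (subst xs) simp
    also have "\<dots> = - \<phi> xs" by (subst xs) (rule slot_alternating_transpose[OF alt])
    finally show ?thesis unfolding cd .
  qed
  show ?thesis
  proof (cases "a < b")
    case False
    then have "xs[a := xs ! b, b := xs ! a] = xs[b := xs ! a, a := xs ! b]"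
      using assms by (simp add: list_update_swap)
    then show ?thesis using *[of b a] False assms by simp
  qed (use * assms in auto)
qed

lemma slot_alternating_permute:
  assumes alt: "slot_alternating (\<phi> :: 'x list \<Rightarrow> 'v)" and p: "p permutes {..<n}" and xs: "length xs = n"
  shows "\<phi> (map (\<lambda>i. xs ! p i) [0..<n]) = sv (of_int (sign p)) (\<phi> xs)"
proof -
  have "\<forall>xs. length xs = n \<longrightarrow> \<phi> (map (\<lambda>i. xs ! p i) [0..<n]) = sv (of_int (sign p)) (\<phi> xs)"
    using p finite_lessThan
  proof (induction p rule: permutes_induct)
    case id
    have "map (\<lambda>i. xs ! id i) [0..<n] = xs" if "length xs = n" for xs :: "'x list"
      using that by (auto intro: nth_equalityI)
    then show ?case by (simp add: sign_id del: id_apply)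
  next
    case (swap a b p)
    show ?case
    proof (intro allI impI)
      fix xs :: "'x list" assume l: "length xs = n"
      have e1: "map (\<lambda>i. xs ! (transpose a b \<circ> p) i) [0..<n] = map (\<lambda>i. xs[a := xs ! b, b := xs ! a] ! p i) [0..<n]"
      proof (rule map_cong[OF refl])
        fix i assume "i \<in> set [0..<n]"
        then have "p i < n" using permutes_in_image[OF swap(4), of i] by auto
        then show "xs ! (transpose a b \<circ> p) i = xs[a := xs ! b, b := xs ! a] ! p i"
          using l swap(1,2) by (auto simp: transpose_def nth_list_update)
      qed
      have e2: "sign (transpose a b \<circ> p) = - sign p"
        using sign_compose[of "transpose a b" p] swap(3) permutes_imp_permutation[OF _ swap(4)]
        by (simp add: sign_swap_id permutation_swap_id)
      show "\<phi> (map (\<lambda>i. xs ! (transpose a b \<circ> p) i) [0..<n]) = sv (of_int (sign (transpose a b \<circ> p))) (\<phi> xs)"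
        unfolding e1 e2 using swap slot_alternating_swap[OF alt, of a xs b] l by simp
    qed
  qed
  then show ?thesis using xs by blast
qed

end

section \<open>Wedge products\<close>

text \<open>The determinant equals that of the transposed matrix. In this form the arguments stay in
  place and the functionals are permuted, so a single argument can be varied.\<close>

lemma wedge_transposed:
  assumes "length xs = length \<xi>s"
  shows "wedge \<xi>s xs = (\<Sum>p | p permutes {..<length \<xi>s}. of_int (sign p) * (\<Prod>j<length \<xi>s. (\<xi>s ! p j) (xs ! j)))"
proof -
  let ?S = "{..<length \<xi>s}"
  have "wedge \<xi>s xs = (\<Sum>p | p permutes ?S. of_int (sign (inv_into UNIV p)) * (\<Prod>i\<in>?S. (\<xi>s ! i) (xs ! inv_into UNIV p i)))"
    unfolding wedge_def by (rule sum_permutations_inverse)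
  also have "\<dots> = (\<Sum>p | p permutes ?S. of_int (sign p) * (\<Prod>j\<in>?S. (\<xi>s ! p j) (xs ! j)))"
  proof (rule sum.cong[OF refl])
    fix p assume "p \<in> {p. p permutes ?S}"
    then have p: "p permutes ?S" by simp
    have "(\<Prod>i\<in>?S. (\<xi>s ! i) (xs ! inv_into UNIV p i)) = (\<Prod>j\<in>?S. (\<xi>s ! p j) (xs ! inv_into UNIV p (p j)))"
      using prod.permute[OF p, of "\<lambda>i. (\<xi>s ! i) (xs ! inv_into UNIV p i)"] by (simp add: comp_def)
    then show "of_int (sign (inv_into UNIV p)) * (\<Prod>i\<in>?S. (\<xi>s ! i) (xs ! inv_into UNIV p i)) = of_int (sign p) * (\<Prod>j\<in>?S. (\<xi>s ! p j) (xs ! j))"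
      by (simp add: sign_inverse[OF permutes_imp_permutation[OF _ p]] permutes_inverses(2)[OF p])
  qed
  finally show ?thesis .
qed

lemma wedge_alternating:
  assumes "length (us @ x # y # vs) = length \<xi>s"
  shows "wedge \<xi>s (us @ x # y # vs) = - wedge \<xi>s (us @ y # x # vs)"
proof -
  let ?S = "{..<length \<xi>s}" and ?k = "length us"
  let ?t = "transpose ?k (Suc ?k)"
  have t: "?t permutes ?S" using assms by (intro permutes_swap_id) auto
  have nth: "(us @ x # y # vs) ! ?t j = (us @ y # x # vs) ! j" for j
    by (auto simp: transpose_def nth_append nth_Cons split: nat.splits)
  have "wedge \<xi>s (us @ x # y # vs) = (\<Sum>p | p permutes ?S. of_int (sign p) * (\<Prod>j\<in>?S. (\<xi>s ! p j) ((us @ x # y # vs) ! j)))"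
    by (rule wedge_transposed[OF assms])
  also have "\<dots> = (\<Sum>p | p permutes ?S. of_int (sign (p \<circ> ?t)) * (\<Prod>j\<in>?S. (\<xi>s ! (p \<circ> ?t) j) ((us @ x # y # vs) ! j)))"
    by (rule sum_permutations_compose_right[OF t])
  also have "\<dots> = (\<Sum>p | p permutes ?S. - (of_int (sign p) * (\<Prod>j\<in>?S. (\<xi>s ! p j) ((us @ y # x # vs) ! j))))"
  proof (rule sum.cong[OF refl])
    fix p assume "p \<in> {p. p permutes ?S}"
    then have p: "p permutes ?S" by simp
    have "sign (p \<circ> ?t) = - sign p"
      using sign_compose[of p ?t] permutes_imp_permutation[OF _ p] by (simp add: sign_swap_id permutation_swap_id)
    moreover have "(\<Prod>j\<in>?S. (\<xi>s ! (p \<circ> ?t) j) ((us @ x # y # vs) ! j)) = (\<Prod>j\<in>?S. (\<xi>s ! p j) ((us @ y # x # vs) ! j))"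
      using prod.permute[OF t, of "\<lambda>j. (\<xi>s ! (p \<circ> ?t) j) ((us @ x # y # vs) ! j)"] by (simp add: comp_def nth)
    ultimately show "of_int (sign (p \<circ> ?t)) * (\<Prod>j\<in>?S. (\<xi>s ! (p \<circ> ?t) j) ((us @ x # y # vs) ! j))
      = - (of_int (sign p) * (\<Prod>j\<in>?S. (\<xi>s ! p j) ((us @ y # x # vs) ! j)))" by simp
  qed
  also have "\<dots> = - wedge \<xi>s (us @ y # x # vs)"
    using assms by (simp add: wedge_transposed sum_negf)
  finally show ?thesis .
qed

text \<open>As a function of one argument the wedge is a fixed linear combination of the
  functionals. Linearity and vanishing in a slot are therefore inherited from them.\<close>

lemma wedge_slot:
  assumes l: "length us + length vs + 1 = length \<xi>s"
  obtains c where "\<And>x. wedge \<xi>s (us @ x # vs) = (\<Sum>p | p permutes {..<length \<xi>s}. c p * (\<xi>s ! p (length us)) x)"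
proof
  fix x
  let ?S = "{..<length \<xi>s}" and ?k = "length us"
  \<comment> \<open>The entry \<open>undefined\<close> fills the slot of x so that the coefficient
    does not mention x; its index is removed from the product.\<close>
  let ?c = "\<lambda>p. of_int (sign p) * (\<Prod>j\<in>?S - {?k}. (\<xi>s ! p j) ((us @ undefined # vs) ! j))"
  have "wedge \<xi>s (us @ x # vs) = (\<Sum>p | p permutes ?S. of_int (sign p) * (\<Prod>j\<in>?S. (\<xi>s ! p j) ((us @ x # vs) ! j)))"
    by (rule wedge_transposed) (use l in simp)
  also have "\<dots> = (\<Sum>p | p permutes ?S. ?c p * (\<xi>s ! p ?k) x)"
  proof (rule sum.cong[OF refl])
    fix p
    have "(\<Prod>j\<in>?S. (\<xi>s ! p j) ((us @ x # vs) ! j)) = (\<xi>s ! p ?k) ((us @ x # vs) ! ?k) * (\<Prod>j\<in>?S - {?k}. (\<xi>s ! p j) ((us @ x # vs) ! j))"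
      by (rule prod.remove) (use l in auto)
    also have "(\<Prod>j\<in>?S - {?k}. (\<xi>s ! p j) ((us @ x # vs) ! j)) = (\<Prod>j\<in>?S - {?k}. (\<xi>s ! p j) ((us @ undefined # vs) ! j))"
      by (rule prod.cong) (auto simp: nth_append nth_Cons split: nat.splits)
    finally show "of_int (sign p) * (\<Prod>j\<in>?S. (\<xi>s ! p j) ((us @ x # vs) ! j)) = ?c p * (\<xi>s ! p ?k) x" by simp
  qed
  finally show "wedge \<xi>s (us @ x # vs) = (\<Sum>p | p permutes ?S. ?c p * (\<xi>s ! p ?k) x)" .
qed

section \<open>Continuous functionals\<close>

context complex_lie_algebra
begin

text \<open>Continuity at 0 gives N with |\<xi>| < 1 on t^N g[[t]]. This is a subspace, so an x in
  it with \<xi> x nonzero could be rescaled to have value 1. Constants are killed by assumption,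
  which frees the coefficient of index 0.\<close>

lemma continuous_dual_vanishes:
  assumes "\<xi> \<in> continuous_dual s"
  obtains N where "\<And>x. (\<forall>i. 0 < i \<and> i < N \<longrightarrow> x $ i = 0) \<Longrightarrow> \<xi> x = 0"
proof -
  have lin: "Vector_Spaces.linear (fps_scale s) (*) \<xi>" and cont: "continuous_on UNIV \<xi>"
    and const: "\<And>a. \<xi> (fps_const a) = 0" using assms by (auto simp: continuous_dual_def)
  note add = linear_map_add[OF lin] and scale = linear_map_scale[OF lin]
  have "\<xi> 0 = 0" by (rule additive_fun_zero) (rule add)
  obtain d where d: "d > 0" "\<And>x. dist x 0 < d \<Longrightarrow> norm (\<xi> x) < 1"
  proof -
    have "\<forall>\<^sub>F x in at 0. dist (\<xi> x) (\<xi> 0) < 1"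
      using cont by (auto simp: continuous_on_def tendsto_iff)
    then obtain d where "d > 0" "\<And>x. x \<noteq> 0 \<Longrightarrow> dist x 0 < d \<Longrightarrow> norm (\<xi> x) < 1"
      unfolding eventually_at using \<open>\<xi> 0 = 0\<close> by (auto simp: dist_norm)
    then show thesis using that[of d] \<open>\<xi> 0 = 0\<close> by (metis norm_zero zero_less_one)
  qed
  obtain N where N: "(1 / 2) ^ N < d" using real_arch_pow_inv[OF d(1), of "1 / 2"] by auto
  have low: "\<xi> x = 0" if x: "\<And>i. i < N \<Longrightarrow> x $ i = 0" for x
  proof (rule ccontr)
    assume nz: "\<xi> x \<noteq> 0"
    define y where "y = fps_scale s (1 / \<xi> x) x"
    have "\<xi> y = 1" using nz by (simp add: y_def scale)
    moreover have "dist y 0 < d"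
    proof (cases "y = 0")
      case False
      have "subdegree y \<ge> N" by (rule subdegree_geI[OF False]) (simp add: y_def fps_scale_def x)
      then have "inverse (2 ^ subdegree y) \<le> (inverse (2 ^ N) :: real)" by simp
      also have "\<dots> < d" using N by (simp add: power_one_over inverse_eq_divide)
      finally show ?thesis using False by (simp add: dist_fps_def)
    qed (use d in simp)
    ultimately show False using d(2)[of y] by simp
  qed
  show thesis
  proof (rule that)
    fix x :: "'g fps" assume x: "\<forall>i. 0 < i \<and> i < N \<longrightarrow> x $ i = 0"
    have "\<xi> (x - fps_const (x $ 0)) = 0"
    proof (rule low)
      fix i assume "i < N" then show "(x - fps_const (x $ 0)) $ i = 0" using x by (cases "i = 0") auto
    qed
    then show "\<xi> x = 0" using add[of "x - fps_const (x $ 0)" "fps_const (x $ 0)"] const by simp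
  qed
qed

lemma continuous_dual_common:
  assumes "set \<xi>s \<subseteq> continuous_dual s"
  obtains N where "\<And>x \<xi>. \<xi> \<in> set \<xi>s \<Longrightarrow> (\<forall>i. 0 < i \<and> i < N \<longrightarrow> x $ i = 0) \<Longrightarrow> \<xi> x = 0"
proof -
  have "\<exists>N. \<forall>x \<xi>. \<xi> \<in> set \<xi>s \<longrightarrow> (\<forall>i. 0 < i \<and> i < N \<longrightarrow> x $ i = 0) \<longrightarrow> \<xi> x = 0"
    using assms
  proof (induction \<xi>s)
    case (Cons \<xi> \<xi>s)
    then obtain N where N: "\<forall>x \<xi>. \<xi> \<in> set \<xi>s \<longrightarrow> (\<forall>i. 0 < i \<and> i < N \<longrightarrow> x $ i = 0) \<longrightarrow> \<xi> x = 0" by auto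
    obtain M where M: "\<And>x. (\<forall>i. 0 < i \<and> i < M \<longrightarrow> x $ i = 0) \<Longrightarrow> \<xi> x = 0"
      using continuous_dual_vanishes Cons.prems by (metis insert_subset list.simps(15))
    show ?case
    proof (intro exI[of _ "max N M"] allI impI)
      fix x :: "'g fps" and \<zeta> assume "\<zeta> \<in> set (\<xi> # \<xi>s)" "\<forall>i. 0 < i \<and> i < max N M \<longrightarrow> x $ i = 0"
      then show "\<zeta> x = 0" using N M by (cases "\<zeta> = \<xi>") (auto simp: less_max_iff_disj)
    qed
  qed simp
  then show thesis using that by blast
qed

lemma coefficient_functional_dual:
  assumes l: "Vector_Spaces.linear s (*) f" and p: "p > 0"
  shows "(\<lambda>x. f (x $ p)) \<in> continuous_dual s"
proof -
  note add = linear_map_add[OF l] and scale = linear_map_scale[OF l]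
  have "vector_space (fps_scale s :: complex \<Rightarrow> 'g fps \<Rightarrow> 'g fps)"
    by unfold_locales (auto simp: fps_scale_def fps_eq_iff scale_right_distrib scale_left_distrib)
  moreover have "vector_space ((*) :: complex \<Rightarrow> complex \<Rightarrow> complex)"
    by unfold_locales (auto simp: algebra_simps)
  ultimately have "Vector_Spaces.linear (fps_scale s) (*) (\<lambda>x. f (x $ p))"
    by (simp add: Vector_Spaces.linear_iff add scale fps_scale_def)
  moreover have "continuous_on UNIV (\<lambda>x. f (x $ p))"
    unfolding continuous_on_def tendsto_iff eventually_at
  proof (intro ballI allI impI)
    fix x :: "'g fps" and e :: real assume e: "e > 0"
    have "dist (f (y $ p)) (f (x $ p)) < e" if "dist y x < inverse (2 ^ p)" for y
    proof -
      have "y $ p = x $ p"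
      proof (cases "y = x")
        case False
        then have "inverse (2 ^ subdegree (y - x)) < (inverse (2 ^ p) :: real)" using that by (simp add: dist_fps_def)
        then have "p < subdegree (y - x)" by simp
        then show ?thesis using nth_less_subdegree_zero[of p "y - x"] by simp
      qed simp
      then show ?thesis using e by simp
    qed
    then show "\<exists>d>0. \<forall>y\<in>UNIV. y \<noteq> x \<and> dist y x < d \<longrightarrow> dist (f (y $ p)) (f (x $ p)) < e"
      by (intro exI[of _ "inverse (2 ^ p)"]) auto
  qed
  moreover have "f 0 = 0" by (rule additive_fun_zero) (rule add)
  ultimately show ?thesis using p by (simp add: continuous_dual_def)
qed

end

section \<open>Cochains as multilinear functions\<close>

context affine_module
begin

definition pure_function :: "'v \<Rightarrow> ('g fps \<Rightarrow> complex) list \<Rightarrow> 'g fps list \<Rightarrow> 'v" where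
  "pure_function v \<xi>s xs = (if length xs = length \<xi>s then sv (wedge \<xi>s xs) v else 0)"

text \<open>The counterpart of \<open>tensor_wedge\<close> with values in the ambient space of the
  module, so that ordinary sums can be used in place of operations on cosets.\<close>

inductive_set tensor_functions :: "nat \<Rightarrow> ('g fps list \<Rightarrow> 'v) set" for n where
  zero: "(\<lambda>_. 0) \<in> tensor_functions n"
| add_pure: "\<phi> \<in> tensor_functions n \<Longrightarrow> v \<in> Vc \<Longrightarrow> length \<xi>s = n \<Longrightarrow> set \<xi>s \<subseteq> continuous_dual s
    \<Longrightarrow> (\<lambda>xs. \<phi> xs + pure_function v \<xi>s xs) \<in> tensor_functions n"

lemma mode_cochain_pure_function:
  assumes v: "v \<in> Vc" and \<xi>s: "set \<xi>s \<subseteq> continuous_dual s"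
  shows "\<exists>N. mode_cochain N (pure_function v \<xi>s)"
proof -
  obtain N where N: "\<And>x \<xi>. \<xi> \<in> set \<xi>s \<Longrightarrow> (\<forall>i. 0 < i \<and> i < N \<longrightarrow> x $ i = 0) \<Longrightarrow> \<xi> x = 0"
    by (rule continuous_dual_common[OF \<xi>s]) blast
  obtain M where M: "killed_from M v" by (rule killed_fromE[OF v])
  have lin: "\<xi> (x + y) = \<xi> x + \<xi> y" "\<xi> (fps_scale s c x) = c * \<xi> x" if "\<xi> \<in> set \<xi>s" for \<xi> x y c
    using that \<xi>s linear_map_add[of "fps_scale s" "(*)" \<xi>] linear_map_scale[of "fps_scale s" "(*)" \<xi>]
    by (auto simp: continuous_dual_def)
  have mem: "\<xi>s ! p k \<in> set \<xi>s" if "p permutes {..<length \<xi>s}" "k < length \<xi>s" for p k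
    using permutes_in_image[OF that(1), of k] that(2) by auto
  have w: "wedge \<xi>s (us @ (x + y) # vs) = wedge \<xi>s (us @ x # vs) + wedge \<xi>s (us @ y # vs)"
      "wedge \<xi>s (us @ fps_scale s c x # vs) = c * wedge \<xi>s (us @ x # vs)"
      "(\<forall>i. 0 < i \<and> i < N \<longrightarrow> x $ i = 0) \<Longrightarrow> wedge \<xi>s (us @ x # vs) = 0"
    if len: "length us + length vs + 1 = length \<xi>s" for us x y vs c
  proof -
    obtain k where k: "\<And>x. wedge \<xi>s (us @ x # vs) = (\<Sum>p | p permutes {..<length \<xi>s}. k p * (\<xi>s ! p (length us)) x)"
      by (rule wedge_slot[OF len]) blast
    have m: "\<xi>s ! p (length us) \<in> set \<xi>s" if "p permutes {..<length \<xi>s}" for p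
      using mem[OF that] len by simp
    show "wedge \<xi>s (us @ (x + y) # vs) = wedge \<xi>s (us @ x # vs) + wedge \<xi>s (us @ y # vs)"
      unfolding k sum.distrib[symmetric] by (rule sum.cong) (auto simp: lin[OF m] algebra_simps)
    show "wedge \<xi>s (us @ fps_scale s c x # vs) = c * wedge \<xi>s (us @ x # vs)"
      unfolding k sum_distrib_left by (rule sum.cong) (auto simp: lin[OF m])
    show "wedge \<xi>s (us @ x # vs) = 0" if "\<forall>i. 0 < i \<and> i < N \<longrightarrow> x $ i = 0"
      unfolding k by (rule sum.neutral) (auto simp: N[OF m that])
  qed
  have "mode_cochain (max N M) (pure_function v \<xi>s)"
    unfolding mode_cochain_def
  proof (intro conjI allI impI)
    show "pure_function v \<xi>s xs \<in> Vc" for xs by (simp add: pure_function_def v Vc_closed)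
    show "slot_additive (pure_function v \<xi>s)"
      by (auto simp: slot_additive_def pure_function_def w V.scale_left_distrib)
    show "slot_homogeneous (fps_scale s) sv (pure_function v \<xi>s)"
      by (auto simp: slot_homogeneous_def pure_function_def w)
    show "slot_alternating (pure_function v \<xi>s)"
      unfolding slot_alternating_def
    proof (intro allI)
      fix us x y vs
      show "pure_function v \<xi>s (us @ x # y # vs) = - pure_function v \<xi>s (us @ y # x # vs)"
        using wedge_alternating[of us x y vs \<xi>s] by (auto simp: pure_function_def)
    qed
    show "slot_vanishing (\<lambda>x. \<forall>i. 0 < i \<and> i < max N M \<longrightarrow> x $ i = 0) (pure_function v \<xi>s)"
      by (auto simp: slot_vanishing_def pure_function_def less_max_iff_disj intro!: w(3))
    show "mode c r (pure_function v \<xi>s xs) = 0" if "int (max N M) \<le> r" for c r xs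
      using M that by (simp add: pure_function_def killed_from_def)
  qed
  then show ?thesis by blast
qed

lemma tensor_functions_add:
  assumes "\<psi> \<in> tensor_functions n" "\<phi> \<in> tensor_functions n"
  shows "(\<lambda>xs. \<phi> xs + \<psi> xs) \<in> tensor_functions n"
  using assms
proof (induction \<psi>)
  case (add_pure \<psi> v \<xi>s)
  from tensor_functions.add_pure[OF add_pure.IH[OF add_pure.prems] add_pure.hyps(2-4)]
  show ?case by (simp add: add.assoc)
qed simp

lemma tensor_functions_sum:
  assumes "\<And>i. i \<in> I \<Longrightarrow> \<phi> i \<in> tensor_functions n"
  shows "(\<lambda>xs. \<Sum>i\<in>I. \<phi> i xs) \<in> tensor_functions n"
  using assms
  by (induction I rule: infinite_finite_induct) (auto intro: tensor_functions.zero tensor_functions_add)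

lemma weights_below_add:
  assumes "v \<in> weights_below M" "w \<in> weights_below N" shows "v + w \<in> weights_below (max M N)"
  using assms weights_below_mono[of M "max M N"] weights_below_mono[of N "max M N"]
  unfolding weights_below_def by (intro V.span_add) auto

end

context sugawara_module
begin

lemma tensor_functions_cochain:
  assumes "\<phi> \<in> tensor_functions n"
  shows "cochain n \<phi> \<and> (\<exists>M. \<forall>xs. \<phi> xs \<in> weights_below M)"
  using assms
proof induction
  case zero
  then show ?case by (auto simp: cochain_def mode_cochain_zero weights_below_def V.span_zero)
next
  case (add_pure \<phi> v \<xi>s)
  have "cochain n (pure_function v \<xi>s)"
    using mode_cochain_pure_function[OF add_pure(2,4)] add_pure(3) by (auto simp: cochain_def pure_function_def)
  with add_pure.IH have "cochain n (\<lambda>xs. \<phi> xs + pure_function v \<xi>s xs)"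
    using cochain_combination[of n \<phi> "pure_function v \<xi>s" 1 1] by simp
  moreover obtain M where "\<forall>xs. \<phi> xs \<in> weights_below M" using add_pure.IH by blast
  moreover obtain M' where "v \<in> weights_below M'" by (rule weights_exhaust[OF add_pure(2)])
  then have "pure_function v \<xi>s xs \<in> weights_below M'" for xs
    unfolding weights_below_def pure_function_def by (auto intro: V.span_scale V.span_zero)
  ultimately show ?case using weights_below_add by blast
qed

text \<open>Each slot is expanded in the monomials a t^p with a in the basis and 0 < p < N; the
  coefficient of a t^p is \<Omega>(x_p, \<open>dual a\<close>). The prefix \<open>us\<close> holds
  the slots already expanded.\<close>

lemma cochain_expansion:
  assumes \<phi>: "mode_cochain N \<phi>"
  shows "\<phi> (us @ xs) = (\<Sum>fs | set fs \<subseteq> B \<times> {1..<N} \<and> length fs = length xs.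
     sv (\<Prod>i<length xs. \<Omega> (xs ! i $ snd (fs ! i)) (dual (fst (fs ! i)))) (\<phi> (us @ map (\<lambda>(a, p). pos_mono a (int p)) fs)))"
proof (induction xs arbitrary: us)
  case Nil
  have "{fs. set fs \<subseteq> B \<times> {1..<N} \<and> length fs = length ([] :: 'g fps list)} = {[]}" by auto
  then show ?case by simp
next
  case (Cons x xs)
  let ?I = "B \<times> {1..<N}"
  let ?L = "\<lambda>n. {fs. set fs \<subseteq> ?I \<and> length fs = n}"
  let ?e = "\<lambda>(a, p). pos_mono a (int p)"
  note d = mode_cochainD[OF \<phi>]
  have a: "\<phi> (us @ (y + z) # vs) = \<phi> (us @ y # vs) + \<phi> (us @ z # vs)" for y z vs
    using d(2) by (simp add: slot_additive_def)
  have sc: "\<phi> (us @ fps_scale s c y # vs) = sv c (\<phi> (us @ y # vs))" for c y vs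
    using d(3) by (simp add: slot_homogeneous_def)
  define r where "r = Abs_fps (\<lambda>i. if 0 < i \<and> i < N then 0 else x $ i)"
  have x: "x = (\<Sum>ap\<in>?I. fps_scale s (\<Omega> (x $ snd ap) (dual (fst ap))) (?e ap)) + r"
  proof (rule fps_ext)
    fix n
    have "(\<Sum>ap\<in>?I. fps_scale s (\<Omega> (x $ snd ap) (dual (fst ap))) (?e ap)) $ n
      = (\<Sum>a\<in>B. \<Sum>p\<in>{1..<N}. if p = n then s (\<Omega> (x $ n) (dual a)) a else 0)"
      unfolding fps_sum_nth sum.cartesian_product
      by (rule sum.cong) (auto simp: pos_mono_nth fps_scale_def)
    also have "\<dots> = (if n \<in> {1..<N} then x $ n else 0)"
      using dual_expansion[of "x $ n"] by (cases "1 \<le> n \<and> n < N") auto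
    finally show "x $ n = ((\<Sum>ap\<in>?I. fps_scale s (\<Omega> (x $ snd ap) (dual (fst ap))) (?e ap)) + r) $ n"
      by (auto simp: r_def)
  qed
  have "\<phi> (us @ r # xs) = 0" using \<phi> by (auto simp: slot_vanishing_def r_def mode_cochain_def)
  then have "\<phi> (us @ x # xs) = (\<Sum>ap\<in>?I. sv (\<Omega> (x $ snd ap) (dual (fst ap))) (\<phi> ((us @ [?e ap]) @ xs)))"
    by (subst x) (simp add: a additive_fun_sum[of "\<lambda>y. \<phi> (us @ y # xs)", OF a] sc)
  also have "\<dots> = (\<Sum>ap\<in>?I. \<Sum>fs\<in>?L (length xs). sv (\<Omega> (x $ snd ap) (dual (fst ap)) *
      (\<Prod>i<length xs. \<Omega> (xs ! i $ snd (fs ! i)) (dual (fst (fs ! i))))) (\<phi> (us @ map ?e (ap # fs))))"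
    by (subst Cons.IH) (simp add: V.scale_sum_right)
  also have "\<dots> = (\<Sum>(fs, ap)\<in>?L (length xs) \<times> ?I. sv (\<Omega> (x $ snd ap) (dual (fst ap)) *
      (\<Prod>i<length xs. \<Omega> (xs ! i $ snd (fs ! i)) (dual (fst (fs ! i))))) (\<phi> (us @ map ?e (ap # fs))))"
    by (subst sum.swap) (simp add: sum.cartesian_product)
  also have "\<dots> = (\<Sum>(fs, ap)\<in>?L (length xs) \<times> ?I.
      sv (\<Prod>i<length (x # xs). \<Omega> ((x # xs) ! i $ snd ((ap # fs) ! i)) (dual (fst ((ap # fs) ! i)))) (\<phi> (us @ map ?e (ap # fs))))"
    by (simp add: prod.lessThan_Suc_shift del: prod.lessThan_Suc)
  also have "\<dots> = (\<Sum>fs\<in>?L (length (x # xs)).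
      sv (\<Prod>i<length (x # xs). \<Omega> ((x # xs) ! i $ snd (fs ! i)) (dual (fst (fs ! i)))) (\<phi> (us @ map ?e fs)))"
    unfolding list.size(4) add_Suc_right Nat.add_0_right lists_length_Suc_eq
    by (subst sum.reindex) (auto simp: inj_on_def case_prod_beta')
  finally show ?case .
qed

text \<open>Multilinear expansion yields ordinary products of coordinate functionals. Averaging
  \<phi> over all permutations of the arguments, with signs, turns these products into wedges; the
  average is the source of 1/n!.\<close>

lemma cochain_tensor_functions:
  assumes "cochain n \<phi>"
  shows "\<phi> \<in> tensor_functions n"
proof -
  obtain N where N: "mode_cochain N \<phi>" and l: "\<And>xs. length xs \<noteq> n \<Longrightarrow> \<phi> xs = 0"
    using assms by (auto simp: cochain_def)
  let ?L = "{fs. set fs \<subseteq> B \<times> {1..<N} \<and> length fs = n}"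
  let ?e = "\<lambda>(a, p). pos_mono a (int p)"
  let ?\<xi> = "\<lambda>ap x. \<Omega> (x $ snd ap) (dual (fst ap))"
  let ?P = "{p. p permutes {..<n}}"
  have \<phi>: "\<phi> xs = (\<Sum>fs\<in>?L. pure_function (sv (1 / fact n) (\<phi> (map ?e fs))) (map ?\<xi> fs) xs)" for xs
  proof (cases "length xs = n")
    case True
    have "sv (fact n) (\<phi> xs) = (\<Sum>p\<in>?P. \<phi> xs)"
      by (simp add: V.sum_constant_scale card_permutations)
    also have "\<dots> = (\<Sum>p\<in>?P. sv (of_int (sign p)) (\<phi> (map (\<lambda>i. xs ! p i) [0..<n])))"
    proof (rule sum.cong[OF refl])
      fix p assume "p \<in> ?P"
      then show "\<phi> xs = sv (of_int (sign p)) (\<phi> (map (\<lambda>i. xs ! p i) [0..<n]))"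
        using slot_alternating_permute[OF V.vector_space_axioms mode_cochainD(4)[OF N] _ True, of p]
        by (simp flip: of_int_mult)
    qed
    also have "\<dots> = (\<Sum>p\<in>?P. sv (of_int (sign p)) (\<Sum>fs\<in>?L. sv (\<Prod>i<n. ?\<xi> (fs ! i) (xs ! p i)) (\<phi> (map ?e fs))))"
    proof (rule sum.cong[OF refl])
      fix p
      show "sv (of_int (sign p)) (\<phi> (map (\<lambda>i. xs ! p i) [0..<n]))
        = sv (of_int (sign p)) (\<Sum>fs\<in>?L. sv (\<Prod>i<n. ?\<xi> (fs ! i) (xs ! p i)) (\<phi> (map ?e fs)))"
        using cochain_expansion[OF N, of "[]" "map (\<lambda>i. xs ! p i) [0..<n]"] by simp
    qed
    also have "\<dots> = (\<Sum>fs\<in>?L. \<Sum>p\<in>?P. sv (of_int (sign p) * (\<Prod>i<n. ?\<xi> (fs ! i) (xs ! p i))) (\<phi> (map ?e fs)))"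
      by (subst sum.swap) (simp add: V.scale_sum_right)
    also have "\<dots> = (\<Sum>fs\<in>?L. sv (wedge (map ?\<xi> fs) xs) (\<phi> (map ?e fs)))"
      by (rule sum.cong[OF refl]) (auto simp: wedge_def V.scale_sum_left)
    finally have "sv (1 / fact n) (sv (fact n) (\<phi> xs))
        = sv (1 / fact n) (\<Sum>fs\<in>?L. sv (wedge (map ?\<xi> fs) xs) (\<phi> (map ?e fs)))" by simp
    then show ?thesis
      using True by (simp add: V.scale_sum_right pure_function_def mult.commute)
  next
    case False
    then show ?thesis by (simp add: l pure_function_def)
  qed
  have "pure_function (sv (1 / fact n) (\<phi> (map ?e fs))) (map ?\<xi> fs) \<in> tensor_functions n" if "fs \<in> ?L" for fs
  proof -
    have "set (map ?\<xi> fs) \<subseteq> continuous_dual s"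
    proof
      fix \<xi> assume "\<xi> \<in> set (map ?\<xi> fs)"
      then obtain i where i: "i \<in> set fs" "\<xi> = ?\<xi> i" by auto
      define a p where "a = fst i" and "p = snd i"
      have ap: "\<xi> = (\<lambda>x. \<Omega> (x $ p) (dual a))" "p > 0" using i that by (auto simp: a_def p_def)
      have "vector_space ((*) :: complex \<Rightarrow> complex \<Rightarrow> complex)"
        by unfold_locales (auto simp: algebra_simps)
      then have "Vector_Spaces.linear s (*) (\<lambda>x. \<Omega> x (dual a))"
        using vector_space_axioms by (simp add: Vector_Spaces.linear_iff \<Omega>_sym[of _ "dual a"] \<Omega>_add \<Omega>_scale)
      then show "\<xi> \<in> continuous_dual s" unfolding ap by (rule coefficient_functional_dual) (rule ap)
    qed
    then show ?thesis
      using tensor_functions.add_pure[OF tensor_functions.zero, of "sv (1 / fact n) (\<phi> (map ?e fs))" "map ?\<xi> fs" n] that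
        Vc_closed mode_cochainD(1)[OF N] by simp
  qed
  then have "(\<lambda>xs. \<Sum>fs\<in>?L. pure_function (sv (1 / fact n) (\<phi> (map ?e fs))) (map ?\<xi> fs) xs) \<in> tensor_functions n"
    by (rule tensor_functions_sum)
  moreover have "\<phi> = (\<lambda>xs. \<Sum>fs\<in>?L. pure_function (sv (1 / fact n) (\<phi> (map ?e fs))) (map ?\<xi> fs) xs)"
    using \<phi> by blast
  ultimately show ?thesis by simp
qed

end

section \<open>The form \<open>\<kappa> - \<kappa>\<^sub>c\<close> and its dual bases\<close>

locale noncritical_level = simple_lie_algebra s br + lie_algebra_form s br \<kappa>
  for s :: "complex \<Rightarrow> 'g::ab_group_add \<Rightarrow> 'g" and br and \<kappa> +
  assumes noncritical: "\<kappa> \<noteq> critical_form"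
begin

definition E :: "'g set" where "E = extend_basis {}"

lemma E_basis: "independent E" "span E = UNIV" "finite E"
proof -
  show i: "independent E" "span E = UNIV"
    unfolding E_def using independent_extend_basis[of "{}"] span_extend_basis[of "{}"] independent_empty by auto
  obtain B where "finite B" "span B = UNIV" using finite_dimensional by blast
  then show "finite E" using independent_span_bound[of B E] i by auto
qed

lemma E_expansion: "(\<Sum>b\<in>E. s (representation E x b) b) = x"
  using sum_representation_eq[OF E_basis(1), of x E] E_basis by auto

lemma coord_add: "representation E (x + y) b = representation E x b + representation E y b"
  and coord_scale: "representation E (s c x) b = c * representation E x b"
  using representation_add[OF E_basis(1), of y x] representation_scale[OF E_basis(1), of x c] E_basis(2) by auto

lemma coord_sum: "representation E (sum f S) b = (\<Sum>i\<in>S. representation E (f i) b)"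
  by (rule additive_fun_sum) (rule coord_add)

lemma trace_E: "trace f = (\<Sum>b\<in>E. representation E (f b) b)"
  by (simp add: trace_def E_def)

lemma trace_cyclic:
  assumes f: "\<And>x y. f (x + y) = f x + f y" "\<And>c x. f (s c x) = s c (f x)"
    and g: "\<And>x y. g (x + y) = g x + g y" "\<And>c x. g (s c x) = s c (g x)"
  shows "trace (f \<circ> g) = trace (g \<circ> f)"
proof -
  have expand: "representation E (h (k b)) b = (\<Sum>c\<in>E. representation E (k b) c * representation E (h c) b)"
    if "\<And>x y. h (x + y) = h x + h y" "\<And>c x. h (s c x) = s c (h x)" for h k :: "'g \<Rightarrow> 'g" and b
  proof -
    have "h (k b) = (\<Sum>c\<in>E. s (representation E (k b) c) (h c))"
      by (subst E_expansion[of "k b", symmetric]) (simp add: additive_fun_sum[of h, OF that(1)] that(2))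
    then show ?thesis by (simp add: coord_sum coord_scale)
  qed
  have "trace (f \<circ> g) = (\<Sum>b\<in>E. \<Sum>c\<in>E. representation E (g b) c * representation E (f c) b)"
    by (simp add: trace_E expand[of f g, OF f])
  also have "\<dots> = (\<Sum>b\<in>E. \<Sum>c\<in>E. representation E (f b) c * representation E (g c) b)"
    by (subst sum.swap) (simp add: mult.commute)
  also have "\<dots> = trace (g \<circ> f)"
    by (simp add: trace_E expand[of g f, OF g])
  finally show ?thesis .
qed

definition killing :: "'g \<Rightarrow> 'g \<Rightarrow> complex" where
  "killing x y = trace (br x \<circ> br y)"

lemma killing_sym: "killing x y = killing y x"
  unfolding killing_def by (rule trace_cyclic) simp_all

lemma killing_add: "killing x (y + z) = killing x y + killing x z"
  and killing_scale: "killing x (s c z) = c * killing x z"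
  by (simp_all add: killing_def trace_E coord_add coord_scale sum.distrib sum_distrib_left)

text \<open>Writing the adjoint action of a bracket as a commutator, both sides share a triple
  product, and the two others agree by cyclicity of the trace.\<close>

lemma killing_invariant: "killing (br x y) z = killing x (br y z)"
proof -
  have t: "trace (\<lambda>w. f w - g w) = trace f - trace g" for f g
    by (simp add: trace_E sum_subtractf[symmetric] additive_fun_diff[of "\<lambda>x. representation E x _", OF coord_add])
  have "br (br x y) \<circ> br z = (\<lambda>w. (br x \<circ> br y \<circ> br z) w - (br y \<circ> (br x \<circ> br z)) w)"
    by (simp add: fun_eq_iff br_leibniz[of x])
  moreover have "br x \<circ> br (br y z) = (\<lambda>w. (br x \<circ> br y \<circ> br z) w - ((br x \<circ> br z) \<circ> br y) w)"
    by (simp add: fun_eq_iff br_leibniz[of y])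
  moreover have "trace (br y \<circ> (br x \<circ> br z)) = trace ((br x \<circ> br z) \<circ> br y)"
    by (rule trace_cyclic) simp_all
  ultimately show ?thesis by (simp only: killing_def t)
qed

definition Om :: "'g \<Rightarrow> 'g \<Rightarrow> complex" where
  "Om x y = \<kappa> x y + killing x y / 2"

lemma Om_eq: "Om x y = \<kappa> x y - critical_form x y"
  by (simp add: Om_def critical_form_def killing_def)

lemma Om_sym: "Om x y = Om y x"
  and Om_invariant: "Om (br x y) z = Om x (br y z)"
  and Om_add: "Om x (y + z) = Om x y + Om x z"
  and Om_scale: "Om x (s c z) = c * Om x z"
  using form_sym[of x y] killing_sym[of x y] form_invariant[of x y z] killing_invariant[of x y z]
  by (simp_all add: Om_def killing_add killing_scale algebra_simps add_divide_distrib)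

lemma Om_add_left: "Om (y + z) x = Om y x + Om z x"
  and Om_scale_left: "Om (s c z) x = c * Om z x"
  by (simp_all add: Om_sym[of _ x] Om_add Om_scale)

lemma Om_minus: "Om (- x) y = - Om x y" "Om y (- x) = - Om y x"
  using additive_fun_minus[of "\<lambda>x. Om x y"] additive_fun_minus[of "Om y"] Om_add Om_add_left by blast+

lemma Om_sum: "Om x (sum f S) = (\<Sum>i\<in>S. Om x (f i))"
  and Om_sum_left: "Om (sum f S) x = (\<Sum>i\<in>S. Om (f i) x)"
  by (rule additive_fun_sum[of "Om x"], rule Om_add, rule additive_fun_sum[of "\<lambda>y. Om y x"], rule Om_add_left)

lemma Om_nondegenerate:
  assumes "\<And>y. Om x y = 0" shows "x = 0"
proof -
  let ?I = "{x. \<forall>y. Om x y = 0}"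
  have "lie_ideal ?I"
    unfolding lie_ideal_def
  proof (intro conjI allI ballI)
    have "Om 0 y = 0" for y using Om_scale_left[of 0 0 y] by simp
    then show "subspace ?I" by (simp add: subspace_def Om_add_left Om_scale_left)
    fix x y assume y: "y \<in> ?I"
    have "Om (br x y) z = 0" for z
    proof -
      have "Om (br x y) z = - Om (br y x) z" by (subst br_swap) (rule Om_minus)
      then show ?thesis using y by (simp add: Om_invariant)
    qed
    then show "br x y \<in> ?I" by simp
  qed
  moreover have "?I \<noteq> UNIV"
  proof
    assume "?I = UNIV"
    then have "Om x y = 0" for x y by blast
    then have "\<kappa> = critical_form" by (simp add: fun_eq_iff Om_eq)
    then show False using noncritical by simp
  qed
  ultimately have "?I = {0}" using only_trivial_ideals by blast
  then show ?thesis using assms by blast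
qed

text \<open>The map sending x to its pairings with the basis is injective by nondegeneracy, hence
  surjective in finite dimension. For b outside the basis the zero vector meets the
  condition.\<close>

lemma Om_dual_exists: "\<exists>b'. \<forall>c\<in>E. Om b' c = (if c = b then 1 else 0)"
proof -
  interpret fd: finite_dimensional_vector_space s E
    by unfold_locales (use E_basis in auto)
  define T where "T x = (\<Sum>c\<in>E. s (Om x c) c)" for x
  have T: "Vector_Spaces.linear s s T"
    using vector_space_axioms
    by (simp add: Vector_Spaces.linear_iff T_def Om_add_left Om_scale_left scale_left_distrib sum.distrib scale_sum_right)
  have coord: "representation E (T x) c = Om x c" if "c \<in> E" for x c
  proof -
    have "representation E (T x) c = (\<Sum>b\<in>E. Om x b * representation E b c)"
      by (simp add: T_def coord_sum coord_scale)
    also have "\<dots> = (\<Sum>b\<in>E. if b = c then Om x c else 0)"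
      by (rule sum.cong[OF refl]) (simp add: representation_basis[OF E_basis(1)])
    finally show ?thesis using that E_basis(3) by simp
  qed
  have zero: "x = 0" if "T x = 0" for x
  proof (rule Om_nondegenerate)
    fix y
    have "Om x c = 0" if "c \<in> E" for c
      using coord[OF that, of x] \<open>T x = 0\<close> by (simp add: representation_zero)
    then show "Om x y = 0"
      by (subst E_expansion[of y, symmetric]) (simp add: Om_sum Om_scale)
  qed
  have "inj T"
  proof (rule injI)
    fix x y assume "T x = T y"
    then have "T (x - y) = 0"
      using additive_fun_diff[of T, OF linear_map_add[OF T]] by simp
    then show "x = y" using zero by fastforce
  qed
  then have "surj T" by (rule fd.linear_inj_imp_surj[OF T])
  then obtain b' where b': "b = T b'" by blast
  show ?thesis
  proof (cases "b \<in> E")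
    case True
    have "Om b' c = (if c = b then 1 else 0)" if "c \<in> E" for c
      using coord[OF that, of b'] representation_basis[OF E_basis(1) True] by (simp add: b'[symmetric])
    then show ?thesis by blast
  next
    case False
    have "Om 0 c = 0" for c using Om_scale_left[of 0 0 c] by simp
    then show ?thesis using False by (intro exI[of _ 0]) auto
  qed
qed

definition dual :: "'g \<Rightarrow> 'g" where
  "dual b = (SOME b'. \<forall>c\<in>E. Om b' c = (if c = b then 1 else 0))"

lemma Om_dual: "c \<in> E \<Longrightarrow> Om c (dual b) = (if c = b then 1 else 0)"
  using someI_ex[OF Om_dual_exists[of b]] by (simp add: dual_def Om_sym[of c])

lemma coord_dual: "a \<in> E \<Longrightarrow> Om x (dual a) = representation E x a"
proof -
  assume a: "a \<in> E"
  have "Om x (dual a) = (\<Sum>c\<in>E. representation E x c * Om c (dual a))"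
    by (subst E_expansion[of x, symmetric]) (simp add: Om_sum_left Om_scale_left)
  also have "\<dots> = (\<Sum>c\<in>E. if c = a then representation E x a else 0)"
    by (rule sum.cong[OF refl]) (simp add: Om_dual)
  finally show ?thesis using a E_basis(3) by simp
qed

lemma dual_basis_expansion: "x = (\<Sum>a\<in>E. s (Om x (dual a)) a)"
  using E_expansion[of x] by (simp add: coord_dual cong: sum.cong)

lemma dual_basis_expansion': "x = (\<Sum>a\<in>E. s (Om x a) (dual a))"
proof -
  let ?z = "\<Sum>a\<in>E. s (Om x a) (dual a)"
  have "Om (x - ?z) y = 0" for y
  proof -
    have "Om ?z y = (\<Sum>a\<in>E. Om x a * Om y (dual a))"
      by (simp add: Om_sum_left Om_scale_left Om_sym[of y])
    also have "\<dots> = Om x (\<Sum>a\<in>E. s (Om y (dual a)) a)"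
      by (simp add: Om_sum Om_scale mult.commute)
    finally have "Om ?z y = Om x y" using dual_basis_expansion[of y] by simp
    then show ?thesis using additive_fun_diff[of "\<lambda>x. Om x y", OF Om_add_left] by simp
  qed
  then have "x - ?z = 0" by (rule Om_nondegenerate)
  then show ?thesis by simp
qed

text \<open>Paired with y under \<Omega>, the first two sums give \<kappa>(b, y) each and the third
  gives the trace of ad b ad y. The total is 2 \<kappa> plus the Killing form, which is 2 \<Omega>,
  and nondegeneracy removes y. This fixes the normalisation that makes the Sugawara operator measure
  degree exactly.\<close>

lemma casimir_identity:
  "(\<Sum>a\<in>E. s (\<kappa> b (dual a)) a) + (\<Sum>a\<in>E. s (\<kappa> b (dual a)) a) + (\<Sum>a\<in>E. br a (br (dual a) b)) = b + b"
proof -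
  let ?K = "\<Sum>a\<in>E. s (\<kappa> b (dual a)) a" and ?C = "\<Sum>a\<in>E. br a (br (dual a) b)"
  have "Om (?K + ?K + ?C - (b + b)) y = 0" for y
  proof -
    have "Om ?K y = (\<Sum>a\<in>E. Om y a * \<kappa> b (dual a))"
      unfolding Om_sum_left Om_scale_left by (simp add: Om_sym[of _ y] mult.commute)
    also have "\<dots> = \<kappa> b (\<Sum>a\<in>E. s (Om y a) (dual a))" by (simp add: form_sum_right)
    finally have K: "Om ?K y = \<kappa> b y" using dual_basis_expansion'[of y] by simp
    have "Om (br a (br (dual a) b)) y = Om (br b (br y a)) (dual a)" for a
    proof -
      have "Om (br a (br (dual a) b)) y = - Om (br (br (dual a) b) a) y" by (subst br_swap) (rule Om_minus)
      also have "\<dots> = - Om (br (dual a) b) (br a y)" by (simp add: Om_invariant)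
      also have "\<dots> = - Om (dual a) (br b (br a y))" by (simp add: Om_invariant)
      also have "\<dots> = Om (dual a) (br b (br y a))" by (subst (2) br_swap) (simp add: Om_minus)
      finally show ?thesis by (simp add: Om_sym)
    qed
    then have "Om ?C y = (\<Sum>a\<in>E. representation E (br b (br y a)) a)"
      by (simp add: Om_sum_left coord_dual)
    then have C: "Om ?C y = killing b y" by (simp add: killing_def trace_E)
    show ?thesis
      using additive_fun_diff[of "\<lambda>x. Om x y", OF Om_add_left] by (simp add: Om_add_left K C Om_def[of b])
  qed
  then have "?K + ?K + ?C - (b + b) = 0" by (rule Om_nondegenerate)
  then show ?thesis by simp
qed

end

section \<open>Vacuum expectation values\<close>

lemma slot_der_cong_fun:
  assumes "\<And>ys. length ys = length xs \<Longrightarrow> \<phi> ys = \<psi> ys"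
  shows "slot_der T \<phi> xs = slot_der T \<psi> xs"
proof -
  have "slot_der T (\<lambda>ys. \<phi> ys - \<psi> ys) xs = 0" by (rule slot_der_length) (simp add: assms)
  then show ?thesis by (simp add: slot_der_diff)
qed

lemma slot_der_snoc: "slot_der T \<phi> (xs @ [x]) = slot_der T (\<lambda>ys. \<phi> (ys @ [x])) xs - \<phi> (xs @ [T x])"
  by (induction xs arbitrary: \<phi>) simp_all

context lie_algebra_form
begin

definition regular :: "'g affine \<Rightarrow> 'g affine" where
  "regular x = (fps_to_fls (fls_regpart (fst x)), 0)"

text \<open>The expectation value \<open>\<langle>x\<^sub>1 \<cdots> x\<^sub>k\<rangle>\<close> in the vacuum: the covector \<open>\<langle>0|\<close> annihilates
  \<open>t\<^sup>-\<^sup>1\<gg>[t\<^sup>-\<^sup>1]\<close>, and the regular part of the first letter is commuted through the rest of the word to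
  the vacuum vector.\<close>

fun expectation :: "'g affine list \<Rightarrow> complex" where
  "expectation [] = 1"
| "expectation (x # w) = snd x * expectation w + (\<Sum>i<length w. expectation (w[i := abr (regular x) (w ! i)]))"

lemma expectation_Cons:
  "expectation (x # w) = snd x * expectation w - slot_der (abr (regular x)) expectation w"
  by (simp add: slot_der_eq_sum)

declare expectation.simps(2) [simp del]

lemma regular_nth: "fst (regular x) $$ n = (if n < 0 then 0 else fst x $$ n)" "snd (regular x) = 0"
  by (simp_all add: regular_def)

lemma regular_add: "regular (x + y) = regular x + regular y"
  and regular_scale: "regular (affine_scale s c x) = affine_scale s c (regular x)"
  by (rule affine_eqI; simp add: regular_nth)+

text \<open>Linearity in the first letter follows from linearity of \<open>regular\<close> and of
  the bracket, but also needs linearity of the expectation in all slots of shorter words; so an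
  induction on length is unavoidable.\<close>

lemma expectation_linear: "slot_additive expectation" "slot_homogeneous (affine_scale s) (*) expectation"
proof -
  \<comment> \<open>Slot conditions speak about lists of all lengths. Cutting the function off at
    length n turns the bounded induction hypothesis into such a condition, and the cut functions
    satisfy the same recursion.\<close>
  define cut where "cut n w = (if length w \<le> n then expectation w else 0)" for n w
  have cut: "slot_additive (cut n) \<and> slot_homogeneous (affine_scale s) (*) (cut n)" for n
  proof (induction n)
    case 0
    then show ?case by (auto simp: slot_additive_def slot_homogeneous_def cut_def)
  next
    case (Suc n)
    have step: "cut (Suc n) (x # w) = snd x * cut n w - slot_der (abr (regular x)) (cut n) w" for x w
    proof (cases "length w \<le> n")
      case True
      then have "slot_der (abr (regular x)) (cut n) w = slot_der (abr (regular x)) expectation w"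
        by (intro slot_der_cong_fun) (simp add: cut_def)
      then show ?thesis using True by (simp add: cut_def expectation_Cons)
    next
      case False
      then have "slot_der (abr (regular x)) (cut n) w = 0" by (intro slot_der_length) (simp add: cut_def)
      then show ?thesis using False by (simp add: cut_def)
    qed
    have ad: "slot_additive (slot_der (abr z) (cut n))" for z
      using Suc by (intro slot_additive_slot_der) (auto simp: affine_bracket_add_right)
    have sc: "slot_homogeneous (affine_scale s) (*) (slot_der (abr z) (cut n))" for z
      using Suc by (intro slot_homogeneous_slot_der) (auto simp: affine_bracket_scale_right algebra_simps)
    show ?case
    proof
      show "slot_additive (cut (Suc n))"
        unfolding slot_additive_def
      proof (intro allI)
        fix us x y vs
        show "cut (Suc n) (us @ (x + y) # vs) = cut (Suc n) (us @ x # vs) + cut (Suc n) (us @ y # vs)"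
        proof (cases us)
          case Nil
          show ?thesis
            using slot_der_add_map[of "cut n" "abr (regular x)" "abr (regular y)" vs] Suc
            by (simp add: Nil step regular_add affine_bracket_add_left[abs_def] algebra_simps)
        next
          case (Cons u us')
          then show ?thesis
            using slot_additiveD[OF ad, of "regular u" us' x y vs] slot_additiveD[of "cut n" us' x y vs] Suc
            by (simp add: step algebra_simps)
        qed
      qed
      show "slot_homogeneous (affine_scale s) (*) (cut (Suc n))"
        unfolding slot_homogeneous_def
      proof (intro allI)
        fix us c x vs
        show "cut (Suc n) (us @ affine_scale s c x # vs) = c * cut (Suc n) (us @ x # vs)"
        proof (cases us)
          case Nil
          show ?thesis
            using slot_der_scale_map[of "affine_scale s" "(*)" "cut n" c "abr (regular x)" vs] Suc
            by (simp add: Nil step regular_scale affine_bracket_scale_left[abs_def] algebra_simps)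
        next
          case (Cons u us')
          then show ?thesis
            using slot_homogeneousD[OF sc, of "regular u" us' c x vs] slot_homogeneousD[of "affine_scale s" "(*)" "cut n" us' c x vs] Suc
            by (simp add: step algebra_simps)
        qed
      qed
    qed
  qed
  have eq: "expectation w = cut n w" if "length w \<le> n" for w n using that by (simp add: cut_def)
  show "slot_additive expectation"
    unfolding slot_additive_def
  proof (intro allI)
    fix us x y vs
    show "expectation (us @ (x + y) # vs) = expectation (us @ x # vs) + expectation (us @ y # vs)"
      using slot_additiveD[OF cut[THEN conjunct1], of "length us + length vs + 1" us x y vs]
      by (simp add: eq[of _ "length us + length vs + 1"])
  qed
  show "slot_homogeneous (affine_scale s) (*) expectation"
    unfolding slot_homogeneous_def
  proof (intro allI)
    fix us c x vs
    show "expectation (us @ affine_scale s c x # vs) = c * expectation (us @ x # vs)"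
      using slot_homogeneousD[OF cut[THEN conjunct2], of "length us + length vs + 1" us c x vs]
      by (simp add: eq[of _ "length us + length vs + 1"])
  qed
qed

text \<open>The length bound makes the rule usable as an induction hypothesis while the recursion
  still calls the full expectation.\<close>

definition commutator_rule :: "nat \<Rightarrow> ('g affine list \<Rightarrow> complex) \<Rightarrow> bool" where
  "commutator_rule n \<phi> \<longleftrightarrow> (\<forall>us x y vs. length us + length vs + 2 \<le> n \<longrightarrow>
     \<phi> (us @ x # y # vs) - \<phi> (us @ y # x # vs) = \<phi> (us @ abr x y # vs))"

lemma commutator_rule_insert: "commutator_rule (Suc n) \<phi> \<Longrightarrow> commutator_rule n (\<lambda>ys. \<phi> (z # ys))"
  unfolding commutator_rule_def
proof (intro allI impI)
  fix us vs :: "'g affine list" and x y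
  assume a: "\<forall>us x y vs. length us + length vs + 2 \<le> Suc n \<longrightarrow>
     \<phi> (us @ x # y # vs) - \<phi> (us @ y # x # vs) = \<phi> (us @ abr x y # vs)" "length us + length vs + 2 \<le> n"
  show "\<phi> (z # us @ x # y # vs) - \<phi> (z # us @ y # x # vs) = \<phi> (z # us @ abr x y # vs)"
    using a(1)[rule_format, of "z # us" vs x y] a(2) by simp
qed

lemma commutator_rule_slot_der:
  assumes "slot_additive \<phi>" "commutator_rule n \<phi>" and len: "length us + length vs + 2 \<le> n"
    and T: "\<And>x y. T (abr x y) = abr (T x) y + abr x (T y)"
  shows "slot_der T \<phi> (us @ x # y # vs) - slot_der T \<phi> (us @ y # x # vs) = slot_der T \<phi> (us @ abr x y # vs)"
  using assms(1-3)
proof (induction us arbitrary: \<phi> n)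
  case Nil
  have r: "\<phi> (x # y # ws) - \<phi> (y # x # ws) = \<phi> (abr x y # ws)" if "length ws = length vs" for x y ws
    using Nil(2)[unfolded commutator_rule_def, rule_format, of "[]" ws x y] Nil(3) that by simp
  have "slot_der T (\<lambda>ys. \<phi> (x # y # ys)) vs - slot_der T (\<lambda>ys. \<phi> (y # x # ys)) vs = slot_der T (\<lambda>ys. \<phi> (abr x y # ys)) vs"
    unfolding slot_der_diff[symmetric] by (rule slot_der_cong_fun) (rule r)
  then show ?case
    using r[of vs "T x" y] r[of vs x "T y"] by (simp add: T slot_additive_first[OF Nil(1)] algebra_simps)
next
  case (Cons u us)
  obtain m where m: "n = Suc m" using Cons.prems(3) by (cases n) auto
  have "\<phi> (T u # us @ x # y # vs) - \<phi> (T u # us @ y # x # vs) = \<phi> (T u # us @ abr x y # vs)"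
    using Cons.prems(2)[unfolded commutator_rule_def, rule_format, of "T u # us" vs x y] Cons.prems(3) by simp
  moreover have "slot_der T (\<lambda>ys. \<phi> (u # ys)) (us @ x # y # vs) - slot_der T (\<lambda>ys. \<phi> (u # ys)) (us @ y # x # vs)
    = slot_der T (\<lambda>ys. \<phi> (u # ys)) (us @ abr x y # vs)"
    using Cons.prems(2,3) unfolding m
    by (intro Cons.IH[of _ m] slot_additive_insert[OF Cons.prems(1)] commutator_rule_insert) auto
  ultimately show ?case by (simp add: algebra_simps)
qed

lemma expectation_singular:
  assumes "\<And>n. n \<ge> 0 \<Longrightarrow> fst m $$ n = 0" "snd m = 0"
  shows "expectation (m # w) = 0"
proof -
  have "regular m = 0" by (rule affine_eqI) (auto simp: regular_nth assms)
  moreover have "abr 0 x = 0" for x using affine_bracket_central(1)[of 0 x] by (simp add: zero_prod_def)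
  moreover have "slot_vanishing (\<lambda>x. x = 0) expectation"
    using slot_additive_zero[OF expectation_linear(1)] by (simp add: slot_vanishing_def)
  ultimately show ?thesis
    using slot_der_zero_map[of "\<lambda>x. x = 0" expectation "\<lambda>x. 0" w] by (simp add: expectation_Cons assms cong: slot_der_cong)
qed

lemma regular_bracket: "regular (abr (regular x) (regular y)) = abr (regular x) (regular y)"
  "snd (abr (regular x) (regular y)) = 0"
proof -
  have "abr (regular x) (regular y) = (fps_to_fls (fps_bracket br (fls_regpart (fst x)) (fls_regpart (fst y))), 0)"
    unfolding regular_def by (rule affine_bracket_fps)
  then show "regular (abr (regular x) (regular y)) = abr (regular x) (regular y)"
    "snd (abr (regular x) (regular y)) = 0"
    by (auto intro!: affine_eqI simp: regular_nth)
qed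

text \<open>Each letter is split into its regular part and the rest. Regular parts act by
  derivations whose commutator is the derivation of the bracket. The bracket of the two remaining
  parts has only negative modes and no central term, so its expectation in front of a word is 0;
  bilinearity of the bracket collects the other terms.\<close>

lemma expectation_front_commutator:
  "expectation (x # y # w) - expectation (y # x # w) = expectation (abr x y # w)"
proof -
  let ?D = "\<lambda>x. slot_der (abr (regular x))"
  note add = expectation_linear(1)
  have two: "expectation (x # y # w) = snd x * (snd y * expectation w - ?D y expectation w)
      - (snd y * ?D x expectation w - ?D x (?D y expectation) w) + expectation (abr (regular x) y # w)" for x y
  proof -
    have "?D x expectation (y # w) = ?D x (\<lambda>ys. expectation (y # ys)) w - expectation (abr (regular x) y # w)" by simp
    also have "?D x (\<lambda>ys. expectation (y # ys)) w = snd y * ?D x expectation w - ?D x (?D y expectation) w"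
      unfolding expectation_Cons by (simp add: slot_der_diff slot_der_hom[of "(*) (snd y)"] distrib_left)
    finally show ?thesis by (simp add: expectation_Cons[of x] expectation_Cons[of y w])
  qed
  let ?r = "abr (regular x) (regular y)"
  have "(\<lambda>z. abr (regular x) (abr (regular y) z) - abr (regular y) (abr (regular x) z)) = abr ?r"
    by (rule ext) (simp add: affine_bracket_leibniz[of "regular x"])
  then have "?D x (?D y expectation) w - ?D y (?D x expectation) w = slot_der (abr ?r) expectation w"
    by (simp add: slot_der_commutator[OF add])
  also have "\<dots> = - expectation (?r # w)" by (simp add: expectation_Cons[of ?r] regular_bracket)
  finally have c: "?D x (?D y expectation) w - ?D y (?D x expectation) w = - expectation (?r # w)" .
  have 1: "expectation (x # y # w) - expectation (y # x # w)
      = expectation (abr (regular x) y # w) - expectation (abr (regular y) x # w) - expectation (?r # w)"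
  proof -
    have "?D x (?D y expectation) w = ?D y (?D x expectation) w - expectation (?r # w)"
      using c by (simp add: diff_eq_eq)
    then show ?thesis unfolding two[of x y] two[of y x] by (simp add: algebra_simps)
  qed
  define m where "m = abr (x - regular x) (y - regular y)"
  obtain N where N: "N \<ge> 0" "\<And>i. i < - N \<Longrightarrow> fst x $$ i = 0" "\<And>i. i < - N \<Longrightarrow> fst y $$ i = 0"
    "\<And>i. i < - N \<Longrightarrow> fst y $$ i = 0" by (rule fls_common_bound[of "fst x" "fst y" "fst y"]) blast
  have "expectation (m # w) = 0"
  proof (rule expectation_singular)
    fix n :: int assume "n \<ge> 0"
    then show "fst m $$ n = 0"
      unfolding m_def
      by (subst affine_bracket_fst[of "-N" _ "-N"]) (auto simp: regular_nth N intro!: sum.neutral)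
  next
    show "snd m = 0"
      unfolding m_def
      by (subst affine_bracket_snd[of "-N" _ "-N"]) (auto simp: regular_nth N intro!: sum.neutral)
  qed
  moreover have "abr x y = m + abr (regular x) y - abr (regular y) x - ?r"
  proof -
    have d: "abr (u - v) z = abr u z - abr v z" "abr z (u - v) = abr z u - abr z v" for u v z
      using additive_fun_diff[of "\<lambda>u. abr u z", OF affine_bracket_add_left]
        additive_fun_diff[of "abr z", OF affine_bracket_add_right] by auto
    show ?thesis unfolding m_def d using affine_bracket_swap[of "regular y" x] by (simp add: algebra_simps)
  qed
  ultimately show ?thesis
    unfolding 1 by (simp add: slot_additive_first[OF add] slot_additive_minus_first[OF add])
qed

lemma expectation_commutator: "expectation (us @ x # y # vs) - expectation (us @ y # x # vs) = expectation (us @ abr x y # vs)"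
proof -
  have "commutator_rule n expectation" for n
  proof (induction n)
    case (Suc n)
    show ?case
      unfolding commutator_rule_def
    proof (intro allI impI)
      fix us vs :: "'g affine list" and x y assume l: "length us + length vs + 2 \<le> Suc n"
      show "expectation (us @ x # y # vs) - expectation (us @ y # x # vs) = expectation (us @ abr x y # vs)"
      proof (cases us)
        case Nil
        then show ?thesis using expectation_front_commutator by simp
      next
        case (Cons u us')
        have a: "expectation (us' @ x # y # vs) - expectation (us' @ y # x # vs) = expectation (us' @ abr x y # vs)"
          using Suc[unfolded commutator_rule_def, rule_format, of us' vs x y] l Cons by simp
        have b: "slot_der (abr (regular u)) expectation (us' @ x # y # vs) - slot_der (abr (regular u)) expectation (us' @ y # x # vs)
          = slot_der (abr (regular u)) expectation (us' @ abr x y # vs)"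
          by (rule commutator_rule_slot_der[OF expectation_linear(1) Suc _ affine_bracket_leibniz]) (use l Cons in auto)
        show ?thesis
          by (simp add: Cons expectation_Cons a[symmetric] b[symmetric] right_diff_distrib)
      qed
    qed
  qed (simp add: commutator_rule_def)
  from this[of "length us + length vs + 2"] show ?thesis
    unfolding commutator_rule_def by blast
qed

text \<open>Commuting the regular part of an earlier letter through h gives an element of g[[t]]
  without central part, whose contribution is 0 by induction. What remains carries the scalar of h
  as a common factor.\<close>

lemma expectation_balanced: "h \<in> affine_plus \<Longrightarrow> expectation (u @ [h]) = snd h * expectation u"
proof (induction "length u" arbitrary: u h)
  case 0
  then show ?case by (simp add: expectation_Cons)
next
  case (Suc n)
  then obtain z w where u: "u = z # w" "length w = n" by (cases u) auto
  obtain f a where h: "h = (fps_to_fls f, a)" using Suc.prems by (auto simp: affine_plus_def)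
  have "abr (regular z) h \<in> affine_plus" "snd (abr (regular z) h) = 0"
    unfolding h regular_def affine_bracket_fps by (auto simp: affine_plus_def)
  then have 1: "expectation (w @ [abr (regular z) h]) = 0" using Suc.hyps(1)[of w] u(2) by simp
  have "slot_der (abr (regular z)) (\<lambda>ys. expectation (ys @ [h])) w
      = slot_der (abr (regular z)) (\<lambda>ys. snd h * expectation ys) w"
    by (rule slot_der_cong_fun) (use Suc.hyps(1) Suc.prems u(2) in auto)
  then show ?case
    using Suc.hyps(1)[of w h] u(2) Suc.prems 1
    by (simp add: u(1) expectation_Cons slot_der_snoc slot_der_hom[of "(*) (snd h)"] algebra_simps)
qed

end

section \<open>The vacuum module\<close>

lemma single_scale: "Poly_Mapping.single k (c * a) = free_scale c (Poly_Mapping.single k a)"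
  by (rule poly_mapping_eqI) (simp add: lookup_free_scale lookup_single when_def)

lemma generators_induct:
  assumes "free.subspace W" "\<And>u m. generator u m \<in> W"
  shows "p \<in> W"
proof -
  have "p = (\<Sum>k\<in>Poly_Mapping.keys p. free_scale (Poly_Mapping.lookup p k) (Poly_Mapping.single k 1))"
    by (rule poly_mapping_eqI)
      (simp add: lookup_sum lookup_free_scale lookup_single when_def mult_delta_right in_keys_iff)
  also have "\<dots> \<in> W"
    using assms by (intro free.subspace_sum free.subspace_scale) auto
  finally show ?thesis .
qed

lemma prepend_letter_superset:
  assumes "finite S" "Poly_Mapping.keys p \<subseteq> S"
  shows "prepend_letter x p = (\<Sum>k\<in>S. Poly_Mapping.single (x # fst k, snd k) (Poly_Mapping.lookup p k))"
proof -
  have "prepend_letter x p = (\<Sum>k\<in>Poly_Mapping.keys p. Poly_Mapping.single (x # fst k, snd k) (Poly_Mapping.lookup p k))"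
    unfolding prepend_letter_def by (rule sum.cong) auto
  also have "\<dots> = (\<Sum>k\<in>S. Poly_Mapping.single (x # fst k, snd k) (Poly_Mapping.lookup p k))"
    by (rule sum.mono_neutral_left) (use assms in \<open>auto simp: in_keys_iff\<close>)
  finally show ?thesis .
qed

lemma prepend_letter_add: "prepend_letter x (p + q) = prepend_letter x p + prepend_letter x q"
proof -
  let ?S = "Poly_Mapping.keys p \<union> Poly_Mapping.keys q"
  have "Poly_Mapping.keys (p + q) \<subseteq> ?S" by (rule keys_add)
  then show ?thesis
    by (simp add: prepend_letter_superset[of ?S] lookup_add single_add sum.distrib)
qed

lemma prepend_letter_scale: "prepend_letter x (free_scale c p) = free_scale c (prepend_letter x p)"
proof -
  let ?S = "Poly_Mapping.keys p"
  have "Poly_Mapping.keys (free_scale c p) \<subseteq> ?S" by (auto simp: in_keys_iff lookup_free_scale)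
  then show ?thesis
    by (simp add: prepend_letter_superset[of ?S] lookup_free_scale free.scale_sum_right single_scale)
qed

lemma prepend_letter_generator: "prepend_letter x (generator u m) = generator (x # u) m"
  by (subst prepend_letter_superset[of "{(u, m)}"]) auto

context lie_algebra_form
begin

type_synonym 'h free_module = "('h affine list \<times> complex) \<Rightarrow>\<^sub>0 complex"

abbreviation relations :: "'g free_module set" where
  "relations \<equiv> induced_relations (affine_scale s) abr affine_plus (*) (\<lambda>x z. snd x * z)"

definition relation_space :: "'g free_module set" where
  "relation_space = free_span relations"

lemma relation_space_subspace: "free.subspace relation_space"
  by (simp add: relation_space_def)

lemma relation_in_space: "r \<in> relations \<Longrightarrow> r \<in> relation_space"
  by (simp add: relation_space_def free.span_base)

lemma prepend_letter_minus: "prepend_letter x (p - q) = prepend_letter x p - prepend_letter x q"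
  by (rule additive_fun_diff[of "prepend_letter x"]) (rule prepend_letter_add)

text \<open>Every relation allows an arbitrary prefix u, so a further letter in front yields a
  relation of the same kind. Letters therefore act on the quotient.\<close>

lemma prepend_letter_relations: "r \<in> relation_space \<Longrightarrow> prepend_letter x r \<in> relation_space"
proof -
  have rel: "prepend_letter x r \<in> relation_space" if "r \<in> relations" for r
    using that
  proof cases
    case (word_linear u c y z w m)
    show ?thesis
      unfolding word_linear prepend_letter_minus prepend_letter_add prepend_letter_scale prepend_letter_generator
      using induced_relations.word_linear[of "x # u" "affine_scale s" c y z w m] by (intro relation_in_space) simp
  next
    case (commutator u y z w m)
    show ?thesis
      unfolding commutator prepend_letter_minus prepend_letter_generator
      using induced_relations.commutator[of "x # u" y z w m] by (intro relation_in_space) simp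
  next
    case (vector_linear u c m m')
    show ?thesis
      unfolding vector_linear prepend_letter_minus prepend_letter_add prepend_letter_scale prepend_letter_generator
      using induced_relations.vector_linear[where u = "x # u" and sM = "(*)" and c = c and m = m and m' = m'] by (intro relation_in_space) simp
  next
    case (balanced h u m)
    show ?thesis
      unfolding balanced prepend_letter_minus prepend_letter_generator
      using induced_relations.balanced[OF balanced(2), of "x # u" m] by (intro relation_in_space) simp
  qed
  assume "r \<in> relation_space"
  then show ?thesis
    unfolding relation_space_def
  proof (induction rule: free.span_induct_alt)
    case base
    have "prepend_letter x (0 :: 'g free_module) = 0" by (rule additive_fun_zero) (rule prepend_letter_add)
    then show ?case by (simp add: free.span_zero)
  next
    case (step c y z)
    then show ?case
      using rel[OF step(1)] unfolding relation_space_def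
      by (simp add: prepend_letter_add prepend_letter_scale free.span_add free.span_scale)
  qed
qed

text \<open>The quotient by the relations is identified with the range of a linear projection along them.\<close>

lemma projection_exists:
  "\<exists>\<pi>. Vector_Spaces.linear free_scale free_scale \<pi> \<and> (\<forall>p. \<pi> p = 0 \<longleftrightarrow> p \<in> relation_space) \<and> (\<forall>p. p - \<pi> p \<in> relation_space)"
proof -
  interpret P: vector_space_pair "free_scale :: complex \<Rightarrow> 'g free_module \<Rightarrow> _" "free_scale :: complex \<Rightarrow> 'g free_module \<Rightarrow> _"
    by unfold_locales
  have "Vector_Spaces.linear free_scale free_scale (\<lambda>x :: 'g free_module. x)"
    by (rule free.linear_ident)
  from P.linear_exists_left_inverse_on[OF this relation_space_subspace]
  obtain g where g: "range g \<subseteq> relation_space" "Vector_Spaces.linear free_scale free_scale g" "\<forall>v\<in>relation_space. g v = v"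
    by auto
  have "Vector_Spaces.linear free_scale free_scale (\<lambda>p. p - g p)"
    using linear_map_add[OF g(2)] linear_map_scale[OF g(2)] free.vector_space_axioms
    by (simp add: Vector_Spaces.linear_iff free.scale_right_diff_distrib)
  moreover have "p - g p = 0 \<longleftrightarrow> p \<in> relation_space" for p using g by auto
  ultimately show ?thesis using g(1) by (intro exI[of _ "\<lambda>p. p - g p"]) auto
qed

definition proj :: "'g free_module \<Rightarrow> 'g free_module" where
  "proj = (SOME \<pi>. Vector_Spaces.linear free_scale free_scale \<pi> \<and> (\<forall>p. \<pi> p = 0 \<longleftrightarrow> p \<in> relation_space)
     \<and> (\<forall>p. p - \<pi> p \<in> relation_space))"

lemma proj: "Vector_Spaces.linear free_scale free_scale proj" "proj p = 0 \<longleftrightarrow> p \<in> relation_space" "p - proj p \<in> relation_space"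
  using someI_ex[OF projection_exists] unfolding proj_def[symmetric] by auto

lemma proj_add: "proj (p + q) = proj p + proj q"
  and proj_scale: "proj (free_scale c p) = free_scale c (proj p)"
  using linear_map_add[OF proj(1)] linear_map_scale[OF proj(1)] by auto

lemma proj_diff: "proj (p - q) = proj p - proj q"
  by (rule additive_fun_diff[of proj]) (rule proj_add)

lemma proj_zero [simp]: "proj 0 = 0"
  by (rule additive_fun_zero[of proj]) (rule proj_add)

lemma proj_eq_iff: "proj p = proj q \<longleftrightarrow> p - q \<in> relation_space"
  using proj(2)[of "p - q"] by (simp add: proj_diff)

lemma proj_relation: "r \<in> relations \<Longrightarrow> proj r = 0"
  using proj(2) relation_in_space by blast

lemma proj_proj [simp]: "proj (proj p) = proj p"
  using proj(2)[of "p - proj p"] proj(3)[of p] by (simp add: proj_diff)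

definition letter :: "'g affine \<Rightarrow> 'g free_module \<Rightarrow> 'g free_module" where
  "letter x p = proj (prepend_letter x p)"

definition vacuum_vector :: "'g free_module" where
  "vacuum_vector = proj (generator [] 1)"

lemma letter_proj: "letter x (proj p) = letter x p"
proof -
  have "prepend_letter x (p - proj p) \<in> relation_space" by (rule prepend_letter_relations) (rule proj(3))
  then show ?thesis by (simp add: letter_def proj_eq_iff[symmetric] prepend_letter_minus)
qed

lemma letter_add: "letter x (p + q) = letter x p + letter x q"
  and letter_scale: "letter x (free_scale c p) = free_scale c (letter x p)"
  by (simp_all add: letter_def prepend_letter_add prepend_letter_scale proj_add proj_scale)

lemma linear_agree_on_generators:
  assumes "\<And>p q. f (p + q) = f p + f q" "\<And>c p. f (free_scale c p) = free_scale c (f p)"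
    and "\<And>p q. g (p + q) = g p + g q" "\<And>c p. g (free_scale c p) = free_scale c (g p)"
    and "\<And>u m. f (generator u m) = g (generator u m)"
  shows "f p = (g p :: 'g free_module)"
proof -
  have "f 0 = 0" "g 0 = 0" using additive_fun_zero[of f, OF assms(1)] additive_fun_zero[of g, OF assms(3)] by auto
  then have "free.subspace {p. f p = g p}" by (simp add: free.subspace_def assms(1-4))
  then have "p \<in> {p. f p = g p}" by (rule generators_induct) (simp add: assms(5))
  then show ?thesis by simp
qed

lemma letter_generator: "letter x (generator u m) = proj (generator (x # u) m)"
  by (simp add: letter_def prepend_letter_generator)

lemma letter_word_linear:
  "letter (affine_scale s c x + y) p = free_scale c (letter x p) + letter y p"
proof (rule linear_agree_on_generators[where f = "letter (affine_scale s c x + y)"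
      and g = "\<lambda>p. free_scale c (letter x p) + letter y p"])
  fix u m
  have "proj (generator ((affine_scale s c x + y) # u) m
      - (free_scale c (generator (x # u) m) + generator (y # u) m)) = 0"
    using induced_relations.word_linear[of "[]" "affine_scale s" c x y u m] by (intro proj_relation) simp
  then show "letter (affine_scale s c x + y) (generator u m)
    = free_scale c (letter x (generator u m)) + letter y (generator u m)"
    by (simp add: letter_generator proj_diff proj_add proj_scale)
qed (simp_all add: letter_add letter_scale free.scale_right_distrib free.scale_left_commute algebra_simps)

lemma affine_scale_one: "affine_scale s 1 x = x"
  by (rule affine_eqI) auto

lemma letter_add_left: "letter (x + y) p = letter x p + letter y p"
  using letter_word_linear[of 1 x y p] by (simp add: affine_scale_one)

lemma letter_scale_left: "letter (affine_scale s c x) p = free_scale c (letter x p)"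
proof -
  have "letter 0 p = 0" using letter_add_left[of 0 0 p] by simp
  then show ?thesis using letter_word_linear[of c x 0 p] by simp
qed

lemma letter_letter_generator: "letter x (letter y (generator u m)) = proj (generator (x # y # u) m)"
  by (simp add: letter_generator letter_proj)

lemma letter_bracket: "letter x (letter y p) - letter y (letter x p) = letter (abr x y) p"
proof (rule linear_agree_on_generators[where f = "\<lambda>p. letter x (letter y p) - letter y (letter x p)"
      and g = "letter (abr x y)"])
  fix u m
  have "proj (generator (x # y # u) m - generator (y # x # u) m - generator (abr x y # u) m) = 0"
    using induced_relations.commutator[of "[]" x y u m] by (intro proj_relation) simp
  then show "letter x (letter y (generator u m)) - letter y (letter x (generator u m)) = letter (abr x y) (generator u m)"
    unfolding letter_letter_generator by (simp add: letter_generator proj_diff)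
qed (simp_all add: letter_add letter_scale free.scale_right_diff_distrib)

text \<open>Linearity in the module vector is imposed only as a relation, so even the generator with
  vector 0 must be shown to die in the quotient.\<close>

lemma proj_generator_scalar: "proj (generator u m) = free_scale m (proj (generator u 1))"
proof -
  have z: "proj (generator u 0) = 0"
  proof -
    have "proj (generator u (1 * 0 + 0) - (free_scale 1 (generator u 0) + generator u 0)) = 0"
      by (rule proj_relation) (rule induced_relations.vector_linear)
    then have "proj (generator u 0) = proj (generator u 0) + proj (generator u 0)"
      by (simp only: proj_diff proj_add free.scale_one mult_1 add_0_right eq_iff_diff_eq_0[symmetric])
    then show ?thesis by simp
  qed
  have "proj (generator u (m * 1 + 0) - (free_scale m (generator u 1) + generator u 0)) = 0"
    by (rule proj_relation) (rule induced_relations.vector_linear)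
  then show ?thesis using z by (simp add: proj_diff proj_add proj_scale)
qed

lemma letter_vacuum:
  assumes "h \<in> affine_plus" shows "letter h vacuum_vector = free_scale (snd h) vacuum_vector"
proof -
  have "proj (generator ([] @ [h]) 1 - generator [] (snd h * 1)) = 0"
    by (rule proj_relation) (rule induced_relations.balanced[OF assms])
  then show ?thesis
    using proj_generator_scalar[of "[]" "snd h"]
    by (simp add: vacuum_vector_def letter_proj letter_generator proj_diff)
qed

lemma affine_module_vacuum: "affine_module s br \<kappa> free_scale letter vacuum_vector (range proj)"
proof (unfold_locales)
  show "free.subspace (range proj)"
    unfolding free.subspace_def
  proof (intro conjI ballI allI)
    show "0 \<in> range proj" using proj_zero by (metis rangeI)
  qed (auto simp: proj_add[symmetric] proj_scale[symmetric])
  show "vacuum_vector \<in> range proj" by (simp add: vacuum_vector_def)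
  show "letter x v \<in> range proj" for x v by (simp add: letter_def)
  show "letter (fps_to_fls f, 0) vacuum_vector = 0" for f
    by (subst letter_vacuum) (auto simp: affine_plus_def)
  show "letter (0, 1) vacuum_vector = vacuum_vector"
  proof -
    have "(0, 1) \<in> (affine_plus :: 'g affine set)" unfolding affine_plus_def using fps_zero_to_fls by (metis (mono_tags, lifting) CollectI)
    then show ?thesis by (simp add: letter_vacuum)
  qed
  fix W assume W: "free.subspace W" "vacuum_vector \<in> W" "\<And>x v. v \<in> W \<Longrightarrow> letter x v \<in> W"
  have words: "proj (generator u 1) \<in> W" for u
  proof (induction u)
    case Nil
    then show ?case using W(2) by (simp add: vacuum_vector_def)
  next
    case (Cons x u)
    then show ?case using W(3)[OF Cons, of x] by (simp add: letter_proj letter_generator)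
  qed
  have "free.subspace {p. proj p \<in> W}"
    using W(1) by (simp add: free.subspace_def proj_add proj_scale)
  then have "p \<in> {p. proj p \<in> W}" for p
  proof (rule generators_induct)
    show "generator u m \<in> {p. proj p \<in> W}" for u m
      using words[of u] W(1) by (subst mem_Collect_eq, subst proj_generator_scalar) (rule free.subspace_scale)
  qed
  then show "range proj \<subseteq> W" by auto
qed (simp_all add: letter_add letter_scale letter_add_left letter_scale_left letter_bracket)

text \<open>The linear extension of the expectation to the free space. It vanishes on all relations,
  so a combination of generators with nonzero evaluation stays nonzero in the quotient.\<close>

definition evaluation :: "'g free_module \<Rightarrow> complex" where
  "evaluation p = (\<Sum>k\<in>Poly_Mapping.keys p. Poly_Mapping.lookup p k * (snd k * expectation (fst k)))"

lemma evaluation_superset: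
  assumes "finite S" "Poly_Mapping.keys p \<subseteq> S"
  shows "evaluation p = (\<Sum>k\<in>S. Poly_Mapping.lookup p k * (snd k * expectation (fst k)))"
  unfolding evaluation_def by (rule sum.mono_neutral_left) (use assms in \<open>auto simp: in_keys_iff\<close>)

lemma evaluation_add: "evaluation (p + q) = evaluation p + evaluation q"
proof -
  let ?S = "Poly_Mapping.keys p \<union> Poly_Mapping.keys q"
  have "Poly_Mapping.keys (p + q) \<subseteq> ?S" by (rule keys_add)
  then show ?thesis
    by (simp add: evaluation_superset[of ?S] lookup_add sum.distrib distrib_right)
qed

lemma evaluation_scale: "evaluation (free_scale c p) = c * evaluation p"
proof -
  let ?S = "Poly_Mapping.keys p"
  have "Poly_Mapping.keys (free_scale c p) \<subseteq> ?S" by (auto simp: in_keys_iff lookup_free_scale)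
  then show ?thesis
    by (simp add: evaluation_superset[of ?S] lookup_free_scale sum_distrib_left mult.assoc)
qed

lemma evaluation_diff: "evaluation (p - q) = evaluation p - evaluation q"
  by (rule additive_fun_diff[of evaluation]) (rule evaluation_add)

lemma evaluation_generator: "evaluation (generator u m) = m * expectation u"
  by (subst evaluation_superset[of "{(u, m)}"]) auto

lemma evaluation_relations: "r \<in> relation_space \<Longrightarrow> evaluation r = 0"
  unfolding relation_space_def
proof (induction rule: free.span_induct_alt)
  case base
  show ?case by (rule additive_fun_zero[of evaluation]) (rule evaluation_add)
next
  case (step c r p)
  have "evaluation r = 0" using step(1)
  proof cases
    case (word_linear u c x y w m)
    show ?thesis
      unfolding word_linear evaluation_diff evaluation_add evaluation_scale evaluation_generator
      by (simp only: slot_additiveD[OF expectation_linear(1)] slot_homogeneousD[OF expectation_linear(2)] algebra_simps) simp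
  next
    case (commutator u x y w m)
    show ?thesis
      unfolding commutator evaluation_diff evaluation_generator expectation_commutator[symmetric]
      by (simp add: right_diff_distrib)
  next
    case (vector_linear u c m m')
    show ?thesis
      unfolding vector_linear evaluation_diff evaluation_add evaluation_scale evaluation_generator
      by (simp add: algebra_simps)
  next
    case (balanced h u m)
    show ?thesis
      unfolding balanced evaluation_diff evaluation_generator
      using balanced(2) by (simp add: expectation_balanced)
  qed
  then show ?case using step(2) by (simp add: evaluation_add evaluation_scale)
qed

lemma vacuum_vector_nonzero: "vacuum_vector \<noteq> 0"
proof
  assume "vacuum_vector = 0"
  then have "generator [] 1 \<in> relation_space" using proj(2) by (simp add: vacuum_vector_def)
  from evaluation_relations[OF this] show False by (simp add: evaluation_generator)
qed

end

sublocale noncritical_level \<subseteq> vac: sugawara_module s br \<kappa> free_scale letter vacuum_vector "range proj" E dual Om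
proof -
  interpret affine_module s br \<kappa> free_scale letter vacuum_vector "range proj" by (rule affine_module_vacuum)
  show "sugawara_module s br \<kappa> free_scale letter vacuum_vector (range proj) E dual Om"
    by unfold_locales (use E_basis Om_sym Om_invariant Om_add Om_scale dual_basis_expansion casimir_identity in auto)
qed

section \<open>Relative cohomology of the vacuum module\<close>

context noncritical_level
begin

abbreviation V\<^sub>\<kappa> where "V\<^sub>\<kappa> \<equiv> vacuum_module s br \<kappa>"

text \<open>A coset of the relations is a fibre of \<open>proj\<close>, with the fixed point of the
  projection as its representative. This translates between the vector space model and the elements
  of the vacuum module.\<close>

definition cls :: "'g free_module \<Rightarrow> 'g vacuum" where
  "cls v = {p. proj p = v}"

lemma cls_inject: "v \<in> range proj \<Longrightarrow> cls v = cls w \<longleftrightarrow> v = w"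
  unfolding cls_def by auto

lemma coset_eq_cls: "free_span relations +>\<^bsub>free_space\<^esub> p = cls (proj p)"
proof -
  have "free_span relations +>\<^bsub>free_space\<^esub> p = {h + p | h. h \<in> relation_space}"
    by (auto simp: a_r_coset_def' relation_space_def free_space_def)
  also have "\<dots> = {q. q - p \<in> relation_space}"
    by (auto intro!: exI[of _ "_ - p"])
  finally show ?thesis by (simp add: cls_def proj_eq_iff)
qed

lemma vacuum_module_eq:
  "carrier V\<^sub>\<kappa> = cls ` range proj" "\<zero>\<^bsub>V\<^sub>\<kappa>\<^esub> = cls 0"
  "v \<in> range proj \<Longrightarrow> w \<in> range proj \<Longrightarrow> cls v \<oplus>\<^bsub>V\<^sub>\<kappa>\<^esub> cls w = cls (v + w)"
  "v \<in> range proj \<Longrightarrow> c \<odot>\<^bsub>V\<^sub>\<kappa>\<^esub> cls v = cls (free_scale c v)"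
  "v \<in> range proj \<Longrightarrow> vacuum_action s br \<kappa> x (cls v) = cls (letter x v)"
proof -
  have self: "v \<in> cls v" if "v \<in> range proj" for v using that by (auto simp: cls_def)
  show "carrier V\<^sub>\<kappa> = cls ` range proj"
  proof -
    have c: "carrier free_space = UNIV" by (simp add: free_space_def)
    show ?thesis
      unfolding vacuum_module_def induced_module_def quotient_space_def
      by (auto simp: A_RCOSETS_def' coset_eq_cls c)
  qed
  show "\<zero>\<^bsub>V\<^sub>\<kappa>\<^esub> = cls 0"
    by (simp add: vacuum_module_def induced_module_def quotient_space_def cls_def proj(2) relation_space_def)
  show "cls v \<oplus>\<^bsub>V\<^sub>\<kappa>\<^esub> cls w = cls (v + w)" if v: "v \<in> range proj" and w: "w \<in> range proj"
  proof -
    have "cls v \<oplus>\<^bsub>V\<^sub>\<kappa>\<^esub> cls w = {p + q | p q. p \<in> cls v \<and> q \<in> cls w}"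
      by (auto simp: vacuum_module_def induced_module_def quotient_space_def set_add_def' free_space_def)
    also have "\<dots> = cls (v + w)"
    proof (intro equalityI subsetI)
      fix p assume "p \<in> cls (v + w)"
      then have "p - v \<in> cls w" using v by (auto simp: cls_def proj_diff)
      then show "p \<in> {p + q | p q. p \<in> cls v \<and> q \<in> cls w}" using self[OF v]
        by (intro CollectI exI[of _ v] exI[of _ "p - v"]) auto
    qed (auto simp: cls_def proj_add)
    finally show ?thesis .
  qed
  show "c \<odot>\<^bsub>V\<^sub>\<kappa>\<^esub> cls v = cls (free_scale c v)" if v: "v \<in> range proj"
  proof -
    have "c \<odot>\<^bsub>V\<^sub>\<kappa>\<^esub> cls v = (\<Union>p\<in>cls v. free_span relations +>\<^bsub>free_space\<^esub> free_scale c p)"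
      by (simp add: vacuum_module_def induced_module_def quotient_space_def free_space_def)
    also have "\<dots> = cls (free_scale c v)"
      unfolding coset_eq_cls proj_scale using self[OF v] by (auto simp: cls_def)
    finally show ?thesis .
  qed
  show "vacuum_action s br \<kappa> x (cls v) = cls (letter x v)" if v: "v \<in> range proj"
  proof -
    have "vacuum_action s br \<kappa> x (cls v) = (\<Union>p\<in>cls v. cls (letter x (proj p)))"
      by (simp add: vacuum_action_def induced_action_def coset_eq_cls letter_proj) (simp add: letter_def)
    also have "\<dots> = cls (letter x v)" using self[OF v] by (auto simp: cls_def)
    finally show ?thesis .
  qed
qed

lemmas range_closed = vac.Vc_closed

lemma vacuum_abelian_group: "abelian_group V\<^sub>\<kappa>"
proof (rule abelian_groupI)
  fix x y z assume "x \<in> carrier V\<^sub>\<kappa>" "y \<in> carrier V\<^sub>\<kappa>" "z \<in> carrier V\<^sub>\<kappa>"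
  then obtain u v w where uvw: "x = cls u" "y = cls v" "z = cls w" "u \<in> range proj" "v \<in> range proj" "w \<in> range proj"
    unfolding vacuum_module_eq(1) by blast
  show "x \<oplus>\<^bsub>V\<^sub>\<kappa>\<^esub> y \<in> carrier V\<^sub>\<kappa>" "x \<oplus>\<^bsub>V\<^sub>\<kappa>\<^esub> y = y \<oplus>\<^bsub>V\<^sub>\<kappa>\<^esub> x" "(x \<oplus>\<^bsub>V\<^sub>\<kappa>\<^esub> y) \<oplus>\<^bsub>V\<^sub>\<kappa>\<^esub> z = x \<oplus>\<^bsub>V\<^sub>\<kappa>\<^esub> (y \<oplus>\<^bsub>V\<^sub>\<kappa>\<^esub> z)"
    "\<zero>\<^bsub>V\<^sub>\<kappa>\<^esub> \<oplus>\<^bsub>V\<^sub>\<kappa>\<^esub> x = x"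
    using uvw range_closed by (auto simp: vacuum_module_eq algebra_simps)
  show "\<exists>y\<in>carrier V\<^sub>\<kappa>. y \<oplus>\<^bsub>V\<^sub>\<kappa>\<^esub> x = \<zero>\<^bsub>V\<^sub>\<kappa>\<^esub>"
    using uvw(1,4) range_closed(5)[OF uvw(4)] vacuum_module_eq(1) vacuum_module_eq(3)[of "- u" u]
    by (intro bexI[of _ "cls (- u)"]) (auto simp: vacuum_module_eq(2))
qed (auto simp: vacuum_module_eq intro: range_closed)

interpretation Vg: abelian_group V\<^sub>\<kappa> by (rule vacuum_abelian_group)

lemma cls_finsum:
  assumes "finite I" "\<And>i. i \<in> I \<Longrightarrow> f i \<in> range proj"
  shows "(\<Oplus>\<^bsub>V\<^sub>\<kappa>\<^esub>i\<in>I. cls (f i)) = cls (\<Sum>i\<in>I. f i)"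
  using assms
proof (induction I rule: finite_induct)
  case (insert i I)
  have "(\<Oplus>\<^bsub>V\<^sub>\<kappa>\<^esub>i\<in>insert i I. cls (f i)) = cls (f i) \<oplus>\<^bsub>V\<^sub>\<kappa>\<^esub> (\<Oplus>\<^bsub>V\<^sub>\<kappa>\<^esub>i\<in>I. cls (f i))"
    using insert by (intro Vg.finsum_insert) (auto simp: vacuum_module_eq(1))
  then show ?case using insert range_closed(6)[of I f] by (simp add: vacuum_module_eq(3))
qed (simp add: vacuum_module_eq(2))

lemma cls_minus:
  assumes "v \<in> range proj" "w \<in> range proj"
  shows "cls v \<ominus>\<^bsub>V\<^sub>\<kappa>\<^esub> cls w = cls (v - w)"
proof -
  have n: "- w \<in> range proj" using assms range_closed by blast
  have "\<ominus>\<^bsub>V\<^sub>\<kappa>\<^esub> cls w = cls (- w)"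
    by (rule Vg.minus_equality) (use assms n in \<open>auto simp: vacuum_module_eq\<close>)
  then show ?thesis using assms n by (simp add: a_minus_def vacuum_module_eq)
qed

abbreviation lift :: "('g fps list \<Rightarrow> 'g free_module) \<Rightarrow> 'g fps list \<Rightarrow> 'g vacuum" where
  "lift \<phi> \<equiv> (\<lambda>xs. cls (\<phi> xs))"

lemma cochain_values: "vac.cochain n \<phi> \<Longrightarrow> \<phi> xs \<in> range proj"
  using vac.mode_cochainD(1) by (auto simp: vac.cochain_def)

text \<open>Finite sums of pure tensors are exactly the truncated alternating multilinear functions.
  Working with the latter description, the operators need no tensor decompositions.\<close>

lemma tensor_wedge_eq: "tensor_wedge V\<^sub>\<kappa> (continuous_dual s) n = lift ` {\<phi>. vac.cochain n \<phi>}"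
proof (intro equalityI subsetI)
  have pure: "pure_cochain V\<^sub>\<kappa> (cls v) \<xi>s = lift (vac.pure_function v \<xi>s)" if "v \<in> range proj" for v \<xi>s
    using that by (intro ext) (simp add: pure_cochain_def vac.pure_function_def vacuum_module_eq)
  have val: "vac.pure_function v \<xi>s xs \<in> range proj" if "v \<in> range proj" for v \<xi>s xs
    using that range_closed by (simp add: vac.pure_function_def)
  fix \<Phi> :: "'g fps list \<Rightarrow> 'g vacuum"
  {
    assume "\<Phi> \<in> tensor_wedge V\<^sub>\<kappa> (continuous_dual s) n"
    then have "\<exists>\<phi>\<in>vac.tensor_functions n. \<Phi> = lift \<phi>"
    proof induction
      case zero
      show ?case by (rule bexI[OF _ vac.tensor_functions.zero]) (simp add: vacuum_module_eq)
    next
      case (add_pure \<Phi> v \<xi>s)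
      then obtain \<phi> w where \<phi>: "\<phi> \<in> vac.tensor_functions n" "\<Phi> = lift \<phi>" "v = cls w" "w \<in> range proj"
        unfolding vacuum_module_eq(1) by blast
      have "\<phi> xs \<in> range proj" for xs
        using vac.tensor_functions_cochain[OF \<phi>(1)] cochain_values by blast
      then have "(\<lambda>xs. \<Phi> xs \<oplus>\<^bsub>V\<^sub>\<kappa>\<^esub> pure_cochain V\<^sub>\<kappa> v \<xi>s xs) = lift (\<lambda>xs. \<phi> xs + vac.pure_function w \<xi>s xs)"
        by (simp add: \<phi> pure vacuum_module_eq(3) val)
      then show ?case
        by (intro bexI[OF _ vac.tensor_functions.add_pure[OF \<phi>(1,4) add_pure(3,4)]])
    qed
    then show "\<Phi> \<in> lift ` {\<phi>. vac.cochain n \<phi>}" using vac.tensor_functions_cochain by blast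
  next
    assume "\<Phi> \<in> lift ` {\<phi>. vac.cochain n \<phi>}"
    then obtain \<phi> where "\<phi> \<in> vac.tensor_functions n" "\<Phi> = lift \<phi>" using vac.cochain_tensor_functions by blast
    then show "\<Phi> \<in> tensor_wedge V\<^sub>\<kappa> (continuous_dual s) n"
    proof (induction arbitrary: \<Phi>)
      case zero
      then show ?case using tensor_wedge.zero[of "V\<^sub>\<kappa>"] by (simp add: vacuum_module_eq)
    next
      case (add_pure \<phi> v \<xi>s)
      have "\<phi> xs \<in> range proj" for xs
        using vac.tensor_functions_cochain[OF add_pure(1)] cochain_values by blast
      then have "\<Phi> = (\<lambda>xs. lift \<phi> xs \<oplus>\<^bsub>V\<^sub>\<kappa>\<^esub> pure_cochain V\<^sub>\<kappa> (cls v) \<xi>s xs)"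
        by (simp add: add_pure pure vacuum_module_eq(3) val)
      moreover have "cls v \<in> carrier V\<^sub>\<kappa>" using add_pure(2) by (simp add: vacuum_module_eq(1))
      ultimately show ?case
        using tensor_wedge.add_pure[OF add_pure.IH[OF refl] _ add_pure(3,4)] by simp
    qed
  }
qed

abbreviation vacuum_act :: "'g fps \<Rightarrow> 'g vacuum \<Rightarrow> 'g vacuum" where
  "vacuum_act \<equiv> \<lambda>f. vacuum_action s br \<kappa> (fps_to_fls f, 0)"

lemma vacuum_act_cls: "v \<in> range proj \<Longrightarrow> vacuum_act f (cls v) = cls (vac.act f v)"
  by (simp add: vacuum_module_eq vac.act_def)

lemma relative_cochains_eq:
  "relative_cochains s br V\<^sub>\<kappa> vacuum_act n = lift ` {\<phi>. vac.cochain n \<phi> \<and> vac.invariant_cochain \<phi>}"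
proof -
  have "(\<forall>a xs. length xs = n \<longrightarrow> vacuum_act (fps_const a) (lift \<phi> xs) \<ominus>\<^bsub>V\<^sub>\<kappa>\<^esub>
            (\<Oplus>\<^bsub>V\<^sub>\<kappa>\<^esub>i\<in>{..<n}. lift \<phi> (xs[i := fps_bracket br (fps_const a) (xs ! i)])) = \<zero>\<^bsub>V\<^sub>\<kappa>\<^esub>)
    \<longleftrightarrow> vac.invariant_cochain \<phi>" if \<phi>: "vac.cochain n \<phi>" for \<phi>
  proof -
    have e1: "vacuum_act (fps_const a) (lift \<phi> xs) \<ominus>\<^bsub>V\<^sub>\<kappa>\<^esub>
            (\<Oplus>\<^bsub>V\<^sub>\<kappa>\<^esub>i\<in>{..<n}. lift \<phi> (xs[i := fps_bracket br (fps_const a) (xs ! i)]))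
        = cls (vac.lie (fps_const a) \<phi> xs)" if "length xs = n" for a xs
    proof -
      note val = cochain_values[OF \<phi>]
      have va: "vacuum_act (fps_const a) (lift \<phi> xs) = cls (vac.act (fps_const a) (\<phi> xs))"
        by (rule vacuum_act_cls) (rule val)
      have sums: "(\<Oplus>\<^bsub>V\<^sub>\<kappa>\<^esub>i\<in>{..<n}. lift \<phi> (xs[i := fps_bracket br (fps_const a) (xs ! i)]))
          = cls (\<Sum>i<n. \<phi> (xs[i := fps_bracket br (fps_const a) (xs ! i)]))"
        by (rule cls_finsum) (auto intro: val)
      show ?thesis
        unfolding va sums lie_der_def slot_der_eq_sum that add_uminus_conv_diff
        by (rule cls_minus) (auto intro!: val vac.act_closed range_closed(6))
    qed
    have e2: "cls (vac.lie (fps_const a) \<phi> xs) = \<zero>\<^bsub>V\<^sub>\<kappa>\<^esub> \<longleftrightarrow> vac.lie (fps_const a) \<phi> xs = 0" for a xs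
      using cls_inject[OF vac.lie_closed[OF cochain_values[OF \<phi>]]] by (simp add: vacuum_module_eq)
    have e3: "vac.lie (fps_const a) \<phi> xs = 0" if "length xs \<noteq> n" for a xs
      using \<phi> that slot_der_length[of xs \<phi> "fps_bracket br (fps_const a)"] by (simp add: lie_der_def vac.cochain_def)
    show ?thesis
      unfolding vac.invariant_cochain_def fun_eq_iff
      by (simp only: e1 e2 cong: imp_cong) (use e3 in blast)
  qed
  then show ?thesis unfolding relative_cochains_def tensor_wedge_eq by blast
qed

lemma diff_length:
  assumes "\<And>ys. Suc (length ys) = length xs \<Longrightarrow> \<phi> ys = 0" shows "vac.diff \<phi> xs = 0"
  using assms
proof (induction xs arbitrary: \<phi>)
  case (Cons x xs)
  have "slot_der (fps_bracket br x) \<phi> xs = 0" by (rule slot_der_length) (use Cons.prems in auto)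
  then show ?case using Cons.IH[of "\<lambda>ys. \<phi> (x # ys)"] Cons.prems by (simp add: lie_der_def)
qed simp

text \<open>Unfolding Cartan's recursion gives the two explicit sums of the differential term by
  term; on lists of any other length both sides are 0.\<close>

lemma chevalley_lift:
  assumes \<phi>: "vac.cochain n \<phi>"
  shows "chevalley_differential br V\<^sub>\<kappa> vacuum_act n (lift \<phi>) = lift (vac.diff \<phi>)"
proof
  fix xs
  note val = cochain_values[OF \<phi>]
  show "chevalley_differential br V\<^sub>\<kappa> vacuum_act n (lift \<phi>) xs = cls (vac.diff \<phi> xs)"
  proof (cases "length xs = Suc n")
    case True
    have alt: "slot_alternating \<phi>" using \<phi> vac.mode_cochainD(4) by (auto simp: vac.cochain_def)
    have t1: "(-1) ^ i \<odot>\<^bsub>V\<^sub>\<kappa>\<^esub> vacuum_act (xs ! i) (cls (\<phi> ys)) = cls (free_scale ((-1) ^ i) (vac.act (xs ! i) (\<phi> ys)))" for i ys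
      using val by (simp add: vacuum_act_cls vacuum_module_eq(4) vac.act_closed)
    have t2: "(-1) ^ k \<odot>\<^bsub>V\<^sub>\<kappa>\<^esub> cls (\<phi> ys) = cls (free_scale ((-1) ^ k) (\<phi> ys))" for k ys
      using val by (simp add: vacuum_module_eq)
    have c1: "free_scale k (vac.act x (\<phi> ys)) \<in> range proj" "free_scale k (\<phi> ys) \<in> range proj" for k x ys
      using val by (auto intro!: range_closed vac.act_closed)
    have c2: "(\<Sum>i\<in>I. free_scale (k i) (\<phi> (f i))) \<in> range proj" "(\<Sum>i\<in>I. free_scale (k i) (vac.act (h i) (\<phi> (f i)))) \<in> range proj"
      "(\<Sum>j\<in>J. \<Sum>i\<in>K j. free_scale (l i j) (\<phi> (g i j))) \<in> range proj"
      for I :: "nat set" and J :: "nat set" and K :: "nat \<Rightarrow> nat set" and k f l g h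
      using c1 by (auto intro!: range_closed(6))
    have "chevalley_differential br V\<^sub>\<kappa> vacuum_act n (lift \<phi>) xs
      = cls ((\<Sum>i\<le>n. free_scale ((-1) ^ i) (vac.act (xs ! i) (\<phi> (nths xs (- {i})))))
        + (\<Sum>j\<le>n. \<Sum>i<j. free_scale ((-1) ^ (i + j)) (\<phi> (fps_bracket br (xs ! i) (xs ! j) # nths xs (- {i, j})))))"
      using True by (simp add: chevalley_differential_def t1 t2 cls_finsum c1 c2 vacuum_module_eq(3))
    also have "\<dots> = cls (vac.diff \<phi> xs)"
      by (subst cartan_diff_explicit[OF free.vector_space_axioms alt True]) simp
    finally show ?thesis .
  next
    case False
    then have "vac.diff \<phi> xs = 0" using \<phi> by (intro diff_length) (auto simp: vac.cochain_def)
    then show ?thesis using False by (simp add: chevalley_differential_def vacuum_module_eq)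
  qed
qed

lemma relative_cocycles_eq:
  "relative_cocycles s br V\<^sub>\<kappa> vacuum_act n
    = lift ` {\<phi>. vac.cochain n \<phi> \<and> vac.invariant_cochain \<phi> \<and> vac.diff \<phi> = (\<lambda>_. 0)}"
proof -
  have "lift (vac.diff \<phi>) = (\<lambda>_. \<zero>\<^bsub>V\<^sub>\<kappa>\<^esub>) \<longleftrightarrow> vac.diff \<phi> = (\<lambda>_. 0)" if "vac.cochain n \<phi>" for \<phi>
    using cls_inject[OF vac.diff_closed[OF cochain_values[OF that]]] by (simp add: vacuum_module_eq fun_eq_iff)
  then show ?thesis
    unfolding relative_cocycles_def relative_cochains_eq by (auto simp: chevalley_lift vacuum_module_eq(2))
qed

lemma relative_coboundaries_eq:
  "relative_coboundaries s br V\<^sub>\<kappa> vacuum_act (Suc n)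
    = (\<lambda>\<psi>. lift (vac.diff \<psi>)) ` {\<psi>. vac.cochain n \<psi> \<and> vac.invariant_cochain \<psi>}"
  unfolding relative_coboundaries_def relative_cochains_eq
  by (auto simp: chevalley_lift image_image intro!: image_eqI)

lemma cohomology_carrier:
  "carrier (vacuum_cohomology s br \<kappa> n) = {{(\<lambda>xs. \<beta> xs \<oplus>\<^bsub>V\<^sub>\<kappa>\<^esub> \<phi> xs) | \<beta>. \<beta> \<in> relative_coboundaries s br V\<^sub>\<kappa> vacuum_act n}
     | \<phi>. \<phi> \<in> relative_cocycles s br V\<^sub>\<kappa> vacuum_act n}"
  unfolding vacuum_cohomology_def relative_cohomology_def quotient_space_def
  by (auto simp: A_RCOSETS_def' a_r_coset_def' cochain_space_def)

lemma cohomology_zero: "\<zero>\<^bsub>vacuum_cohomology s br \<kappa> n\<^esub> = relative_coboundaries s br V\<^sub>\<kappa> vacuum_act n"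
  by (simp add: vacuum_cohomology_def relative_cohomology_def quotient_space_def)

text \<open>Every cocycle has a primitive, so its coset is the space of coboundaries itself. The
  zero cocycle shows that this coset occurs.\<close>

lemma cohomology_vanishes:
  assumes "n > 0"
  shows "carrier (vacuum_cohomology s br \<kappa> n) = {\<zero>\<^bsub>vacuum_cohomology s br \<kappa> n\<^esub>}"
proof -
  obtain m where n: "n = Suc m" using assms by (cases n) auto
  let ?Z = "relative_cocycles s br V\<^sub>\<kappa> vacuum_act n"
  let ?B = "relative_coboundaries s br V\<^sub>\<kappa> vacuum_act n"
  let ?C = "{\<psi>. vac.cochain m \<psi> \<and> vac.invariant_cochain \<psi>}"
  have lin: "(\<lambda>xs. \<psi> xs + free_scale k (\<theta> xs)) \<in> ?C"
    "vac.diff (\<lambda>xs. \<psi> xs + free_scale k (\<theta> xs)) xs = vac.diff \<psi> xs + free_scale k (vac.diff \<theta> xs)"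
    if "\<psi> \<in> ?C" "\<theta> \<in> ?C" for \<psi> \<theta> k xs
    using vac.cochain_combination[of m \<psi> \<theta> 1 k] vac.lie_combination[of _ 1 \<psi> k \<theta>] vac.diff_combination[of 1 \<psi> k \<theta>] that
    by (auto simp: vac.invariant_cochain_def)
  have dval: "vac.diff \<psi> xs \<in> range proj" if "\<psi> \<in> ?C" for \<psi> xs
    using that vac.diff_closed cochain_values by blast
  have coset: "{(\<lambda>xs. \<beta> xs \<oplus>\<^bsub>V\<^sub>\<kappa>\<^esub> \<phi> xs) | \<beta>. \<beta> \<in> ?B} = ?B" if cocycle: "\<phi> \<in> ?Z" for \<phi>
  proof -
    obtain \<phi>' where \<phi>': "\<phi> = lift \<phi>'" "vac.cochain n \<phi>'" "vac.invariant_cochain \<phi>'" "vac.diff \<phi>' = (\<lambda>_. 0)"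
      using cocycle unfolding relative_cocycles_eq by blast
    obtain M where "\<And>xs. \<phi>' xs \<in> vac.weights_below M"
      using vac.tensor_functions_cochain[OF vac.cochain_tensor_functions[OF \<phi>'(2)]] by blast
    then obtain \<theta> where \<theta>: "\<theta> \<in> ?C" "vac.diff \<theta> = \<phi>'"
      using vac.invariant_cocycle_exact[OF \<phi>'(2)[unfolded n] \<phi>'(3)] \<phi>'(4) by auto
    have B: "?B = (\<lambda>\<psi>. lift (vac.diff \<psi>)) ` ?C" unfolding n relative_coboundaries_eq ..
    have add: "(\<lambda>xs. lift (vac.diff \<psi>) xs \<oplus>\<^bsub>V\<^sub>\<kappa>\<^esub> \<phi> xs) = lift (vac.diff (\<lambda>xs. \<psi> xs + free_scale 1 (\<theta> xs)))"
      if "\<psi> \<in> ?C" for \<psi>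
      unfolding lin(2)[OF that \<theta>(1)] unfolding \<phi>'(1) \<theta>(2)[symmetric]
      using vacuum_module_eq(3)[OF dval[OF that] dval[OF \<theta>(1)]] by simp
    show ?thesis
    proof (intro equalityI subsetI)
      fix \<beta> assume "\<beta> \<in> {(\<lambda>xs. \<beta> xs \<oplus>\<^bsub>V\<^sub>\<kappa>\<^esub> \<phi> xs) | \<beta>. \<beta> \<in> ?B}"
      then obtain \<psi> where "\<psi> \<in> ?C" "\<beta> = lift (vac.diff (\<lambda>xs. \<psi> xs + free_scale 1 (\<theta> xs)))"
        unfolding B using add by auto
      then show "\<beta> \<in> ?B" unfolding B using lin(1)[OF _ \<theta>(1)] by blast
    next
      fix \<beta> assume "\<beta> \<in> ?B"
      then obtain \<psi> where \<psi>: "\<psi> \<in> ?C" "\<beta> = lift (vac.diff \<psi>)" unfolding B by blast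
      \<comment> \<open>Subtracting the primitive \<theta> of \<phi> from \<psi> makes the coset
        shift by \<phi> return the differential of \<psi>.\<close>
      let ?\<psi> = "\<lambda>xs. \<psi> xs + free_scale (- 1) (\<theta> xs)"
      have "?\<psi> \<in> ?C" by (rule lin(1)[OF \<psi>(1) \<theta>(1)])
      moreover have "(\<lambda>xs. ?\<psi> xs + free_scale 1 (\<theta> xs)) = \<psi>" by simp
      ultimately have *: "\<beta> = (\<lambda>xs. lift (vac.diff ?\<psi>) xs \<oplus>\<^bsub>V\<^sub>\<kappa>\<^esub> \<phi> xs)" "lift (vac.diff ?\<psi>) \<in> ?B"
        using add[of ?\<psi>] \<psi>(2) unfolding B by auto
      show "\<beta> \<in> {(\<lambda>xs. \<beta> xs \<oplus>\<^bsub>V\<^sub>\<kappa>\<^esub> \<phi> xs) | \<beta>. \<beta> \<in> ?B}" by (intro CollectI exI conjI) (rule *)+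
    qed
  qed
  have zero_cocycle: "lift (\<lambda>_. 0) \<in> ?Z"
  proof -
    have "vac.cochain n (\<lambda>_. 0)" by (auto simp: vac.cochain_def vac.mode_cochain_zero)
    moreover have "vac.invariant_cochain (\<lambda>_. 0)" by (simp add: vac.invariant_cochain_def lie_der_def slot_der_zero)
    moreover have "vac.diff (\<lambda>_. 0) = (\<lambda>_. 0)" by (intro ext diff_length) simp
    ultimately show ?thesis unfolding relative_cocycles_eq by (intro image_eqI[of _ _ "\<lambda>_. 0"]) auto
  qed
  have "carrier (vacuum_cohomology s br \<kappa> n) = (\<lambda>\<phi>. {(\<lambda>xs. \<beta> xs \<oplus>\<^bsub>V\<^sub>\<kappa>\<^esub> \<phi> xs) | \<beta>. \<beta> \<in> ?B}) ` ?Z"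
    unfolding cohomology_carrier by (rule setcompr_eq_image[of _ "\<lambda>\<phi>. \<phi> \<in> ?Z", simplified])
  also have "\<dots> = (\<lambda>\<phi>. ?B) ` ?Z" by (rule image_cong[OF refl]) (rule coset)
  also have "\<dots> = {?B}" using zero_cocycle by (rule image_constant)
  finally show ?thesis unfolding cohomology_zero .
qed

definition invariant_zero_cochain :: "complex \<Rightarrow> 'g fps list \<Rightarrow> 'g free_module" where
  "invariant_zero_cochain c xs = (if xs = [] then free_scale c vacuum_vector else 0)"

text \<open>On one argument f the differential of a 0-cochain is f applied to its value, so cocycles
  are the vectors killed by g[[t]]. Invariance under constants is then automatic, which gives the
  converse inclusion.\<close>

lemma zero_cocycles: "relative_cocycles s br V\<^sub>\<kappa> vacuum_act 0 = range (\<lambda>c. lift (invariant_zero_cochain c))"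
proof -
  have "{\<phi>. vac.cochain 0 \<phi> \<and> vac.invariant_cochain \<phi> \<and> vac.diff \<phi> = (\<lambda>_. 0)} = range invariant_zero_cochain"
  proof (intro equalityI subsetI)
    fix \<phi> assume "\<phi> \<in> {\<phi>. vac.cochain 0 \<phi> \<and> vac.invariant_cochain \<phi> \<and> vac.diff \<phi> = (\<lambda>_. 0)}"
    then have \<phi>: "vac.cochain 0 \<phi>" "vac.diff \<phi> = (\<lambda>_. 0)" by auto
    have "vac.act f (\<phi> []) = 0" for f using fun_cong[OF \<phi>(2), of "[f]"] by (simp add: lie_der_def)
    then obtain c where "\<phi> [] = free_scale c vacuum_vector"
      using vac.invariant_vectors[OF cochain_values[OF \<phi>(1)]] by blast
    then have "\<phi> = invariant_zero_cochain c"
      using \<phi>(1) by (intro ext) (auto simp: invariant_zero_cochain_def vac.cochain_def)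
    then show "\<phi> \<in> range invariant_zero_cochain" by blast
  next
    fix \<phi> assume "\<phi> \<in> range invariant_zero_cochain"
    then obtain c where c: "\<phi> = invariant_zero_cochain c" by blast
    have v: "free_scale c vacuum_vector \<in> range proj" by (intro range_closed vac.vac_in)
    have ann: "vac.act f (free_scale c vacuum_vector) = 0" for f
      by (simp add: vac.act_def letter_scale vac.vac_ann)
    have "vac.mode_cochain 0 \<phi>"
      unfolding vac.mode_cochain_def slot_additive_def slot_homogeneous_def slot_alternating_def slot_vanishing_def
      using v range_closed(3) ann by (simp add: c invariant_zero_cochain_def vac.mode_nonneg)
    moreover have "slot_der T \<phi> xs = 0" for T xs
      by (cases xs) (auto simp: c invariant_zero_cochain_def slot_der_zero)
    ultimately show "\<phi> \<in> {\<phi>. vac.cochain 0 \<phi> \<and> vac.invariant_cochain \<phi> \<and> vac.diff \<phi> = (\<lambda>_. 0)}"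
    proof -
      assume m: "vac.mode_cochain 0 \<phi>" and d: "\<And>T xs. slot_der T \<phi> xs = 0"
      have "vac.lie f \<phi> xs = 0" for f xs using ann by (simp add: lie_der_def d) (simp add: c invariant_zero_cochain_def)
      moreover have "vac.diff \<phi> xs = 0" for xs
      proof (cases xs)
        case (Cons x ys)
        have "(\<lambda>zs. \<phi> (x # zs)) = (\<lambda>_. 0)" by (simp add: c invariant_zero_cochain_def)
        then show ?thesis using \<open>\<And>f xs. vac.lie f \<phi> xs = 0\<close> diff_length[of ys "\<lambda>_. 0"] by (simp add: Cons)
      qed simp
      ultimately show ?thesis using m by (auto simp: vac.cochain_def vac.invariant_cochain_def c invariant_zero_cochain_def)
    qed
  qed
  then show ?thesis unfolding relative_cocycles_eq by (simp add: image_image)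
qed

text \<open>Coboundaries in degree 0 are trivial, so each class is a singleton and the multiples of
  the vacuum parametrise them. Injectivity is the nonvanishing of the vacuum vector.\<close>

lemma zeroth_cohomology: "isomorphic_spaces (vacuum_cohomology s br \<kappa> 0) scalar_space"
proof -
  let ?H = "vacuum_cohomology s br \<kappa> 0"
  define g where "g c = {lift (invariant_zero_cochain c)}" for c
  have val: "invariant_zero_cochain c xs \<in> range proj" for c xs
    unfolding invariant_zero_cochain_def using range_closed vac.vac_in by simp
  have B: "relative_coboundaries s br V\<^sub>\<kappa> vacuum_act 0 = {\<lambda>_. cls 0}"
    by (simp add: relative_coboundaries_def vacuum_module_eq)
  have z: "(\<lambda>xs. cls 0 \<oplus>\<^bsub>V\<^sub>\<kappa>\<^esub> lift (invariant_zero_cochain c) xs) = lift (invariant_zero_cochain c)" for c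
    using vacuum_module_eq(3)[OF range_closed(3) val] by simp
  have carrier: "carrier ?H = range g"
  proof -
    have "carrier ?H = (\<lambda>\<phi>. {\<lambda>xs. cls 0 \<oplus>\<^bsub>V\<^sub>\<kappa>\<^esub> \<phi> xs}) ` range (\<lambda>c. lift (invariant_zero_cochain c))"
      unfolding cohomology_carrier zero_cocycles B by auto
    also have "\<dots> = range g" unfolding image_image g_def z ..
    finally show ?thesis .
  qed
  have add: "g a \<oplus>\<^bsub>?H\<^esub> g b = g (a + b)" for a b
  proof -
    have "invariant_zero_cochain a xs + invariant_zero_cochain b xs = invariant_zero_cochain (a + b) xs" for xs
      by (simp add: invariant_zero_cochain_def free.scale_left_distrib)
    then have "(\<lambda>xs. lift (invariant_zero_cochain a) xs \<oplus>\<^bsub>V\<^sub>\<kappa>\<^esub> lift (invariant_zero_cochain b) xs) = lift (invariant_zero_cochain (a + b))"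
      using val by (simp add: vacuum_module_eq(3))
    then show ?thesis
      by (simp add: g_def vacuum_cohomology_def relative_cohomology_def quotient_space_def set_add_def' cochain_space_def)
  qed
  have scale: "c \<odot>\<^bsub>?H\<^esub> g a = g (c * a)" for c a
  proof -
    have "free_scale c (invariant_zero_cochain a xs) = invariant_zero_cochain (c * a) xs" for xs
      by (simp add: invariant_zero_cochain_def)
    then have "c \<odot>\<^bsub>V\<^sub>\<kappa>\<^esub> lift (invariant_zero_cochain a) xs = lift (invariant_zero_cochain (c * a)) xs" for xs
      using val by (simp add: vacuum_module_eq(4))
    then show ?thesis
      using fun_cong[OF z[of "c * a"]]
      by (simp add: g_def vacuum_cohomology_def relative_cohomology_def quotient_space_def a_r_coset_def' cochain_space_def B)
  qed
  have inj: "inj g"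
  proof (rule injI)
    fix a b assume "g a = g b"
    then have "cls (invariant_zero_cochain a []) = cls (invariant_zero_cochain b [])"
      unfolding g_def by (metis singleton_inject)
    then have "invariant_zero_cochain a [] = invariant_zero_cochain b []"
      using cls_inject[OF val] by blast
    then have "free_scale (a - b) vacuum_vector = 0"
      by (simp add: invariant_zero_cochain_def free.scale_left_diff_distrib)
    then show "a = b" using vacuum_vector_nonzero by simp
  qed
  define f where "f = inv_into UNIV g"
  have fg: "f (g c) = c" for c unfolding f_def using inj by simp
  have "bij_betw f (carrier ?H) UNIV"
    unfolding carrier by (rule bij_betw_byWitness[where f' = g]) (auto simp: fg)
  moreover have "\<forall>x\<in>carrier ?H. \<forall>y\<in>carrier ?H. f (x \<oplus>\<^bsub>?H\<^esub> y) = f x + f y"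
    unfolding carrier by (auto simp: add fg)
  moreover have "\<forall>c. \<forall>x\<in>carrier ?H. f (c \<odot>\<^bsub>?H\<^esub> x) = c * f x"
    unfolding carrier by (auto simp: scale fg)
  ultimately show ?thesis
    unfolding isomorphic_spaces_def scalar_space_def by (intro exI[of _ f]) simp
qed

end

theorem proposition4p2:
  fixes s :: "complex \<Rightarrow> 'g::ab_group_add \<Rightarrow> 'g"
    and br :: "'g \<Rightarrow> 'g \<Rightarrow> 'g"
    and \<kappa> :: "'g \<Rightarrow> 'g \<Rightarrow> complex"
  assumes "simple_lie_algebra s br"
    and "complex_lie_algebra.invariant_form s br \<kappa>"
    and "\<kappa> \<noteq> complex_lie_algebra.critical_form s br"
  shows "(\<forall>i>0. carrier (vacuum_cohomology s br \<kappa> i) = {\<zero>\<^bsub>vacuum_cohomology s br \<kappa> i\<^esub>})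
       \<and> isomorphic_spaces (vacuum_cohomology s br \<kappa> 0) scalar_space"
proof -
  interpret simple_lie_algebra s br by (rule assms(1))
  interpret noncritical_level s br \<kappa>
    by unfold_locales (use assms in auto)
  show ?thesis using cohomology_vanishes zeroth_cohomology by blast
qed

end
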